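(* Let $\mu=q_*^{\frac s2+\frac12}$. In the Grothendieck ring of representations of the upper Borel part $\mathfrak b_+$ of $U_q(C^{(2)}(2))$, $$[\rho_+(\lambda\mu)\otimes\rho_-(\lambda\mu^{-1})]=\sum_{m=0}^\infty[U_{-s-2m}\otimes\mathcal W_s^{(-1)^m}(\lambda)],$$ and this can be rewritten as $$[\rho_+(q_*^{\frac s2+\frac12}\lambda)]\,[\rho_-(q_*^{-\frac s2-\frac12}\lambda)]=[\mathcal W_s^+(\lambda)]\cdot f_s,\qquad f_s:=\sum_{m=0}^\infty\sigma^m[U_{-s-2m}]=\frac{[U_{-s}]}{1-\sigma[U_{-2}]}.$$
   Context: $q=e^{\pi ib^2}$, $q_*:=-iq=e^{\pi ib_*^2}$, $b^2=b_*^2+\frac12$; $[x]_{q_*}=\frac{q_*^x-q_*^{-x}}{q_*-q_*^{-1}}$. The parameter $s$ is not restricted to nonnegative integers. $\mathfrak b_+$ is generated by odd $\mathcal E_0,\mathcal E_1$ and even $\mathcal K_0,\mathcal K_1$ with $\mathcal K_i\mathcal E_j=q^{a_{ij}}\mathcal E_j\mathcal K_i$, $(a_{ij})=\begin{pmatrix}2&-2\\-2&2\end{pmatrix}$, and the Serre relations $\mathcal E_i^3\mathcal E_j+\{3\}_q\mathcal E_i^2\mathcal E_j\mathcal E_i-\{3\}_q\mathcal E_i\mathcal E_j\mathcal E_i^2-\mathcal E_j\mathcal E_i^3=0$ ($i\ne j$), $\{3\}_q=\frac{q^3+q^{-3}}{q+q^{-1}}$. Coproduct: $\Delta(\mathcal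 E_i)=\mathcal E_i\otimes\mathcal K_i+1\otimes\mathcal E_i$, $\Delta(\mathcal K_i)=\mathcal K_i\otimes\mathcal K_i$; tensor products are super. Representations: - Prefundamental ($q$-oscillator) representations $\rho_\pm(\lambda)$: let $\alpha_+,\alpha_-$ (odd) and $\mathcal H$ satisfy $q\alpha_+\alpha_-+q^{-1}\alpha_-\alpha_+=-\frac1{q+q^{-1}}$, $[\mathcal H,\alpha_\pm]=\pm2\alpha_\pm$, with Fock modules $\Pi_\pm=\mathrm{span}\{\alpha_\pm^k|0\rangle_\pm:\ \mathcal H|0\rangle_\pm=0,\ \alpha_\mp|0\rangle_\pm=0\}_{k\ge0}$, the vacuum vectors being even. $\rho_\pm(\lambda)$ is given by $\mathcal E_1=\lambda\alpha_\pm$, $\mathcal E_0=\lambda\alpha_\mp$, $\mathcal K_1=q^{\pm\mathcal H}$, $\mathcal K_0=q^{\mp\mathcal H}$, acting on $\Pi_\mp$. - $\mathcal W_s^\pm(\lambda)$ (evaluation Verma module): basis $|k\rangle_\pm$, $k\ge0$, with $|k\rangle_\pm$ even when $\pm(-1)^k=+1$ and odd otherwise; $\mathcal E_0|k\rangle_\pm=\lambda|k+1\rangle_\pm$, $\mathcal E_1|k\rangle_\pm=\lambda[k]_{q_*}[s-k+1]_{q_*}|k-1\rangle_\pm$, $\mathcal K_0|k\rangle_\pm=\pm(-1)^kq_*^{2k-s}|k\rangle_\pm$, $\mathcal K_1|k\rangle_\pm=\pm(-1)^kq_*^{-2k+s}|k\rangle_\pm$. In $\mathcal W_s^{(-1)^m}$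 the superscript denotes the sign. - $U_p=U_p^+$: one-dimensional with even generator, $\mathcal E_0,\mathcal E_1$ acting as $0$, $\mathcal K_1,\mathcal K_0$ acting as $q_*^p,q_*^{-p}$. $U_p^-$: one-dimensional with odd generator, $\mathcal E_i$ acting as $0$ and $\mathcal K_1,\mathcal K_0$ as $-q_*^p,-q_*^{-p}$, so that $U_m^{\epsilon_1}\otimes U_n^{\epsilon_2}\simeq U_{m+n}^{\epsilon_1\epsilon_2}$, $U_0^-\otimes\mathcal W_s^\pm\simeq\mathcal W_s^\mp$ and $U_0^-\otimes U_p^\pm\simeq U_p^\mp$. The parity element is $\sigma:=[U_0^-]$; thus $\sigma^2=1$, $\sigma[\mathcal W_s^\pm]=[\mathcal W_s^\mp]$, $\sigma[U_p^\pm]=[U_p^\mp]$, and $[U_0]=1$.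
   Formalization: It is assumed that q is not a root of unity (otherwise a power of σ[U_{-2}] is 1 and 1/(1-σ[U_{-2}]) does not exist); the Grothendieck ring is that of category O, and infinite sums are classes of direct sums lying in it. *)

theory Defs
  imports
    Complex_Main
    "HOL-Library.Poly_Mapping"
    "HOL-Library.Nat_Bijection"
    "HOL-Algebra.QuotRing"
    "HOL-Algebra.Generated_Groups"
begin

section \<open>Deformation parameters\<close>

definition qpar :: "complex \<Rightarrow> complex"
  where "qpar b = exp (\<i> * of_real pi * b\<^sup>2)"

text \<open>\<open>qspow bs x\<close> is \<open>q\<^sub>*\<^sup>x = exp (\<pi> i b\<^sub>*\<^sup>2 x)\<close>, so no choice of logarithm of \<open>q\<^sub>*\<close> is involved.\<close>

definition qspow :: "complex \<Rightarrow> complex \<Rightarrow> complex"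
  where "qspow bs x = exp (\<i> * of_real pi * bs\<^sup>2 * x)"

definition qsnum :: "complex \<Rightarrow> complex \<Rightarrow> complex"
  where "qsnum bs x = (qspow bs x - qspow bs (- x)) / (qspow bs 1 - qspow bs (- 1))"

definition three_q :: "complex \<Rightarrow> complex"
  where "three_q q = (q ^ 3 + inverse q ^ 3) / (q + inverse q)"

section \<open>Super representations of the Borel part with a homogeneous weight basis\<close>

text \<open>
  All modules considered have diagonalizable \<open>\<K>\<^sub>0, \<K>\<^sub>1\<close> and countable dimension, so up to
  isomorphism each has a basis of homogeneous weight vectors indexed by a set of natural numbers.
  Vectors are finitely supported functions on the basis.
\<close>

type_synonym vec = "nat \<Rightarrow>\<^sub>0 complex"

datatype node = N0 | N1

fun cartan :: "node \<Rightarrow> node \<Rightarrow> int"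
  where "cartan i j = (if i = j then 2 else - 2)"

text \<open>
  \<open>wt M j i\<close> is the eigenvalue of \<open>\<K>\<^sub>j\<close> on the basis vector \<open>i\<close>, and \<open>act M j i\<close> its image under
  \<open>\<E>\<^sub>j\<close>; \<open>podd\<close> marks the odd basis vectors. Field values outside \<open>idx M\<close> play no role.
\<close>

record sbmod =
  idx :: "nat set"
  podd :: "nat \<Rightarrow> bool"
  wt :: "node \<Rightarrow> nat \<Rightarrow> complex"
  act :: "node \<Rightarrow> nat \<Rightarrow> vec"

definition cscale :: "complex \<Rightarrow> vec \<Rightarrow> vec"
  where "cscale c v = Poly_Mapping.map ((*) c) v"

definition lin_ext :: "(nat \<Rightarrow> vec) \<Rightarrow> vec \<Rightarrow> vec"
  where "lin_ext f v = (\<Sum>i\<in>Poly_Mapping.keys v. cscale (Poly_Mapping.lookup v i) (f i))"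

definition mspace :: "sbmod \<Rightarrow> vec set"
  where "mspace M = {v. Poly_Mapping.keys v \<subseteq> idx M}"

definition hspace :: "sbmod \<Rightarrow> bool \<Rightarrow> vec set"
  where "hspace M p = {v. Poly_Mapping.keys v \<subseteq> {i \<in> idx M. podd M i = p}}"

definition Eop :: "sbmod \<Rightarrow> node \<Rightarrow> vec \<Rightarrow> vec"
  where "Eop M j = lin_ext (act M j)"

definition Kop :: "sbmod \<Rightarrow> node \<Rightarrow> vec \<Rightarrow> vec"
  where "Kop M j = lin_ext (\<lambda>i. Poly_Mapping.single i (wt M j i))"

text \<open>The operators \<open>\<K>\<^sub>j\<close> are even and commute because they are diagonal in the homogeneous basis.\<close>

definition is_rep :: "complex \<Rightarrow> sbmod \<Rightarrow> bool"
  where "is_rep q M \<longleftrightarrow>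
    (\<forall>j. \<forall>i\<in>idx M. wt M j i \<noteq> 0) \<and>
    (\<forall>j p. Eop M j ` hspace M p \<subseteq> hspace M (\<not> p)) \<and>
    (\<forall>i j. \<forall>v\<in>mspace M.
      Kop M i (Eop M j v) = cscale (q powi cartan i j) (Eop M j (Kop M i v))) \<and>
    (\<forall>i j. i \<noteq> j \<longrightarrow> (\<forall>v\<in>mspace M.
      Eop M i (Eop M i (Eop M i (Eop M j v)))
      + cscale (three_q q) (Eop M i (Eop M i (Eop M j (Eop M i v))))
      - cscale (three_q q) (Eop M i (Eop M j (Eop M i (Eop M i v))))
      - Eop M j (Eop M i (Eop M i (Eop M i v))) = 0))"

text \<open>
  Category O: weight spaces are finite-dimensional, and all weights lie in a finite union of
  cones, a cone consisting of the weights obtained from a given one by steps of weight \<open>\<E>\<^sub>0\<close>.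
  Some such restriction is indispensable: with arbitrary infinite-dimensional representations,
  \<open>[M] + [M\<^sup>\<oplus>\<^sup>\<infinity>] = [M\<^sup>\<oplus>\<^sup>\<infinity>]\<close> would make the Grothendieck group vanish.
\<close>

definition catO :: "complex \<Rightarrow> sbmod set"
  where "catO q = {M. is_rep q M \<and>
    (\<forall>a c. finite {i \<in> idx M. wt M N0 i = a \<and> wt M N1 i = c}) \<and>
    (\<exists>Om. finite Om \<and> (\<forall>i\<in>idx M. \<exists>(a, c)\<in>Om. \<exists>n::nat.
      wt M N0 i = q powi (2 * int n) * a \<and> wt M N1 i = q powi (- 2 * int n) * c))}"

text \<open>Morphisms are the parity-preserving intertwiners.\<close>

definition is_hom :: "sbmod \<Rightarrow> sbmod \<Rightarrow> (vec \<Rightarrow> vec) \<Rightarrow> bool"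
  where "is_hom M N f \<longleftrightarrow>
    (\<forall>u\<in>mspace M. \<forall>v\<in>mspace M. f (u + v) = f u + f v) \<and>
    (\<forall>c. \<forall>v\<in>mspace M. f (cscale c v) = cscale c (f v)) \<and>
    (\<forall>p. f ` hspace M p \<subseteq> hspace N p) \<and>
    (\<forall>j. \<forall>v\<in>mspace M. f (Eop M j v) = Eop N j (f v) \<and> f (Kop M j v) = Kop N j (f v))"

definition short_exact :: "sbmod \<Rightarrow> sbmod \<Rightarrow> sbmod \<Rightarrow> bool"
  where "short_exact A B C \<longleftrightarrow> (\<exists>f g. is_hom A B f \<and> is_hom B C g \<and>
    inj_on f (mspace A) \<and> f ` mspace A = {v \<in> mspace B. g v = 0} \<and> g ` mspace B = mspace C)"

section \<open>Tensor products and direct sums\<close>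

definition tens_vec :: "vec \<Rightarrow> vec \<Rightarrow> vec"
  where "tens_vec v w = (\<Sum>i\<in>Poly_Mapping.keys v. \<Sum>k\<in>Poly_Mapping.keys w.
    Poly_Mapping.single (prod_encode (i, k)) (Poly_Mapping.lookup v i * Poly_Mapping.lookup w k))"

text \<open>
  \<open>\<Delta>(\<E>\<^sub>j) = \<E>\<^sub>j \<otimes> \<K>\<^sub>j + 1 \<otimes> \<E>\<^sub>j\<close>, \<open>\<Delta>(\<K>\<^sub>j) = \<K>\<^sub>j \<otimes> \<K>\<^sub>j\<close>; the sign is that of
  \<open>(1 \<otimes> \<E>\<^sub>j)(v \<otimes> w) = (-1)\<^sup>|\<^sup>v\<^sup>| v \<otimes> \<E>\<^sub>j w\<close>.
\<close>

definition tensor :: "sbmod \<Rightarrow> sbmod \<Rightarrow> sbmod"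
  where "tensor A B = \<lparr>
    idx = prod_encode ` (idx A \<times> idx B),
    podd = (\<lambda>n. case prod_decode n of (i, k) \<Rightarrow> podd A i \<noteq> podd B k),
    wt = (\<lambda>j n. case prod_decode n of (i, k) \<Rightarrow> wt A j i * wt B j k),
    act = (\<lambda>j n. case prod_decode n of (i, k) \<Rightarrow>
      tens_vec (act A j i) (Poly_Mapping.single k (wt B j k))
      + cscale (if podd A i then - 1 else 1) (tens_vec (Poly_Mapping.single i 1) (act B j k)))\<rparr>"

definition dsum :: "(nat \<Rightarrow> sbmod) \<Rightarrow> sbmod"
  where "dsum A = \<lparr>
    idx = prod_encode ` (SIGMA m:UNIV. idx (A m)),
    podd = (\<lambda>n. case prod_decode n of (m, i) \<Rightarrow> podd (A m) i),
    wt = (\<lambda>j n. case prod_decode n of (m, i) \<Rightarrow> wt (A m) j i),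
    act = (\<lambda>j n. case prod_decode n of (m, i) \<Rightarrow>
      lin_ext (\<lambda>i'. Poly_Mapping.single (prod_encode (m, i')) 1) (act (A m) j i))\<rparr>"

definition onedim :: "bool \<Rightarrow> complex \<Rightarrow> complex \<Rightarrow> sbmod"
  where "onedim p w0 w1 = \<lparr>idx = {0}, podd = (\<lambda>_. p),
    wt = (\<lambda>j _. case j of N0 \<Rightarrow> w0 | N1 \<Rightarrow> w1), act = (\<lambda>_ _. 0)\<rparr>"

section \<open>The Grothendieck ring\<close>

text \<open>
  The free abelian group on the objects of category O with the bilinear extension of \<open>tensor\<close>.
  The tensor product is associative and unital only up to isomorphism, so this is a ring only
  after passing to the quotient.
\<close>

definition free_obj :: "complex \<Rightarrow> (sbmod \<Rightarrow>\<^sub>0 int) ring"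
  where "free_obj q = \<lparr>
    carrier = {x. Poly_Mapping.keys x \<subseteq> catO q},
    mult = (\<lambda>x y. frag_extend (\<lambda>M. frag_extend (\<lambda>N. frag_of (tensor M N)) y) x),
    one = frag_of (onedim False 1 1),
    zero = 0,
    add = (+)\<rparr>"

definition exact_rel :: "complex \<Rightarrow> (sbmod \<Rightarrow>\<^sub>0 int) set"
  where "exact_rel q = generate (add_monoid (free_obj q))
    {frag_of B - frag_of A - frag_of C | A B C.
      A \<in> catO q \<and> B \<in> catO q \<and> C \<in> catO q \<and> short_exact A B C}"

definition groth :: "complex \<Rightarrow> (sbmod \<Rightarrow>\<^sub>0 int) set ring"
  where "groth q = free_obj q Quot exact_rel q"

definition gclass :: "complex \<Rightarrow> sbmod \<Rightarrow> (sbmod \<Rightarrow>\<^sub>0 int) set"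
  where "gclass q M = exact_rel q +>\<^bsub>free_obj q\<^esub> frag_of M"

text \<open>
  Infinite sums are those of locally finite families, as usual for category O: the sum of the
  classes of a family of modules is the class of its direct sum, provided the latter is again in
  category O, and differences are treated termwise. (In terms of composition multiplicities,
  every simple module occurs in finitely many terms only and the multiplicities add up.)
\<close>

definition groth_sums ::
    "complex \<Rightarrow> (nat \<Rightarrow> (sbmod \<Rightarrow>\<^sub>0 int) set) \<Rightarrow> (sbmod \<Rightarrow>\<^sub>0 int) set \<Rightarrow> bool"
  where "groth_sums q X x \<longleftrightarrow> (\<exists>A B.
    (\<forall>m. A m \<in> catO q \<and> B m \<in> catO q \<and>
      X m = gclass q (A m) \<ominus>\<^bsub>groth q\<^esub> gclass q (B m)) \<and>
    dsum A \<in> catO q \<and> dsum B \<in> catO q \<and>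
    x = gclass q (dsum A) \<ominus>\<^bsub>groth q\<^esub> gclass q (dsum B))"

section \<open>The representations\<close>

text \<open>
  Fock module \<open>\<Pi>\<^sub>e\<close> of the q-oscillator algebra for a sign \<open>e\<close>, with basis
  \<open>n \<mapsto> \<alpha>\<^sub>e\<^sup>n |0\<rangle>\<^sub>e\<close>. The operator \<open>\<alpha>\<^sub>e\<close> raises \<open>n\<close>, and \<open>\<alpha>\<^sub>-\<^sub>e\<close> maps the basis vector \<open>n\<close> to
  \<open>osc_coeff q e n\<close> times the basis vector \<open>n - 1\<close>; the recursion is
  \<open>q \<alpha>\<^sub>+ \<alpha>\<^sub>- + q\<inverse> \<alpha>\<^sub>- \<alpha>\<^sub>+ = - 1 / (q + q\<inverse>)\<close> applied to the basis vector \<open>n\<close>.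
\<close>

fun osc_coeff :: "complex \<Rightarrow> int \<Rightarrow> nat \<Rightarrow> complex"
  where
    "osc_coeff q e 0 = 0"
  | "osc_coeff q e (Suc n) = q powi e * (- 1 / (q + inverse q) - q powi e * osc_coeff q e n)"

text \<open>\<open>osc_alpha q e d n\<close>: image of the basis vector \<open>n\<close> of \<open>\<Pi>\<^sub>e\<close> under \<open>\<alpha>\<^sub>d\<close>.\<close>

definition osc_alpha :: "complex \<Rightarrow> int \<Rightarrow> int \<Rightarrow> nat \<Rightarrow> vec"
  where "osc_alpha q e d n =
    (if d = e then Poly_Mapping.single (Suc n) 1
     else Poly_Mapping.single (n - 1) (osc_coeff q e n))"

text \<open>The eigenvalue of \<open>\<H>\<close> on the basis vector \<open>n\<close> of \<open>\<Pi>\<^sub>e\<close>.\<close>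

definition osc_H :: "int \<Rightarrow> nat \<Rightarrow> int"
  where "osc_H e n = e * 2 * int n"

lemma cscale_single [simp]:
  "cscale c (Poly_Mapping.single n x) = Poly_Mapping.single n (c * x)"
  unfolding cscale_def by (rule poly_mapping_eqI) (simp add: map.rep_eq lookup_single when_def)

lemma cscale_zero [simp]: "cscale c 0 = 0"
  unfolding cscale_def by (rule poly_mapping_eqI) (simp add: map.rep_eq)

lemma lin_ext_zero [simp]: "lin_ext f 0 = 0"
  by (simp add: lin_ext_def)

lemma lin_ext_single:
  "lin_ext f (Poly_Mapping.single n x) = cscale x (f n)"
proof (cases "x = 0")
  case True
  then show ?thesis
    unfolding lin_ext_def cscale_def
    by (auto intro!: poly_mapping_eqI simp: map.rep_eq when_def)
next
  case False
  then show ?thesis by (simp add: lin_ext_def)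
qed

lemma osc_alpha_relation:
  assumes "q \<noteq> 0" and "e = 1 \<or> e = - 1"
  shows "cscale q (lin_ext (osc_alpha q e 1) (osc_alpha q e (- 1) n))
    + cscale (inverse q) (lin_ext (osc_alpha q e (- 1)) (osc_alpha q e 1 n))
    = Poly_Mapping.single n (- 1 / (q + inverse q))"
  using assms
  by (cases n)
    (auto simp: osc_alpha_def lin_ext_single single_add [symmetric] power_int_minus
      right_diff_distrib mult.assoc [symmetric])

text \<open>
  \<open>rho q e lam\<close> is \<open>\<rho>\<^sub>e(lam)\<close>, acting on the Fock module \<open>\<Pi>\<^sub>-\<^sub>e\<close> of the opposite sign; \<open>\<alpha>\<^sub>\<plusminus>\<close> is odd and
  the vacuum even.
\<close>

definition rho :: "complex \<Rightarrow> int \<Rightarrow> complex \<Rightarrow> sbmod"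
  where "rho q e lam = \<lparr>
    idx = UNIV,
    podd = odd,
    wt = (\<lambda>j n. case j of N0 \<Rightarrow> q powi (- e * osc_H (- e) n) | N1 \<Rightarrow> q powi (e * osc_H (- e) n)),
    act = (\<lambda>j n. case j of
        N0 \<Rightarrow> cscale lam (osc_alpha q (- e) (- e) n)
      | N1 \<Rightarrow> cscale lam (osc_alpha q (- e) e n))\<rparr>"

abbreviation rho_plus :: "complex \<Rightarrow> complex \<Rightarrow> sbmod"
  where "rho_plus q \<equiv> rho q 1"

abbreviation rho_minus :: "complex \<Rightarrow> complex \<Rightarrow> sbmod"
  where "rho_minus q \<equiv> rho q (- 1)"

text \<open>The superscript sign \<open>e\<close> of \<open>W_rep\<close> and \<open>U_rep\<close> is \<open>1\<close> or \<open>-1\<close>.\<close>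

definition W_rep :: "complex \<Rightarrow> complex \<Rightarrow> int \<Rightarrow> complex \<Rightarrow> sbmod"
  where "W_rep bs s e lam = \<lparr>
    idx = UNIV,
    podd = (\<lambda>k. e * (- 1) ^ k \<noteq> 1),
    wt = (\<lambda>j k. case j of
        N0 \<Rightarrow> of_int (e * (- 1) ^ k) * qspow bs (2 * of_nat k - s)
      | N1 \<Rightarrow> of_int (e * (- 1) ^ k) * qspow bs (- 2 * of_nat k + s)),
    act = (\<lambda>j k. case j of
        N0 \<Rightarrow> Poly_Mapping.single (Suc k) lam
      | N1 \<Rightarrow> Poly_Mapping.single (k - 1)
          (lam * qsnum bs (of_nat k) * qsnum bs (s - of_nat k + 1)))\<rparr>"

definition U_rep :: "complex \<Rightarrow> int \<Rightarrow> complex \<Rightarrow> sbmod"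
  where "U_rep bs e p = onedim (e \<noteq> 1) (of_int e * qspow bs (- p)) (of_int e * qspow bs p)"

definition parity_elt :: "complex \<Rightarrow> complex \<Rightarrow> (sbmod \<Rightarrow>\<^sub>0 int) set"
  where "parity_elt q bs = gclass q (U_rep bs (- 1) 0)"

end

theory Submission
  imports Defs
begin

text \<open>
  On \<open>\<rho>\<^sub>+(\<lambda>\<mu>) \<otimes> \<rho>\<^sub>-(\<lambda>\<mu>\<inverse>)\<close> the operator \<open>\<E>\<^sub>0\<close> is \<open>\<lambda>\<close> times an operator \<open>c\<close>
  such that the vectors \<open>c\<^sup>k |0, j\<rangle>\<close> form a basis, and \<open>\<E>\<^sub>1\<close> maps \<open>c\<^sup>k |0, j\<rangle>\<close> to a combination of
  \<open>c\<^sup>k\<^sup>-\<^sup>1 |0, j\<rangle>\<close> and \<open>c\<^sup>k |0, j - 1\<rangle>\<close>. For \<open>\<mu>\<^sup>2 = q\<^sub>*\<^sup>s\<^sup>+\<^sup>1\<close> the first coefficient is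
  \<open>\<lambda> [k] [s - k + 1]\<close>. Hence the vectors with \<open>j < m\<close> span an increasing sequence of submodules with
  subquotients \<open>U\<^bsub>-s-2m\<^esub> \<otimes> W\<^sub>s\<^bsup>(-1)^m\<^esup>(\<lambda>)\<close>.

  Exactness gives only finite relations in the Grothendieck group. The infinite filtration is
  handled by a swindle: the \<open>m\<close>-th quotient \<open>Q m\<close> of the filtration lives in depth at least \<open>m\<close>, so
  \<open>\<Oplus> Q m\<close> is still in category O, and comparing it with \<open>\<Oplus> Q (m + 1)\<close> in two ways gives the class
  of \<open>Q 0\<close>. In the same way \<open>\<Oplus> \<sigma>\<^sup>m U\<^bsub>-2m\<^esub>\<close> is the inverse of \<open>1 - \<sigma> [U\<^bsub>-2\<^esub>]\<close>.
\<close>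


section \<open>Linear maps on finitely supported vectors\<close>

text \<open>The two coefficients of E_1 come from its coproduct. The summands E_1 \<otimes> K_1 and
  1 \<otimes> E_1 commute with c up to the scalars -q^-2 and -q^2 and an additive constant. Pushing
  them through c^k therefore gives geometric sums, the oscillator coefficients
  \<open>osc_coeff q (- 1) k\<close> and \<open>osc_coeff q 1 k\<close>, weighted by mu^2 and mu^-2.
  At mu^2 = q_*^(s+1) this combination factors as [k] [s - k + 1], which is the origin of mu.

  The swindle runs over quotients and not over the submodules with j < m: for m > 0 each of these
  contains |0, 0>, so their direct sum has infinite-dimensional weight spaces and leaves category O.

  The quotients are given by explicit formulas, but their Serre relations are not computed. They are
  pulled back from the tensor product for m = 0 and then pushed along the projections. For the
  tensor product itself, the parity operator turns the super signs into the quantum parameter -q^2.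

  The filtration produces U \<otimes> W, whereas W stands to the left of f_s in the product; a
  rescaling isomorphism exchanges the two.\<close>

abbreviation bv :: "nat \<Rightarrow> vec"
  where "bv i \<equiv> Poly_Mapping.single i 1"

text \<open>Linearity on all of \<open>vec\<close>, whereas \<open>is_hom\<close> constrains a map
  on \<open>mspace M\<close> alone. Total linear maps can be composed and compared on basis vectors
  without tracking supports.\<close>

definition vlin :: "(vec \<Rightarrow> vec) \<Rightarrow> bool"
  where "vlin f \<longleftrightarrow> (\<forall>u v. f (u + v) = f u + f v) \<and> (\<forall>c v. f (cscale c v) = cscale c (f v))"

lemma lookup_cscale [simp]: "Poly_Mapping.lookup (cscale c v) n = c * Poly_Mapping.lookup v n"
  by (simp add: cscale_def map.rep_eq when_def)

lemma cscale_add: "cscale c (u + v) = cscale c u + cscale c v"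
  by (rule poly_mapping_eqI) (simp add: lookup_add algebra_simps)

lemma cscale_diff: "cscale c (u - v) = cscale c u - cscale c v"
  by (rule poly_mapping_eqI) (simp add: lookup_minus algebra_simps)

lemma cscale_left_add: "cscale (c + d) v = cscale c v + cscale d v"
  by (rule poly_mapping_eqI) (simp add: lookup_add algebra_simps)

lemma cscale_cscale [simp]: "cscale c (cscale d v) = cscale (c * d) v"
  by (rule poly_mapping_eqI) simp

lemma cscale_one [simp]: "cscale 1 v = v"
  by (rule poly_mapping_eqI) simp

lemma cscale_zero_left [simp]: "cscale 0 v = 0"
  by (rule poly_mapping_eqI) simp

lemma cscale_minus_one: "cscale (- 1) v = - v"
  by (rule poly_mapping_eqI) simp

lemma cscale_commute: "cscale c (cscale d v) = cscale d (cscale c v)"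
  by (simp add: mult.commute)

lemma vlinI:
  assumes "\<And>u v. f (u + v) = f u + f v" and "\<And>c v. f (cscale c v) = cscale c (f v)"
  shows "vlin f"
  using assms by (simp add: vlin_def)

lemma vlin_add: "vlin f \<Longrightarrow> f (u + v) = f u + f v"
  and vlin_cscale: "vlin f \<Longrightarrow> f (cscale c v) = cscale c (f v)"
  by (simp_all add: vlin_def)

lemma vlin_zero: "vlin f \<Longrightarrow> f 0 = 0"
  by (metis cscale_zero_left vlin_cscale)

lemma vlin_minus: "vlin f \<Longrightarrow> f (- v) = - f v"
  by (metis cscale_minus_one vlin_cscale)

lemma vlin_diff: "vlin f \<Longrightarrow> f (u - v) = f u - f v"
  by (metis diff_conv_add_uminus vlin_add vlin_minus)

lemma vlin_sum: "vlin f \<Longrightarrow> f (\<Sum>i\<in>I. g i) = (\<Sum>i\<in>I. f (g i))"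
  by (induction I rule: infinite_finite_induct) (simp_all add: vlin_zero vlin_add)

lemmas vlin_simps = vlin_add vlin_cscale vlin_zero vlin_minus vlin_diff

lemma vlin_id [simp, intro]: "vlin (\<lambda>v. v)"
  by (simp add: vlin_def)

lemma vlin_const_zero [simp, intro]: "vlin (\<lambda>v. 0)"
  by (simp add: vlin_def)

lemma vlin_comp: "vlin f \<Longrightarrow> vlin g \<Longrightarrow> vlin (\<lambda>v. f (g v))"
  by (simp add: vlin_def)

lemma vlin_plus: "vlin f \<Longrightarrow> vlin g \<Longrightarrow> vlin (\<lambda>v. f v + g v)"
  by (simp add: vlin_def cscale_add add_ac)

lemma vlin_minus_fun: "vlin f \<Longrightarrow> vlin g \<Longrightarrow> vlin (\<lambda>v. f v - g v)"
  by (simp add: vlin_def cscale_diff)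

lemma vlin_scale: "vlin f \<Longrightarrow> vlin (\<lambda>v. cscale c (f v))"
  by (simp add: vlin_def cscale_add mult.commute)

lemma lin_ext_superset:
  assumes "finite S" "Poly_Mapping.keys v \<subseteq> S"
  shows "lin_ext f v = (\<Sum>i\<in>S. cscale (Poly_Mapping.lookup v i) (f i))"
  unfolding lin_ext_def using assms
  by (intro sum.mono_neutral_left) (auto simp: in_keys_iff)

lemma vlin_lin_ext [simp, intro]: "vlin (lin_ext f)"
proof (rule vlinI)
  fix u v :: vec
  let ?S = "Poly_Mapping.keys u \<union> Poly_Mapping.keys v"
  have "lin_ext f (u + v) = (\<Sum>i\<in>?S. cscale (Poly_Mapping.lookup (u + v) i) (f i))"
    by (rule lin_ext_superset) (use Poly_Mapping.keys_add[of u v] in auto)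
  also have "\<dots> = lin_ext f u + lin_ext f v"
    by (simp add: lin_ext_superset[of ?S u] lin_ext_superset[of ?S v] lookup_add cscale_left_add
        sum.distrib)
  finally show "lin_ext f (u + v) = lin_ext f u + lin_ext f v" .
next
  fix c v
  have s: "vlin (cscale c)" by (rule vlinI) (simp_all add: cscale_add mult.commute)
  have "lin_ext f (cscale c v) = (\<Sum>i\<in>Poly_Mapping.keys v. cscale (Poly_Mapping.lookup (cscale c v) i) (f i))"
    by (rule lin_ext_superset) (auto simp: in_keys_iff)
  then show "lin_ext f (cscale c v) = cscale c (lin_ext f v)"
    by (simp add: lin_ext_def vlin_sum[OF s])
qed

lemma lin_ext_bv [simp]: "lin_ext f (bv i) = f i"
  by (simp add: lin_ext_single)

lemma vec_expand: "v = (\<Sum>i\<in>Poly_Mapping.keys v. cscale (Poly_Mapping.lookup v i) (bv i))"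
proof (rule poly_mapping_eqI)
  fix n
  have L: "Poly_Mapping.lookup (\<Sum>i\<in>I. g i) n = (\<Sum>i\<in>I. Poly_Mapping.lookup (g i) n)"
    for I :: "nat set" and g :: "nat \<Rightarrow> vec"
    by (induction I rule: infinite_finite_induct) (simp_all add: lookup_add)
  show "Poly_Mapping.lookup v n =
      Poly_Mapping.lookup (\<Sum>i\<in>Poly_Mapping.keys v. cscale (Poly_Mapping.lookup v i) (bv i)) n"
    by (simp add: L lookup_single when_def in_keys_iff)
qed

lemma vlin_eqI:
  assumes "vlin f" "vlin g" "\<And>i. i \<in> K \<Longrightarrow> f (bv i) = g (bv i)" "Poly_Mapping.keys v \<subseteq> K"
  shows "f v = g v"
proof -
  have "f v = (\<Sum>i\<in>Poly_Mapping.keys v. cscale (Poly_Mapping.lookup v i) (f (bv i)))"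
    by (subst vec_expand[of v]) (simp only: vlin_sum[OF assms(1)] vlin_cscale[OF assms(1)])
  also have "\<dots> = (\<Sum>i\<in>Poly_Mapping.keys v. cscale (Poly_Mapping.lookup v i) (g (bv i)))"
    by (rule sum.cong) (use assms in auto)
  also have "\<dots> = g v"
    by (subst (3) vec_expand[of v]) (simp only: vlin_sum[OF assms(2)] vlin_cscale[OF assms(2)])
  finally show ?thesis .
qed

lemma vlin_eq_all:
  assumes "vlin f" "vlin g" "\<And>i. f (bv i) = g (bv i)"
  shows "f v = g v"
  by (rule vlin_eqI[where K = UNIV]) (use assms in auto)

definition vspan :: "nat set \<Rightarrow> vec set"
  where "vspan K = {v. Poly_Mapping.keys v \<subseteq> K}"

lemma mspace_vspan: "mspace M = vspan (idx M)"
  by (simp add: mspace_def vspan_def)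

lemma hspace_vspan: "hspace M p = vspan {i \<in> idx M. podd M i = p}"
  by (simp add: hspace_def vspan_def)

lemma hspace_subset_mspace: "hspace M p \<subseteq> mspace M"
  by (auto simp: hspace_def mspace_def)

lemma vspan_lookup: "v \<in> vspan K \<longleftrightarrow> (\<forall>i. i \<notin> K \<longrightarrow> Poly_Mapping.lookup v i = 0)"
  by (auto simp: vspan_def in_keys_iff subset_iff)

lemma vspan_zero [simp]: "0 \<in> vspan K"
  and vspan_add: "u \<in> vspan K \<Longrightarrow> v \<in> vspan K \<Longrightarrow> u + v \<in> vspan K"
  and vspan_diff: "u \<in> vspan K \<Longrightarrow> v \<in> vspan K \<Longrightarrow> u - v \<in> vspan K"
  and vspan_cscale: "v \<in> vspan K \<Longrightarrow> cscale c v \<in> vspan K"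
  and vspan_single: "i \<in> K \<Longrightarrow> Poly_Mapping.single i c \<in> vspan K"
  by (auto simp: vspan_lookup lookup_add lookup_minus lookup_single when_def)

lemma vspan_mono: "K \<subseteq> L \<Longrightarrow> vspan K \<subseteq> vspan L"
  by (auto simp: vspan_def)

lemma vspan_sum: "(\<And>i. i \<in> I \<Longrightarrow> g i \<in> vspan K) \<Longrightarrow> (\<Sum>i\<in>I. g i) \<in> vspan K"
  by (induction I rule: infinite_finite_induct) (auto simp: vspan_add)

lemma vlin_vspan:
  assumes "vlin f" "\<And>i. i \<in> K \<Longrightarrow> f (bv i) \<in> vspan L" "v \<in> vspan K"
  shows "f v \<in> vspan L"
proof -
  have "f v = (\<Sum>i\<in>Poly_Mapping.keys v. cscale (Poly_Mapping.lookup v i) (f (bv i)))"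
    by (subst vec_expand[of v]) (simp only: vlin_sum[OF assms(1)] vlin_cscale[OF assms(1)])
  also have "\<dots> \<in> vspan L"
    using assms(2,3) by (intro vspan_sum vspan_cscale) (auto simp: vspan_def)
  finally show ?thesis .
qed

lemma vspan_eqI:
  assumes "vlin f" "vlin g" "\<And>i. i \<in> K \<Longrightarrow> f (bv i) = g (bv i)" "v \<in> vspan K"
  shows "f v = g v"
  using assms vlin_eqI[of f g K v] by (auto simp: vspan_def)

subsection \<open>Tensor products of vectors and maps\<close>

lemma lookup_vec_sum:
  "Poly_Mapping.lookup (\<Sum>i\<in>I. g i) n = (\<Sum>i\<in>I. Poly_Mapping.lookup (g i) n)"
  for g :: "'b \<Rightarrow> vec"
  by (induction I rule: infinite_finite_induct) (simp_all add: lookup_add)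

lemma lookup_tens_vec:
  "Poly_Mapping.lookup (tens_vec v w) n =
    Poly_Mapping.lookup v (fst (prod_decode n)) * Poly_Mapping.lookup w (snd (prod_decode n))"
proof -
  obtain a b where n: "n = prod_encode (a, b)"
    by (metis prod_decode_inverse surj_pair)
  have "Poly_Mapping.lookup (tens_vec v w) n = (\<Sum>i\<in>Poly_Mapping.keys v. \<Sum>k\<in>Poly_Mapping.keys w.
     if i = a then (if k = b then Poly_Mapping.lookup v i * Poly_Mapping.lookup w k else 0) else 0)"
    unfolding tens_vec_def lookup_vec_sum
    by (intro sum.cong refl) (simp add: n lookup_single when_def prod_encode_eq)
  also have "\<dots> = (\<Sum>i\<in>Poly_Mapping.keys v. if i = a then \<Sum>k\<in>Poly_Mapping.keys w.
     (if k = b then Poly_Mapping.lookup v i * Poly_Mapping.lookup w k else 0) else 0)"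
    by (intro sum.cong refl) simp
  also have "\<dots> = Poly_Mapping.lookup v a * Poly_Mapping.lookup w b"
    by (simp add: in_keys_iff)
  finally show ?thesis by (simp add: n)
qed

lemma tens_vec_add_left: "tens_vec (u + v) w = tens_vec u w + tens_vec v w"
  and tens_vec_add_right: "tens_vec w (u + v) = tens_vec w u + tens_vec w v"
  and tens_vec_cscale_left: "tens_vec (cscale c v) w = cscale c (tens_vec v w)"
  and tens_vec_cscale_right: "tens_vec w (cscale c v) = cscale c (tens_vec w v)"
  by (rule poly_mapping_eqI, simp add: lookup_tens_vec lookup_add algebra_simps)+

lemma tens_vec_zero_left [simp]: "tens_vec 0 w = 0"
  and tens_vec_zero_right [simp]: "tens_vec w 0 = 0"
  by (rule poly_mapping_eqI, simp add: lookup_tens_vec)+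

lemma tens_vec_single:
  "tens_vec (Poly_Mapping.single i a) (Poly_Mapping.single k b) =
    Poly_Mapping.single (prod_encode (i, k)) (a * b)"
proof (rule poly_mapping_eqI)
  fix n
  have "i = fst (prod_decode n) \<and> k = snd (prod_decode n) \<longleftrightarrow> prod_encode (i, k) = n"
    by (metis prod.collapse prod_decode_inverse prod_encode_inverse fst_conv snd_conv)
  then show "Poly_Mapping.lookup (tens_vec (Poly_Mapping.single i a) (Poly_Mapping.single k b)) n =
      Poly_Mapping.lookup (Poly_Mapping.single (prod_encode (i, k)) (a * b)) n"
    by (auto simp: lookup_tens_vec lookup_single when_def)
qed

lemma vlin_tens_left: "vlin f \<Longrightarrow> vlin (\<lambda>v. tens_vec (f v) w)"
  and vlin_tens_right: "vlin f \<Longrightarrow> vlin (\<lambda>v. tens_vec w (f v))"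
  by (simp_all add: vlin_def tens_vec_add_left tens_vec_add_right tens_vec_cscale_left
      tens_vec_cscale_right)

lemma tens_vec_vspan:
  "u \<in> vspan K \<Longrightarrow> v \<in> vspan L \<Longrightarrow> tens_vec u v \<in> vspan (prod_encode ` (K \<times> L))"
  unfolding vspan_lookup lookup_tens_vec
  by (metis SigmaI image_eqI mult_eq_0_iff prod.collapse prod_decode_inverse)

lemma bilinear_eqI:
  assumes "\<And>v. vlin (\<lambda>u. F u v)" "\<And>u. vlin (F u)" "\<And>v. vlin (\<lambda>u. G u v)" "\<And>u. vlin (G u)"
    and "\<And>i k. i \<in> K \<Longrightarrow> k \<in> L \<Longrightarrow> F (bv i) (bv k) = G (bv i) (bv k)"
    and "u \<in> vspan K" "v \<in> vspan L"
  shows "F u v = G u v"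
proof (rule vspan_eqI[of "\<lambda>u. F u v" "\<lambda>u. G u v" K])
  fix i assume "i \<in> K"
  then show "F (bv i) v = G (bv i) v"
    by (intro vspan_eqI[OF assms(2,4) _ assms(7)] assms(5))
qed (fact assms)+

text \<open>The unsigned tensor product of maps. The Koszul sign of 1 \<otimes> E_j is carried by
  \<open>par\<close> in the left slot (\<open>Eop_tensor\<close>), so composition obeys no sign
  rule.\<close>

definition tmap :: "(vec \<Rightarrow> vec) \<Rightarrow> (vec \<Rightarrow> vec) \<Rightarrow> vec \<Rightarrow> vec"
  where "tmap f g = lin_ext (\<lambda>n. case prod_decode n of (i, k) \<Rightarrow> tens_vec (f (bv i)) (g (bv k)))"

lemma vlin_tmap [simp, intro]: "vlin (tmap f g)"
  by (simp add: tmap_def)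

lemma tmap_bv: "tmap f g (bv n) = tens_vec (f (bv (fst (prod_decode n)))) (g (bv (snd (prod_decode n))))"
  by (simp add: tmap_def split_beta)

lemma tmap_tens:
  assumes "vlin f" "vlin g"
  shows "tmap f g (tens_vec u v) = tens_vec (f u) (g v)"
proof (rule bilinear_eqI[of "\<lambda>u v. tmap f g (tens_vec u v)" "\<lambda>u v. tens_vec (f u) (g v)" UNIV UNIV])
  show "vlin (\<lambda>u. tmap f g (tens_vec u v))" for v
    by (rule vlin_comp[OF vlin_tmap]) (simp add: vlin_tens_left)
  show "vlin (\<lambda>v. tmap f g (tens_vec u v))" for u
    by (rule vlin_comp[OF vlin_tmap]) (simp add: vlin_tens_right)
qed (auto simp: tens_vec_single tmap_bv vspan_def intro!: vlin_tens_left vlin_tens_right assms)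

lemma tmap_comp:
  assumes "vlin f" "vlin g"
  shows "tmap f g (tmap f' g' v) = tmap (\<lambda>u. f (f' u)) (\<lambda>u. g (g' u)) v"
  by (rule vlin_eq_all) (auto simp: vlin_comp tmap_bv tmap_tens assms)

lemma tmap_cong:
  assumes "v \<in> vspan (prod_encode ` (K \<times> L))"
    and "\<And>i. i \<in> K \<Longrightarrow> f (bv i) = f' (bv i)" "\<And>i. i \<in> L \<Longrightarrow> g (bv i) = g' (bv i)"
  shows "tmap f g v = tmap f' g' v"
  by (rule vspan_eqI[OF _ _ _ assms(1)]) (auto simp: tmap_bv assms)

lemma tmap_add_left: "tmap (\<lambda>u. f u + f' u) g v = tmap f g v + tmap f' g v"
  by (rule vlin_eq_all) (auto intro!: vlin_plus simp: tmap_bv tens_vec_add_left)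

lemma tmap_add_right: "tmap f (\<lambda>u. g u + g' u) v = tmap f g v + tmap f g' v"
  by (rule vlin_eq_all) (auto intro!: vlin_plus simp: tmap_bv tens_vec_add_right)

lemma tmap_zero_left: "tmap (\<lambda>u. 0) g v = 0"
  by (rule vlin_eq_all) (auto simp: tmap_bv)

lemma tmap_zero_right: "tmap f (\<lambda>u. 0) v = 0"
  by (rule vlin_eq_all) (auto simp: tmap_bv)

lemma tmap_cscale_left: "tmap (\<lambda>u. cscale c (f u)) g v = cscale c (tmap f g v)"
  by (rule vlin_eq_all) (auto intro!: vlin_scale simp: tmap_bv tens_vec_cscale_left)

lemma tmap_cscale_right: "tmap f (\<lambda>u. cscale c (g u)) v = cscale c (tmap f g v)"
  by (rule vlin_eq_all) (auto intro!: vlin_scale simp: tmap_bv tens_vec_cscale_right)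

lemma tmap_vspan:
  assumes "v \<in> vspan (prod_encode ` (K \<times> L))"
    and "\<And>i. i \<in> K \<Longrightarrow> f (bv i) \<in> vspan K'" "\<And>i. i \<in> L \<Longrightarrow> g (bv i) \<in> vspan L'"
  shows "tmap f g v \<in> vspan (prod_encode ` (K' \<times> L'))"
  by (rule vlin_vspan[OF _ _ assms(1)]) (auto simp: tmap_bv intro!: tens_vec_vspan assms)


section \<open>Representations given on a basis\<close>

text \<open>Keeping the coefficient and both operators abstract allows the expression to be
  transported along homomorphisms and to be split over the two summands of a coproduct.\<close>

definition serre :: "complex \<Rightarrow> (vec \<Rightarrow> vec) \<Rightarrow> (vec \<Rightarrow> vec) \<Rightarrow> vec \<Rightarrow> vec"
  where "serre c F G v =
    F (F (F (G v))) + cscale c (F (F (G (F v)))) - cscale c (F (G (F (F v)))) - G (F (F (F v)))"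

definition par :: "sbmod \<Rightarrow> vec \<Rightarrow> vec"
  where "par M = lin_ext (\<lambda>i. Poly_Mapping.single i (if podd M i then - 1 else 1))"

lemma vlin_Eop [simp, intro]: "vlin (Eop M j)"
  and vlin_Kop [simp, intro]: "vlin (Kop M j)"
  and vlin_par [simp, intro]: "vlin (par M)"
  by (simp_all add: Eop_def Kop_def par_def)

lemmas vlin_op_comps [simp, intro!] =
  vlin_comp[OF vlin_Eop vlin_Kop] vlin_comp[OF vlin_Kop vlin_Eop]
  vlin_comp[OF vlin_lin_ext vlin_Eop] vlin_comp[OF vlin_lin_ext vlin_Kop]
  vlin_comp[OF vlin_Eop vlin_lin_ext] vlin_comp[OF vlin_Kop vlin_lin_ext]

lemma vlin_serre: "vlin F \<Longrightarrow> vlin G \<Longrightarrow> vlin (serre c F G)"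
  by (simp add: vlin_def serre_def cscale_add cscale_diff cscale_commute del: cscale_cscale)

lemma Eop_bv [simp]: "Eop M j (bv i) = act M j i"
  and Kop_bv: "Kop M j (bv i) = Poly_Mapping.single i (wt M j i)"
  and par_bv: "par M (bv i) = Poly_Mapping.single i (if podd M i then - 1 else 1)"
  by (simp_all add: Eop_def Kop_def par_def)

lemma Eop_single: "Eop M j (Poly_Mapping.single i x) = cscale x (act M j i)"
  by (simp add: Eop_def lin_ext_single)

lemma lookup_lin_ext_diag:
  "Poly_Mapping.lookup (lin_ext (\<lambda>i. Poly_Mapping.single i (w i)) v) n = w n * Poly_Mapping.lookup v n"
  by (simp add: lin_ext_def lookup_vec_sum lookup_single when_def in_keys_iff if_distrib cong: if_cong)

lemma lookup_Kop: "Poly_Mapping.lookup (Kop M j v) n = wt M j n * Poly_Mapping.lookup v n"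
  and lookup_par: "Poly_Mapping.lookup (par M v) n = (if podd M n then - 1 else 1) * Poly_Mapping.lookup v n"
  by (simp_all add: Kop_def par_def lookup_lin_ext_diag)

lemma par_hspace: "v \<in> hspace M p \<Longrightarrow> par M v = cscale (if p then - 1 else 1) v"
  by (rule poly_mapping_eqI) (auto simp: hspace_vspan vspan_lookup lookup_par)

lemma par_par [simp]: "par M (par M v) = v"
  by (rule poly_mapping_eqI) (simp add: lookup_par)

lemma Kop_commute: "Kop M i (Kop M j v) = Kop M j (Kop M i v)"
  by (rule poly_mapping_eqI) (simp add: lookup_Kop)

lemma bv_hspace: "i \<in> idx M \<Longrightarrow> bv i \<in> hspace M (podd M i)"
  by (simp add: hspace_vspan vspan_single)

lemma bv_mspace: "i \<in> idx M \<Longrightarrow> bv i \<in> mspace M"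
  by (simp add: mspace_vspan vspan_single)

lemma diag_mspace: "v \<in> mspace M \<Longrightarrow> Kop M j v \<in> mspace M" "v \<in> mspace M \<Longrightarrow> par M v \<in> mspace M"
  by (simp_all add: mspace_vspan vspan_lookup lookup_Kop lookup_par)

lemma is_rep_iff:
  "is_rep q M \<longleftrightarrow>
    (\<forall>j. \<forall>i\<in>idx M. wt M j i \<noteq> 0) \<and>
    (\<forall>j p. Eop M j ` hspace M p \<subseteq> hspace M (\<not> p)) \<and>
    (\<forall>i j. \<forall>v\<in>mspace M.
      Kop M i (Eop M j v) = cscale (q powi cartan i j) (Eop M j (Kop M i v))) \<and>
    (\<forall>i j. i \<noteq> j \<longrightarrow> (\<forall>v\<in>mspace M. serre (three_q q) (Eop M i) (Eop M j) v = 0))"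
  by (simp add: is_rep_def serre_def)

lemma rep_wt: "is_rep q M \<Longrightarrow> k \<in> idx M \<Longrightarrow> wt M j k \<noteq> 0"
  and rep_hspace: "is_rep q M \<Longrightarrow> v \<in> hspace M p \<Longrightarrow> Eop M j v \<in> hspace M (\<not> p)"
  and rep_KE: "is_rep q M \<Longrightarrow> v \<in> mspace M \<Longrightarrow>
    Kop M i (Eop M j v) = cscale (q powi cartan i j) (Eop M j (Kop M i v))"
  and rep_serre: "is_rep q M \<Longrightarrow> v \<in> mspace M \<Longrightarrow> i \<noteq> j \<Longrightarrow>
    serre (three_q q) (Eop M i) (Eop M j) v = 0"
  unfolding is_rep_iff by blast+

lemma rep_act: "is_rep q M \<Longrightarrow> i \<in> idx M \<Longrightarrow> act M j i \<in> hspace M (\<not> podd M i)"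
  using rep_hspace[OF _ bv_hspace] by simp

lemma rep_act_mspace: "is_rep q M \<Longrightarrow> i \<in> idx M \<Longrightarrow> act M j i \<in> mspace M"
  using rep_act hspace_subset_mspace by blast

lemma rep_mspace:
  assumes "is_rep q M" "v \<in> mspace M" shows "Eop M j v \<in> mspace M"
  unfolding mspace_vspan
  by (rule vlin_vspan[where K = "idx M"]) (use assms rep_act_mspace in \<open>auto simp: mspace_vspan\<close>)

lemma rep_par:
  assumes "is_rep q M" "v \<in> mspace M"
  shows "par M (Eop M j v) = - Eop M j (par M v)"
proof -
  have "par M (Eop M j v) = cscale (- 1) (Eop M j (par M v))"
  proof (rule vspan_eqI[of "\<lambda>v. par M (Eop M j v)" "\<lambda>v. cscale (- 1) (Eop M j (par M v))" "idx M"])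
    fix i assume i: "i \<in> idx M"
    show "par M (Eop M j (bv i)) = cscale (- 1) (Eop M j (par M (bv i)))"
      using par_hspace[OF bv_hspace[OF i]] par_hspace[OF rep_act[OF assms(1) i, of j]]
      by (simp add: vlin_simps Eop_single)
  qed (use assms in \<open>auto simp: mspace_vspan vlin_comp intro!: vlin_scale\<close>)
  then show ?thesis by (simp add: cscale_minus_one)
qed

lemma is_repI:
  assumes "\<And>j i. i \<in> idx M \<Longrightarrow> wt M j i \<noteq> 0"
    and "\<And>j i. i \<in> idx M \<Longrightarrow> act M j i \<in> hspace M (\<not> podd M i)"
    and "\<And>i j k. k \<in> idx M \<Longrightarrow> Kop M i (act M j k) = cscale (q powi cartan i j * wt M i k) (act M j k)"
    and "\<And>i j k. k \<in> idx M \<Longrightarrow> i \<noteq> j \<Longrightarrow> serre (three_q q) (Eop M i) (Eop M j) (bv k) = 0"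
  shows "is_rep q M"
  unfolding is_rep_iff
proof (intro conjI allI ballI impI subsetI)
  fix j p w assume "w \<in> Eop M j ` hspace M p"
  then obtain v where v: "v \<in> hspace M p" "w = Eop M j v" by blast
  have "Eop M j v \<in> vspan {i \<in> idx M. podd M i = (\<not> p)}"
    by (rule vlin_vspan[OF _ _ v(1)[unfolded hspace_vspan]])
      (use assms(2) in \<open>auto simp: hspace_vspan\<close>)
  then show "w \<in> hspace M (\<not> p)" by (simp add: v hspace_vspan)
next
  fix i j v assume v: "v \<in> mspace M"
  show "Kop M i (Eop M j v) = cscale (q powi cartan i j) (Eop M j (Kop M i v))"
  proof (rule vspan_eqI[of "\<lambda>v. Kop M i (Eop M j v)" "\<lambda>v. cscale (q powi cartan i j) (Eop M j (Kop M i v))"])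
    fix k assume "k \<in> idx M"
    then show "Kop M i (Eop M j (bv k)) = cscale (q powi cartan i j) (Eop M j (Kop M i (bv k)))"
      by (simp add: assms(3) Kop_bv) (simp add: Eop_def lin_ext_single)
  qed (use v in \<open>auto simp: mspace_vspan intro!: vlin_scale\<close>)
next
  fix i j v assume v: "v \<in> mspace M" and "i \<noteq> (j :: node)"
  then show "serre (three_q q) (Eop M i) (Eop M j) v = 0"
    by (intro vspan_eqI[OF _ _ _ v[unfolded mspace_vspan], of "serre (three_q q) (Eop M i) (Eop M j)" "\<lambda>v. 0"])
      (auto simp: assms(4) intro!: vlin_serre)
qed (fact assms(1))

section \<open>Homomorphisms\<close>

lemma is_homI:
  assumes "\<And>i. i \<in> idx M \<Longrightarrow> \<phi> i \<in> hspace N (podd M i)"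
    and "\<And>i j. i \<in> idx M \<Longrightarrow> lin_ext \<phi> (act M j i) = Eop N j (\<phi> i)"
    and "\<And>i j. i \<in> idx M \<Longrightarrow> Kop N j (\<phi> i) = cscale (wt M j i) (\<phi> i)"
  shows "is_hom M N (lin_ext \<phi>)"
  unfolding is_hom_def
proof (intro conjI allI ballI subsetI)
  fix p w assume "w \<in> lin_ext \<phi> ` hspace M p"
  then obtain v where v: "v \<in> hspace M p" "w = lin_ext \<phi> v" by blast
  have "lin_ext \<phi> v \<in> vspan {i \<in> idx N. podd N i = p}"
    by (rule vlin_vspan[OF _ _ v(1)[unfolded hspace_vspan]])
      (use assms(1) in \<open>auto simp: hspace_vspan\<close>)
  then show "w \<in> hspace N p" by (simp add: v hspace_vspan)
next
  fix j v assume v: "v \<in> mspace M"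
  show "lin_ext \<phi> (Eop M j v) = Eop N j (lin_ext \<phi> v)"
    by (rule vspan_eqI[OF _ _ _ v[unfolded mspace_vspan],
          of "\<lambda>v. lin_ext \<phi> (Eop M j v)" "\<lambda>v. Eop N j (lin_ext \<phi> v)"])
      (auto simp: assms(2))
  show "lin_ext \<phi> (Kop M j v) = Kop N j (lin_ext \<phi> v)"
    by (rule vspan_eqI[OF _ _ _ v[unfolded mspace_vspan],
          of "\<lambda>v. lin_ext \<phi> (Kop M j v)" "\<lambda>v. Kop N j (lin_ext \<phi> v)"])
      (auto simp: assms(3) Kop_bv lin_ext_single)
qed (auto simp: vlin_simps)

lemma is_homD:
  assumes "is_hom M N f"
  shows "v \<in> mspace M \<Longrightarrow> f (Eop M j v) = Eop N j (f v)"
    and "v \<in> mspace M \<Longrightarrow> f (Kop M j v) = Kop N j (f v)"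
    and "v \<in> hspace M p \<Longrightarrow> f v \<in> hspace N p"
    and "u \<in> mspace M \<Longrightarrow> v \<in> mspace M \<Longrightarrow> f (u + v) = f u + f v"
    and "v \<in> mspace M \<Longrightarrow> f (cscale c v) = cscale c (f v)"
  using assms unfolding is_hom_def by blast+

lemma is_hom_lin_ext:
  assumes "is_hom M N f" "v \<in> mspace M"
  shows "f v = lin_ext (\<lambda>i. f (bv i)) v"
proof -
  have z: "f 0 = 0"
    using is_homD(5)[OF assms(1), of 0 0] by (simp add: mspace_vspan)
  have S: "f (\<Sum>i\<in>I. g i) = (\<Sum>i\<in>I. f (g i)) \<and> (\<Sum>i\<in>I. g i) \<in> mspace M"
    if "\<And>i. i \<in> I \<Longrightarrow> g i \<in> mspace M" "finite I" for I :: "nat set" and g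
    using that(2,1)
    by (induction I) (auto simp: z mspace_vspan vspan_add is_homD(4)[OF assms(1)])
  have "f v = (\<Sum>i\<in>Poly_Mapping.keys v. f (cscale (Poly_Mapping.lookup v i) (bv i)))"
    using assms(2)
    by (subst vec_expand[of v], intro conjunct1[OF S])
      (auto simp: mspace_vspan vspan_def in_keys_iff)
  also have "\<dots> = lin_ext (\<lambda>i. f (bv i)) v"
    unfolding lin_ext_def using assms(2)
    by (intro sum.cong refl is_homD(5)[OF assms(1)] bv_mspace) (auto simp: mspace_vspan vspan_def)
  finally show ?thesis .
qed

lemma is_hom_mspace:
  assumes "is_hom M N f" "v \<in> mspace M" shows "f v \<in> mspace N"
proof -
  have "lin_ext (\<lambda>i. f (bv i)) v \<in> mspace N"
    unfolding mspace_vspan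
    by (rule vlin_vspan[OF _ _ assms(2)[unfolded mspace_vspan]])
      (use is_homD(3)[OF assms(1) bv_hspace] hspace_subset_mspace[of N] in \<open>auto simp: mspace_vspan\<close>)
  then show ?thesis using is_hom_lin_ext[OF assms] by simp
qed

lemma hom_serre:
  assumes f: "vlin f" "is_hom M N f"
    and m: "\<And>j v. v \<in> mspace M \<Longrightarrow> Eop M j v \<in> mspace M" and v: "v \<in> mspace M"
  shows "f (serre c (Eop M i) (Eop M j) v) = serre c (Eop N i) (Eop N j) (f v)"
  using v by (simp add: serre_def vlin_simps[OF f(1)] is_homD(1)[OF f(2)] m)

text \<open>The relations are equations between words in the generators, so they pass to an image.
  Parity and nonvanishing weights refer to the chosen basis of \<open>N\<close> and are therefore
  separate hypotheses.\<close>

lemma rep_of_surj_hom: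
  assumes M: "is_rep q M" and f: "vlin f" "is_hom M N f" and surj: "mspace N \<subseteq> f ` mspace M"
    and wt: "\<And>j i. i \<in> idx N \<Longrightarrow> wt N j i \<noteq> 0"
    and act: "\<And>j i. i \<in> idx N \<Longrightarrow> act N j i \<in> hspace N (\<not> podd N i)"
  shows "is_rep q N"
proof (rule is_repI[OF wt act])
  note E = is_homD(1)[OF f(2), symmetric] and K = is_homD(2)[OF f(2), symmetric]
  note m = rep_mspace[OF M] diag_mspace(1)[of _ M]
  fix i j k assume k: "k \<in> idx N"
  obtain v where v: "v \<in> mspace M" "bv k = f v"
    using bv_mspace[OF k] surj by auto
  have "Kop N i (Eop N j (f v)) = cscale (q powi cartan i j) (Eop N j (Kop N i (f v)))"
    using v by (simp add: E K m rep_KE[OF M] vlin_simps[OF f(1)])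
  then show "Kop N i (act N j k) = cscale (q powi cartan i j * wt N i k) (act N j k)"
    by (simp add: v(2)[symmetric] Kop_bv) (simp add: Eop_def lin_ext_single)
  assume "i \<noteq> j"
  then show "serre (three_q q) (Eop N i) (Eop N j) (bv k) = 0"
    unfolding v(2) using rep_serre[OF M v(1)] hom_serre[OF f rep_mspace[OF M] v(1), of "three_q q" i j]
    by (simp add: vlin_zero[OF f(1)])
qed

text \<open>An injective homomorphism reflects the relations, since each of them holds after
  applying \<open>f\<close>. This carries the Serre relations of the tensor product over to its
  description in the new basis.\<close>

lemma rep_of_inj_hom:
  assumes N: "is_rep q N" and f: "vlin f" "is_hom M N f" and inj: "inj_on f (mspace M)"
    and wt: "\<And>j i. i \<in> idx M \<Longrightarrow> wt M j i \<noteq> 0"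
    and act: "\<And>j i. i \<in> idx M \<Longrightarrow> act M j i \<in> hspace M (\<not> podd M i)"
  shows "is_rep q M"
proof (rule is_repI[OF wt act])
  note E = is_homD(1)[OF f(2)] and K = is_homD(2)[OF f(2)]
  have mE: "Eop M j v \<in> mspace M" if "v \<in> mspace M" for v j
    unfolding mspace_vspan
    by (rule vlin_vspan[OF _ _ that[unfolded mspace_vspan]])
      (use act hspace_subset_mspace[of M] in \<open>auto simp: mspace_vspan\<close>)
  note m = mE diag_mspace(1)[of _ M] is_hom_mspace[OF f(2)]
  fix i j k assume k: "k \<in> idx M"
  note kM = bv_mspace[OF k]
  have cl: "\<And>c v. v \<in> mspace M \<Longrightarrow> cscale c v \<in> mspace M"
    by (simp add: mspace_vspan vspan_cscale)
  have "Kop M i (Eop M j (bv k)) = cscale (q powi cartan i j) (Eop M j (Kop M i (bv k)))"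
    by (rule inj_onD[OF inj])
      (simp_all add: E K m kM rep_KE[OF N] vlin_simps[OF f(1)] del: Eop_bv, simp_all add: m cl kM del: Eop_bv)
  then show "Kop M i (act M j k) = cscale (q powi cartan i j * wt M i k) (act M j k)"
    by (simp add: Kop_bv) (simp add: Eop_def lin_ext_single)
  assume "i \<noteq> j"
  then have "f (serre (three_q q) (Eop M i) (Eop M j) (bv k)) = f 0"
    using rep_serre[OF N, of "f (bv k)"] is_hom_mspace[OF f(2) kM]
    by (simp add: hom_serre[OF f mE kM] vlin_zero[OF f(1)])
  moreover have "serre (three_q q) (Eop M i) (Eop M j) (bv k) \<in> mspace M"
    unfolding serre_def using kM mE
    by (simp add: mspace_vspan vspan_add vspan_diff vspan_cscale del: Eop_bv)
  ultimately show "serre (three_q q) (Eop M i) (Eop M j) (bv k) = 0"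
    by (rule inj_onD[OF inj]) (simp add: mspace_vspan)
qed


section \<open>Tensor products of representations\<close>

text \<open>
  The two summands of a coproduct \<open>\<Delta>(\<E>)\<close> quasi-commute, as for an ordinary (non-super) quantum
  group with parameter \<open>t = q\<^sub>*\<^sup>2 = - q\<^sup>2\<close>.
\<close>

lemma serre_add:
  assumes lin: "vlin Xi" "vlin Yi" "vlin Xj" "vlin Yj"
    and S: "\<And>v. v \<in> S \<Longrightarrow> Xi v \<in> S" "\<And>v. v \<in> S \<Longrightarrow> Yi v \<in> S"
      "\<And>v. v \<in> S \<Longrightarrow> Xj v \<in> S" "\<And>v. v \<in> S \<Longrightarrow> Yj v \<in> S"
    and comm: "\<And>v. v \<in> S \<Longrightarrow> Xi (Yi v) = cscale t (Yi (Xi v))"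
      "\<And>v. v \<in> S \<Longrightarrow> Xi (Yj v) = cscale s (Yj (Xi v))"
      "\<And>v. v \<in> S \<Longrightarrow> Xj (Yi v) = cscale s (Yi (Xj v))"
    and ts: "t * s = 1" and c: "c = - (t + 1 + s)"
    and sX: "\<And>v. v \<in> S \<Longrightarrow> serre c Xi Xj v = 0" and sY: "\<And>v. v \<in> S \<Longrightarrow> serre c Yi Yj v = 0"
    and v: "v \<in> S"
  shows "serre c (\<lambda>v. Xi v + Yi v) (\<lambda>v. Xj v + Yj v) v = 0"
proof -
  note l = vlin_simps[OF lin(1)] vlin_simps[OF lin(2)] vlin_simps[OF lin(3)] vlin_simps[OF lin(4)]
  have st: "s * t = 1" using ts by (simp add: mult.commute)
  then have st': "s * (t * x) = x" for x by (metis mult.assoc mult_1)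
  note st = st st'
  \<comment> \<open>\<open>comm\<close> moves every Y outside every X. Each mixed monomial then has
    a coefficient in t and s that vanishes because c = - (t + 1 + s) and t * s = 1.\<close>
  have w: "serre c (\<lambda>v. Xi v + Yi v) (\<lambda>v. Xj v + Yj v) v = serre c Xi Xj v + serre c Yi Yj v"
    unfolding serre_def
    by (simp add: l S comm v cscale_add cscale_diff, rule poly_mapping_eqI)
      (simp add: lookup_add lookup_minus, simp add: algebra_simps st, simp add: c,
        simp add: algebra_simps st)
  show ?thesis using w sX sY v by simp
qed

lemma tensor_simps [simp]:
  "idx (tensor A B) = prod_encode ` (idx A \<times> idx B)"
  "podd (tensor A B) (prod_encode (i, k)) = (podd A i \<noteq> podd B k)"
  "wt (tensor A B) j (prod_encode (i, k)) = wt A j i * wt B j k"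
  "act (tensor A B) j (prod_encode (i, k)) =
    tens_vec (act A j i) (Poly_Mapping.single k (wt B j k))
    + cscale (if podd A i then - 1 else 1) (tens_vec (bv i) (act B j k))"
  by (simp_all add: tensor_def)

lemma bv_cases: obtains i k where "n = prod_encode (i, k)"
  by (metis prod_decode_inverse surj_pair)

lemma single_cscale_bv: "Poly_Mapping.single i x = cscale x (bv i)"
  by simp

lemma Eop_tensor: "Eop (tensor A B) j v = tmap (Eop A j) (Kop B j) v + tmap (par A) (Eop B j) v"
proof (rule vlin_eq_all[of "Eop (tensor A B) j" "\<lambda>v. tmap (Eop A j) (Kop B j) v + tmap (par A) (Eop B j) v"])
  fix n
  obtain i k where n: "n = prod_encode (i, k)" by (rule bv_cases)
  show "Eop (tensor A B) j (bv n) = tmap (Eop A j) (Kop B j) (bv n) + tmap (par A) (Eop B j) (bv n)"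
    by (simp add: n tmap_bv Kop_bv par_bv)
      (simp add: single_cscale_bv[of _ "- 1"] tens_vec_cscale_left del: cscale_single)
qed (auto intro!: vlin_plus)

lemma Kop_tensor: "Kop (tensor A B) j v = tmap (Kop A j) (Kop B j) v"
proof (rule vlin_eq_all[of "Kop (tensor A B) j" "tmap (Kop A j) (Kop B j)"])
  fix n
  obtain i k where n: "n = prod_encode (i, k)" by (rule bv_cases)
  show "Kop (tensor A B) j (bv n) = tmap (Kop A j) (Kop B j) (bv n)"
    by (simp add: n tmap_bv Kop_bv tens_vec_single)
qed auto

lemma tens_vec_hspace:
  "u \<in> hspace A p \<Longrightarrow> v \<in> hspace B p' \<Longrightarrow> tens_vec u v \<in> hspace (tensor A B) (p \<noteq> p')"
  unfolding hspace_vspan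
  by (drule tens_vec_vspan, assumption, erule subsetD[OF vspan_mono, rotated]) auto

lemma bv_tensor: "bv (prod_encode (i, k)) = tens_vec (bv i) (bv k)"
  by (simp add: tens_vec_single)

locale generic_param =
  fixes q :: complex
  assumes q_nz: "q \<noteq> 0" and q_gen: "\<And>n::nat. n > 0 \<Longrightarrow> q ^ n \<noteq> 1"
begin

lemma q_sq: "q\<^sup>2 \<noteq> 1" "q\<^sup>2 \<noteq> - 1"
proof -
  have "q ^ 4 = q\<^sup>2 * q\<^sup>2" by (simp flip: power_add)
  then have "q\<^sup>2 * q\<^sup>2 \<noteq> 1" using q_gen[of 4] by simp
  then show "q\<^sup>2 \<noteq> 1" "q\<^sup>2 \<noteq> - 1" by (metis mult_1, metis mult_minus1 minus_minus)
qed

abbreviation "qq \<equiv> q + inverse q"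

lemma qq_nz: "qq \<noteq> 0"
proof
  assume "qq = 0"
  then have "q * qq = 0" by simp
  then have "q\<^sup>2 + 1 = 0" using q_nz by (simp add: algebra_simps power2_eq_square)
  then have "q\<^sup>2 = - 1" by (simp add: add_eq_0_iff2)
  then show False using q_sq(2) by simp
qed

text \<open>With t = -q^2 this reads -(t + 1 + 1/t), minus the quantum integer 3 of the ordinary
  quantum Serre relation; it is the form of the coefficient that \<open>serre_add\<close>
  expects.\<close>

lemma three_q_eq: "three_q q = - (- (q\<^sup>2) + 1 + - (inverse q ^ 2))"
proof -
  have "(- (- (q\<^sup>2) + 1 + - (inverse q ^ 2))) * qq = q ^ 3 + inverse q ^ 3"
    using q_nz by (simp add: field_simps power2_eq_square power3_eq_cube)
  then show ?thesis
    unfolding three_q_def using qq_nz by (metis nonzero_mult_div_cancel_right)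
qed

lemma q_powi_cartan: "q powi cartan i j = (if i = j then q\<^sup>2 else inverse q ^ 2)"
  by (simp add: power_int_minus power_inverse)

text \<open>Genericity enters the finiteness arguments here: the depth of a vector below the apex of
  its cone can be read off its weight.\<close>

lemma q_powi_inj:
  assumes "q powi (2 * int m) = q powi (2 * int n)" shows "m = n"
proof -
  have *: "q powi (2 * int k) = q ^ (2 * k)" for k
    by (metis of_nat_mult of_nat_numeral power_int_of_nat)
  have main: "m = n" if "m \<le> n" "q ^ (2 * m) = q ^ (2 * n)" for m n
  proof (rule ccontr)
    assume "m \<noteq> n"
    then have "2 * (n - m) > 0" using that by simp
    moreover have "q ^ (2 * n) = q ^ (2 * m) * q ^ (2 * (n - m))"
      using that(1) by (simp flip: power_add distrib_left)
    ultimately show False using q_gen that(2) q_nz by simp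
  qed
  show ?thesis
    using main[of m n] main[of n m] assms unfolding * by (cases m n rule: le_cases) auto
qed

lemma rep_KE_bv:
  assumes "is_rep q M" "k \<in> idx M"
  shows "Kop M i (act M j k) = cscale (q powi cartan i j * wt M i k) (act M j k)"
  using rep_KE[OF assms(1) bv_mspace[OF assms(2)], of i j] by (simp add: Kop_bv Eop_single del: cartan.simps)

text \<open>By \<open>Eop_tensor\<close> each generator acts as X + Y with X = E \<otimes> K and Y =
  par \<otimes> E, and \<open>serre_add\<close> reduces the Serre relation to the two pure
  ones.\<close>

lemma tensor_rep:
  assumes A: "is_rep q A" and B: "is_rep q B"
  shows "is_rep q (tensor A B)"
proof (rule is_repI)
  fix j n assume "n \<in> idx (tensor A B)"
  then obtain i k where n: "n = prod_encode (i, k)" "i \<in> idx A" "k \<in> idx B" by auto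
  show "wt (tensor A B) j n \<noteq> 0"
    using n rep_wt[OF A] rep_wt[OF B] by simp
  have "tens_vec (act A j i) (Poly_Mapping.single k (wt B j k)) \<in> hspace (tensor A B) ((\<not> podd A i) \<noteq> podd B k)"
    using n by (intro tens_vec_hspace rep_act[OF A]) (auto simp: hspace_vspan intro!: vspan_single)
  moreover have "tens_vec (bv i) (act B j k) \<in> hspace (tensor A B) (podd A i \<noteq> (\<not> podd B k))"
    using n by (intro tens_vec_hspace rep_act[OF B] bv_hspace)
  ultimately show "act (tensor A B) j n \<in> hspace (tensor A B) (\<not> podd (tensor A B) n)"
    by (cases "podd A i"; cases "podd B k") (simp_all add: n hspace_vspan vspan_add vspan_cscale)
next
  fix i j n assume "n \<in> idx (tensor A B)"
  then obtain a b where n: "n = prod_encode (a, b)" "a \<in> idx A" "b \<in> idx B" by auto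
  show "Kop (tensor A B) i (act (tensor A B) j n)
      = cscale (q powi cartan i j * wt (tensor A B) i n) (act (tensor A B) j n)"
  proof -
    have single: "Poly_Mapping.single b (wt B l b) = cscale (wt B l b) (bv b)"
      "Poly_Mapping.single a (wt A l a) = cscale (wt A l a) (bv a)" for l
      by simp_all
    show ?thesis
      using n(2,3)
      by (simp add: n(1) vlin_simps Kop_tensor tmap_tens rep_KE_bv[OF A] rep_KE_bv[OF B] Kop_bv single
          tens_vec_cscale_left tens_vec_cscale_right cscale_add mult_ac del: cartan.simps cscale_single)
  qed
next
  fix i j :: node and n assume n: "n \<in> idx (tensor A B)" and ij: "i \<noteq> j"
  let ?S = "vspan (prod_encode ` (idx A \<times> idx B))"
  define X where "X = (\<lambda>i. tmap (Eop A i) (Kop B i))"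
  define Y where "Y = (\<lambda>i. tmap (par A) (Eop B i))"
  have E: "Eop (tensor A B) i = (\<lambda>v. X i v + Y i v)" for i
    by (rule ext) (simp add: X_def Y_def Eop_tensor)
  have lX: "vlin (X i)" and lY: "vlin (Y i)" for i by (simp_all add: X_def Y_def)
  have X: "X i v \<in> ?S" and Y: "Y i v \<in> ?S" if "v \<in> ?S" for i v
    using tmap_vspan[OF that, of "Eop A i" "idx A" "Kop B i" "idx B"]
      tmap_vspan[OF that, of "par A" "idx A" "Eop B i" "idx B"]
      rep_act_mspace[OF A] rep_act_mspace[OF B]
    by (auto simp: X_def Y_def mspace_vspan Kop_bv par_bv vspan_single)
  \<comment> \<open>The minus sign comes from moving \<open>par\<close> past the odd operator of the
    left factor, the power of q from moving K_i past E_j in the right one.\<close>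
  have XY: "X i (Y j v) = cscale (- (q powi cartan i j)) (Y j (X i v))" if "v \<in> ?S" for i j v
  proof -
    have "X i (Y j v) = tmap (\<lambda>u. cscale (- 1) (par A (Eop A i u)))
        (\<lambda>w. cscale (q powi cartan i j) (Eop B j (Kop B i w))) v"
      unfolding X_def Y_def tmap_comp[OF vlin_Eop vlin_Kop]
      by (rule tmap_cong[OF that])
        (simp_all add: rep_par[OF A] rep_KE[OF B] bv_mspace cscale_minus_one del: cartan.simps Eop_bv)
    also have "\<dots> = cscale (- (q powi cartan i j)) (Y j (X i v))"
      by (simp add: X_def Y_def tmap_comp tmap_cscale_left tmap_cscale_right del: cartan.simps)
    finally show ?thesis .
  qed
  show "serre (three_q q) (Eop (tensor A B) i) (Eop (tensor A B) j) (bv n) = 0"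
    unfolding E
  proof (rule serre_add[OF lX lY lX lY X Y X Y])
    show "X i (Y i v) = cscale (- (q\<^sup>2)) (Y i (X i v))"
      "X i (Y j v) = cscale (- (inverse q ^ 2)) (Y j (X i v))"
      "X j (Y i v) = cscale (- (inverse q ^ 2)) (Y i (X j v))" if "v \<in> ?S" for v
      using ij by (simp_all only: XY[OF that] q_powi_cartan) auto
    show "- (q\<^sup>2) * - (inverse q ^ 2) = 1"
      using q_nz by (simp flip: power_mult_distrib)
    show "bv n \<in> ?S" using n by (auto intro: vspan_single)
    fix v assume v: "v \<in> ?S"
    \<comment> \<open>All four words put the same product of commuting diagonal operators on the
      right factor, so it factors out.\<close>
    define K where "K = (\<lambda>w. Kop B i (Kop B i (Kop B i (Kop B j w))))"
    have "serre (three_q q) (X i) (X j) v = tmap (serre (three_q q) (Eop A i) (Eop A j)) K v"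
    proof -
      have "tmap (serre (three_q q) (Eop A i) (Eop A j)) K v =
        tmap (\<lambda>u. Eop A i (Eop A i (Eop A i (Eop A j u)))) K v
        + cscale (three_q q) (tmap (\<lambda>u. Eop A i (Eop A i (Eop A j (Eop A i u)))) K v)
        + cscale (- three_q q) (tmap (\<lambda>u. Eop A i (Eop A j (Eop A i (Eop A i u)))) K v)
        + cscale (- 1) (tmap (\<lambda>u. Eop A j (Eop A i (Eop A i (Eop A i u)))) K v)"
        unfolding tmap_cscale_left[symmetric] tmap_add_left[symmetric] serre_def
        by (intro arg_cong[where f = "\<lambda>f. tmap f K v"] ext poly_mapping_eqI)
          (simp add: lookup_add lookup_minus)
      moreover have "(\<lambda>w. Kop B i (Kop B i (Kop B j (Kop B i w)))) = K"
        "(\<lambda>w. Kop B i (Kop B j (Kop B i (Kop B i w)))) = K"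
        "(\<lambda>w. Kop B j (Kop B i (Kop B i (Kop B i w)))) = K"
        unfolding K_def by (metis Kop_commute)+
      ultimately show ?thesis
        unfolding serre_def X_def
        by (simp add: tmap_comp vlin_comp flip: K_def)
          (rule poly_mapping_eqI, simp add: lookup_add lookup_minus)
    qed
    also have "\<dots> = tmap (\<lambda>u. 0) K v"
      by (rule tmap_cong[OF v]) (simp_all add: rep_serre[OF A] bv_mspace ij)
    finally show "serre (three_q q) (X i) (X j) v = 0" by (simp add: tmap_zero_left)
    \<comment> \<open>In every word the left factor is the fourth power of \<open>par\<close>, that
      is, the identity.\<close>
    have "serre (three_q q) (Y i) (Y j) v = tmap (\<lambda>u. u) (serre (three_q q) (Eop B i) (Eop B j)) v"
    proof -
      have "tmap (\<lambda>u. u) (serre (three_q q) (Eop B i) (Eop B j)) v =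
        tmap (\<lambda>u. u) (\<lambda>u. Eop B i (Eop B i (Eop B i (Eop B j u)))) v
        + cscale (three_q q) (tmap (\<lambda>u. u) (\<lambda>u. Eop B i (Eop B i (Eop B j (Eop B i u)))) v)
        + cscale (- three_q q) (tmap (\<lambda>u. u) (\<lambda>u. Eop B i (Eop B j (Eop B i (Eop B i u)))) v)
        + cscale (- 1) (tmap (\<lambda>u. u) (\<lambda>u. Eop B j (Eop B i (Eop B i (Eop B i u)))) v)"
        unfolding tmap_cscale_right[symmetric] tmap_add_right[symmetric] serre_def
        by (intro arg_cong[where f = "\<lambda>f. tmap (\<lambda>u. u) f v"] ext poly_mapping_eqI)
          (simp add: lookup_add lookup_minus)
      then show ?thesis
        unfolding serre_def Y_def
        by (simp add: tmap_comp vlin_comp)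
          (rule poly_mapping_eqI, simp add: lookup_add lookup_minus)
    qed
    also have "\<dots> = tmap (\<lambda>u. u) (\<lambda>u. 0) v"
      by (rule tmap_cong[OF v]) (simp_all add: rep_serre[OF B] bv_mspace ij)
    finally show "serre (three_q q) (Y i) (Y j) v = 0" by (simp add: tmap_zero_right)
  qed (fact three_q_eq | assumption)+
qed

subsection \<open>Category O\<close>

lemma catO_rep: "M \<in> catO q \<Longrightarrow> is_rep q M"
  by (simp add: catO_def)

text \<open>For a single cone with apex (a, c) a weight fixes the depth by
  \<open>q_powi_inj\<close>, so finite depth levels already give finite weight spaces.\<close>

lemma catO_by_depth:
  assumes "is_rep q M"
    and wt: "\<And>i. i \<in> idx M \<Longrightarrow> wt M N0 i = q powi (2 * int (d i)) * a"
      "\<And>i. i \<in> idx M \<Longrightarrow> wt M N1 i = q powi (- 2 * int (d i)) * c"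
    and fin: "\<And>n. finite {i \<in> idx M. d i = n}"
  shows "M \<in> catO q"
  unfolding catO_def
proof (intro CollectI conjI allI assms(1))
  fix x y
  show "finite {i \<in> idx M. wt M N0 i = x \<and> wt M N1 i = y}"
  proof (cases "\<exists>i0\<in>idx M. wt M N0 i0 = x")
    case True
    then obtain i0 where i0: "i0 \<in> idx M" "wt M N0 i0 = x" by blast
    have "a \<noteq> 0" using rep_wt[OF assms(1) i0(1), of N0] wt(1)[OF i0(1)] by auto
    then have "{i \<in> idx M. wt M N0 i = x \<and> wt M N1 i = y} \<subseteq> {i \<in> idx M. d i = d i0}"
      using wt(1) i0 by (auto intro: q_powi_inj)
    then show ?thesis using fin finite_subset by blast
  next
    case False
    then have "{i \<in> idx M. wt M N0 i = x \<and> wt M N1 i = y} = {}" by blast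
    then show ?thesis by (simp only: finite.emptyI)
  qed
next
  show "\<exists>Om. finite Om \<and> (\<forall>i\<in>idx M. \<exists>(a, c)\<in>Om. \<exists>n::nat.
      wt M N0 i = q powi (2 * int n) * a \<and> wt M N1 i = q powi (- 2 * int n) * c)"
    using wt by (intro exI[of _ "{(a, c)}"]) auto
qed

text \<open>Products of apexes are the apexes of the tensor product. For a fixed pair of cones a
  weight determines the total depth m + n, which leaves finitely many pairs (m, n) and a finite cell
  for each.\<close>

lemma tensor_catO:
  assumes A: "A \<in> catO q" and B: "B \<in> catO q"
  shows "tensor A B \<in> catO q"
proof -
  note rA = catO_rep[OF A] and rB = catO_rep[OF B]
  define cell where "cell = (\<lambda>(M :: sbmod) x n. {i \<in> idx M. wt M N0 i = q powi (2 * int n) * fst x \<and>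
    wt M N1 i = q powi (- 2 * int n) * snd x})"
  have fcell: "finite (cell M x n)" if "M \<in> catO q" for M x n
    using that unfolding catO_def cell_def by blast
  have "\<exists>Om. finite Om \<and> (\<forall>i\<in>idx M. \<exists>x\<in>Om. \<exists>n. i \<in> cell M x n)" if "M \<in> catO q" for M
    using that unfolding catO_def cell_def by (fastforce simp: split_beta)
  then obtain Om where Om: "\<And>M. M \<in> catO q \<Longrightarrow> finite (Om M)"
    "\<And>M i. M \<in> catO q \<Longrightarrow> i \<in> idx M \<Longrightarrow> \<exists>x\<in>Om M. \<exists>n. i \<in> cell M x n"
    by metis
  have pw: "q powi (2 * int m) * a * (q powi (2 * int n) * b) = q powi (2 * int (m + n)) * (a * b)"
    "q powi (- 2 * int m) * a * (q powi (- 2 * int n) * b) = q powi (- 2 * int (m + n)) * (a * b)"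
    for m n a b
    using q_nz by (simp_all add: distrib_left power_int_add power_int_diff power_int_minus field_simps)
  show ?thesis
    unfolding catO_def
  proof (intro CollectI conjI allI tensor_rep rA rB)
    fix x y
    let ?P = "\<lambda>u v. {(m, n). q powi (2 * int (m + n)) * (fst u * fst v) = x}"
    \<comment> \<open>The chosen apex sets may contain zero entries. Their cells are empty because
      weights are nonzero, and discarding them permits cancelling the apexes.\<close>
    let ?U = "\<Union>u\<in>{u \<in> Om A. fst u \<noteq> 0}. \<Union>v\<in>{v \<in> Om B. fst v \<noteq> 0}. \<Union>(m, n)\<in>?P u v.
      prod_encode ` (cell A u m \<times> cell B v n)"
    have fP: "finite (?P u v)" if "fst u \<noteq> 0" "fst v \<noteq> 0" for u v
    proof (cases "?P u v = {}")
      case False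
      then obtain m0 n0 where 0: "q powi (2 * int (m0 + n0)) * (fst u * fst v) = x" by blast
      have "?P u v \<subseteq> {..m0 + n0} \<times> {..m0 + n0}"
      proof
        fix p assume "p \<in> ?P u v"
        then obtain m n where p: "p = (m, n)" "x = q powi (2 * int (m + n)) * (fst u * fst v)" by auto
        then have "q powi (2 * int (m + n)) = q powi (2 * int (m0 + n0))"
          using 0 that by auto
        then have "m + n = m0 + n0" by (rule q_powi_inj)
        then show "p \<in> {..m0 + n0} \<times> {..m0 + n0}" using p by auto
      qed
      then show ?thesis by (rule finite_subset) simp
    qed (simp only: finite.emptyI)
    have "finite ?U"
      using Om(1)[OF A] Om(1)[OF B] fP fcell[OF A] fcell[OF B]
      by (intro finite_UN_I) auto
    moreover have "{n \<in> idx (tensor A B). wt (tensor A B) N0 n = x \<and> wt (tensor A B) N1 n = y} \<subseteq> ?U"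
    proof
      fix n assume "n \<in> {n \<in> idx (tensor A B). wt (tensor A B) N0 n = x \<and> wt (tensor A B) N1 n = y}"
      then have "n \<in> idx (tensor A B)" and x: "wt (tensor A B) N0 n = x" by auto
      then obtain i k where n: "n = prod_encode (i, k)" and i: "i \<in> idx A" and k: "k \<in> idx B" by auto
      obtain u m where u: "u \<in> Om A" "i \<in> cell A u m" using Om(2)[OF A i] by blast
      obtain v m' where v: "v \<in> Om B" "k \<in> cell B v m'" using Om(2)[OF B k] by blast
      have "fst u \<noteq> 0" "fst v \<noteq> 0"
        using u v rep_wt[OF rA i, of N0] rep_wt[OF rB k, of N0] by (auto simp: cell_def)
      moreover have "q powi (2 * int (m + m')) * (fst u * fst v) = x"
        unfolding pw(1)[symmetric] x[symmetric] using u v by (simp add: n cell_def)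
      ultimately show "n \<in> ?U"
        using u v n by fast
    qed
    ultimately show "finite {n \<in> idx (tensor A B). wt (tensor A B) N0 n = x \<and> wt (tensor A B) N1 n = y}"
      by (rule finite_subset[rotated])
  next
    show "\<exists>Om. finite Om \<and> (\<forall>n\<in>idx (tensor A B). \<exists>(a, c)\<in>Om. \<exists>m::nat.
      wt (tensor A B) N0 n = q powi (2 * int m) * a \<and> wt (tensor A B) N1 n = q powi (- 2 * int m) * c)"
    proof (intro exI[of _ "(\<lambda>(u, v). (fst u * fst v, snd u * snd v)) ` (Om A \<times> Om B)"] conjI ballI)
      fix n assume "n \<in> idx (tensor A B)"
      then obtain i k where n: "n = prod_encode (i, k)" and i: "i \<in> idx A" and k: "k \<in> idx B" by auto
      obtain u m where u: "u \<in> Om A" "i \<in> cell A u m" using Om(2)[OF A i] by blast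
      obtain v m' where v: "v \<in> Om B" "k \<in> cell B v m'" using Om(2)[OF B k] by blast
      have "wt (tensor A B) N0 n = q powi (2 * int (m + m')) * (fst u * fst v) \<and>
          wt (tensor A B) N1 n = q powi (- 2 * int (m + m')) * (snd u * snd v)"
        unfolding pw[symmetric] using u v by (simp add: n cell_def)
      moreover have "(fst u * fst v, snd u * snd v) \<in> (\<lambda>(u, v). (fst u * fst v, snd u * snd v)) ` (Om A \<times> Om B)"
        using u v by force
      ultimately show "\<exists>(a, c)\<in>(\<lambda>(u, v). (fst u * fst v, snd u * snd v)) ` (Om A \<times> Om B). \<exists>m::nat.
        wt (tensor A B) N0 n = q powi (2 * int m) * a \<and> wt (tensor A B) N1 n = q powi (- 2 * int m) * c"
        by blast
    qed (use Om(1)[OF A] Om(1)[OF B] in auto)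
  qed
qed

end


text \<open>The basis vector \<open>bv 0\<close> would be rewritten to the unit \<open>1\<close> of the convolution product.\<close>

declare single_one [simp del]

section \<open>Exact sequences\<close>

text \<open>
  Short exact sequences of vector spaces split; keeping the (merely linear) splittings
  \<open>r\<close>, \<open>s\<close> as data turns exactness into identities, which tensor products and direct sums preserve.
\<close>

definition split_exact ::
    "sbmod \<Rightarrow> sbmod \<Rightarrow> sbmod \<Rightarrow> (vec \<Rightarrow> vec) \<Rightarrow> (vec \<Rightarrow> vec) \<Rightarrow> (vec \<Rightarrow> vec) \<Rightarrow> (vec \<Rightarrow> vec) \<Rightarrow> bool"
  where "split_exact A B C f g r s \<longleftrightarrow>
    vlin f \<and> vlin g \<and> vlin r \<and> vlin s \<and> is_hom A B f \<and> is_hom B C g \<and>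
    (\<forall>i\<in>idx B. r (bv i) \<in> mspace A) \<and> (\<forall>i\<in>idx C. s (bv i) \<in> mspace B) \<and>
    (\<forall>i\<in>idx A. r (f (bv i)) = bv i \<and> g (f (bv i)) = 0) \<and> (\<forall>i\<in>idx C. g (s (bv i)) = bv i) \<and>
    (\<forall>i\<in>idx B. f (r (bv i)) + s (g (bv i)) = bv i)"

lemma mspace_eqI:
  assumes "vlin f" "vlin g" "\<And>i. i \<in> idx M \<Longrightarrow> f (bv i) = g (bv i)" "v \<in> mspace M"
  shows "f v = g v"
  using vspan_eqI[OF assms(1-3)] assms(4) by (auto simp: mspace_vspan)

lemma split_exactD:
  assumes "split_exact A B C f g r s"
  shows "vlin f" "vlin g" "vlin r" "vlin s" "is_hom A B f" "is_hom B C g"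
    and "v \<in> mspace B \<Longrightarrow> r v \<in> mspace A" "v \<in> mspace C \<Longrightarrow> s v \<in> mspace B"
    and "v \<in> mspace A \<Longrightarrow> r (f v) = v" "v \<in> mspace A \<Longrightarrow> g (f v) = 0"
    and "v \<in> mspace C \<Longrightarrow> g (s v) = v" "v \<in> mspace B \<Longrightarrow> f (r v) + s (g v) = v"
proof -
  note a = assms[unfolded split_exact_def]
  show l: "vlin f" "vlin g" "vlin r" "vlin s" "is_hom A B f" "is_hom B C g" using a by auto
  show "v \<in> mspace B \<Longrightarrow> r v \<in> mspace A" "v \<in> mspace C \<Longrightarrow> s v \<in> mspace B"
    unfolding mspace_vspan
    by (erule vlin_vspan[OF l(3), rotated]; use a in \<open>auto simp: mspace_vspan\<close>)
      (erule vlin_vspan[OF l(4), rotated]; use a in \<open>auto simp: mspace_vspan\<close>)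
  show "v \<in> mspace A \<Longrightarrow> r (f v) = v"
    by (rule mspace_eqI[of "\<lambda>v. r (f v)" "\<lambda>v. v" A]) (use a l in \<open>auto intro: vlin_comp[OF l(3) l(1)]\<close>)
  show "v \<in> mspace A \<Longrightarrow> g (f v) = 0"
    by (rule mspace_eqI[of "\<lambda>v. g (f v)" "\<lambda>v. 0" A]) (use a l in \<open>auto intro: vlin_comp[OF l(2) l(1)]\<close>)
  show "v \<in> mspace C \<Longrightarrow> g (s v) = v"
    by (rule mspace_eqI[of "\<lambda>v. g (s v)" "\<lambda>v. v" C]) (use a l in \<open>auto intro: vlin_comp[OF l(2) l(4)]\<close>)
  show "v \<in> mspace B \<Longrightarrow> f (r v) + s (g v) = v"
    by (rule mspace_eqI[of "\<lambda>v. f (r v) + s (g v)" "\<lambda>v. v" B])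
      (use a l in \<open>auto intro: vlin_plus[OF vlin_comp[OF l(1) l(3)] vlin_comp[OF l(4) l(2)]]\<close>)
qed

lemma split_exact_short_exact:
  assumes "split_exact A B C f g r s" shows "short_exact A B C"
proof -
  note d = split_exactD[OF assms]
  show ?thesis
    unfolding short_exact_def
  proof (intro exI conjI)
    show "is_hom A B f" "is_hom B C g" by (fact d)+
    show "inj_on f (mspace A)" using d(9) by (metis inj_on_inverseI)
    show "f ` mspace A = {v \<in> mspace B. g v = 0}"
    proof
      show "f ` mspace A \<subseteq> {v \<in> mspace B. g v = 0}"
        using is_hom_mspace[OF d(5)] d(10) by auto
      show "{v \<in> mspace B. g v = 0} \<subseteq> f ` mspace A"
      proof
        fix v assume v: "v \<in> {v \<in> mspace B. g v = 0}"
        then have "f (r v) = v" using d(12)[of v] by (simp add: vlin_zero[OF d(4)])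
        then show "v \<in> f ` mspace A" using d(7)[of v] v by (intro image_eqI[of v f "r v"]) auto
      qed
    qed
    show "g ` mspace B = mspace C"
    proof
      show "g ` mspace B \<subseteq> mspace C" using is_hom_mspace[OF d(6)] by auto
      show "mspace C \<subseteq> g ` mspace B"
      proof
        fix v assume "v \<in> mspace C"
        then show "v \<in> g ` mspace B" using d(8)[of v] d(11)[of v] by (intro image_eqI[of v g "s v"]) auto
      qed
    qed
  qed
qed

lemma is_hom_vlin:
  assumes A: "is_rep q A" and f: "is_hom A B f"
  shows "is_hom A B (lin_ext (\<lambda>i. f (bv i)))"
proof (rule is_homI)
  fix i j assume i: "i \<in> idx A"
  show "f (bv i) \<in> hspace B (podd A i)" using is_homD(3)[OF f bv_hspace[OF i]] .
  show "lin_ext (\<lambda>i. f (bv i)) (act A j i) = Eop B j (f (bv i))"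
    using is_homD(1)[OF f bv_mspace[OF i], of j] is_hom_lin_ext[OF f rep_act_mspace[OF A i, of j]] by simp
  show "Kop B j (f (bv i)) = cscale (wt A j i) (f (bv i))"
    using is_homD(2)[OF f bv_mspace[OF i], of j] is_homD(5)[OF f bv_mspace[OF i], of "wt A j i"]
    by (simp add: Kop_bv)
qed

text \<open>Preimages of the basis vectors of \<open>C\<close> define the section s. For each basis
  vector x of \<open>B\<close>, x - s (g x) lies in the kernel of g, hence in the image of f, and
  its preimage defines the retraction r.\<close>

lemma short_exact_split:
  assumes A: "is_rep q A" and B: "is_rep q B" and ex: "short_exact A B C"
  obtains f g r s where "split_exact A B C f g r s"
proof -
  from ex obtain f0 g0 where f0: "is_hom A B f0" and g0: "is_hom B C g0" and inj: "inj_on f0 (mspace A)"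
    and im: "f0 ` mspace A = {v \<in> mspace B. g0 v = 0}" and surj: "g0 ` mspace B = mspace C"
    unfolding short_exact_def by blast
  define f where "f = lin_ext (\<lambda>i. f0 (bv i))"
  define g where "g = lin_ext (\<lambda>i. g0 (bv i))"
  have ff: "f v = f0 v" if "v \<in> mspace A" for v
    unfolding f_def using is_hom_lin_ext[OF f0 that] by simp
  have gg: "g v = g0 v" if "v \<in> mspace B" for v
    unfolding g_def using is_hom_lin_ext[OF g0 that] by simp
  have homf: "is_hom A B f" and homg: "is_hom B C g"
    unfolding f_def g_def using is_hom_vlin A B f0 g0 by blast+
  have lf: "vlin f" and lg: "vlin g" by (simp_all add: f_def g_def)
  have "\<forall>i\<in>idx C. \<exists>v. v \<in> mspace B \<and> g v = bv i"
    using surj bv_mspace gg by (metis imageE)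
  then obtain s0 where s0: "\<And>i. i \<in> idx C \<Longrightarrow> s0 i \<in> mspace B \<and> g (s0 i) = bv i" by metis
  define s where "s = lin_ext s0"
  have ls: "vlin s" by (simp add: s_def)
  have gs: "g (s v) = v" if "v \<in> mspace C" for v
    by (rule mspace_eqI[of "\<lambda>v. g (s v)" "\<lambda>v. v" C])
      (use that s0 in \<open>auto simp: s_def intro: vlin_comp[OF lg ls]\<close>, metis lg ls s_def vlin_comp)
  have sB: "s v \<in> mspace B" if "v \<in> mspace C" for v
    using that unfolding mspace_vspan
    by (rule vlin_vspan[OF ls, rotated]) (use s0 in \<open>auto simp: s_def mspace_vspan\<close>)
  have "\<exists>u. u \<in> mspace A \<and> f u = bv i - s (g (bv i))" if i: "i \<in> idx B" for i
  proof -
    have m: "bv i - s (g (bv i)) \<in> mspace B"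
      using bv_mspace[OF i] sB[OF is_hom_mspace[OF homg bv_mspace[OF i]]]
      by (simp add: mspace_vspan vspan_diff)
    have "g (bv i - s (g (bv i))) = 0"
      using gs[OF is_hom_mspace[OF homg bv_mspace[OF i]]] by (simp add: vlin_simps[OF lg])
    then have "bv i - s (g (bv i)) \<in> f0 ` mspace A"
      using im m gg[OF m] by simp
    then show ?thesis using ff by (metis imageE)
  qed
  then obtain r0 where r0: "\<And>i. i \<in> idx B \<Longrightarrow> r0 i \<in> mspace A \<and> f (r0 i) = bv i - s (g (bv i))" by metis
  define r where "r = lin_ext r0"
  have lr: "vlin r" by (simp add: r_def)
  have rA: "r v \<in> mspace A" if "v \<in> mspace B" for v
    using that unfolding mspace_vspan
    by (rule vlin_vspan[OF lr, rotated]) (use r0 in \<open>auto simp: r_def mspace_vspan\<close>)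
  have fr: "f (r v) = v - s (g v)" if "v \<in> mspace B" for v
    by (rule mspace_eqI[of "\<lambda>v. f (r v)" "\<lambda>v. v - s (g v)" B])
      (use that r0 in \<open>auto simp: r_def intro: vlin_comp[OF lf] vlin_minus_fun vlin_comp[OF ls lg]\<close>)
  have gf: "g (f v) = 0" if "v \<in> mspace A" for v
    using that im ff gg is_hom_mspace[OF homf that] by auto
  have rf: "r (f v) = v" if v: "v \<in> mspace A" for v
  proof (rule inj_onD[OF inj])
    have "f (r (f v)) = f v"
      using fr[OF is_hom_mspace[OF homf v]] by (simp add: gf[OF v] vlin_zero[OF ls])
    then show "f0 (r (f v)) = f0 v" using ff v rA is_hom_mspace[OF homf v] by metis
  qed (use v rA is_hom_mspace[OF homf v] in auto)
  have "split_exact A B C f g r s"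
    unfolding split_exact_def
    using lf lg lr ls homf homg rA sB rf gf gs fr bv_mspace by auto
  then show ?thesis by (rule that)
qed

lemma hom_par:
  assumes "vlin f" "is_hom M N f" "i \<in> idx M"
  shows "par N (f (bv i)) = f (par M (bv i))"
  using par_hspace[OF is_homD(3)[OF assms(2) bv_hspace[OF assms(3)]]] par_hspace[OF bv_hspace[OF assms(3)]]
  by (simp add: vlin_simps[OF assms(1)] del: cscale_single)

lemma tmap_hom:
  assumes f: "vlin f" "is_hom A A' f" and g: "vlin g" "is_hom B B' g"
  shows "is_hom (tensor A B) (tensor A' B') (tmap f g)"
  unfolding tmap_def
proof (rule is_homI, unfold tmap_def[symmetric])
  fix n j assume "n \<in> idx (tensor A B)"
  then obtain i k where n: "n = prod_encode (i, k)" and i: "i \<in> idx A" and k: "k \<in> idx B" by auto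
  note v = bv_mspace[OF i] bv_mspace[OF k]
  let ?\<phi> = "case prod_decode n of (i, k) \<Rightarrow> tens_vec (f (bv i)) (g (bv k))"
  have \<phi>: "?\<phi> = tens_vec (f (bv i)) (g (bv k))" by (simp add: n)
  show "?\<phi> \<in> hspace (tensor A' B') (podd (tensor A B) n)"
    unfolding \<phi> using tens_vec_hspace[OF is_homD(3)[OF f(2) bv_hspace[OF i]] is_homD(3)[OF g(2) bv_hspace[OF k]]]
    by (simp add: n)
  have "tmap f g (Eop (tensor A B) j (bv n)) = Eop (tensor A' B') j ?\<phi>"
    unfolding \<phi> Eop_tensor
    by (simp add: vlin_add tmap_bv n tmap_tens f(1) g(1) hom_par[OF f i] is_homD(1,2)[OF f(2) v(1)]
        is_homD(1,2)[OF g(2) v(2)] del: Eop_bv)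
  then show "tmap f g (act (tensor A B) j n) = Eop (tensor A' B') j ?\<phi>" by simp
  have "Kop (tensor A' B') j ?\<phi> = tmap f g (Kop (tensor A B) j (bv n))"
    unfolding \<phi> Kop_tensor
    by (simp add: tmap_bv n tmap_tens f(1) g(1) is_homD(2)[OF f(2) v(1)] is_homD(2)[OF g(2) v(2)])
  also have "\<dots> = cscale (wt (tensor A B) j n) (tmap f g (bv n))"
    using vlin_cscale[OF vlin_tmap[of f g], of "wt (tensor A B) j n" "bv n"] by (simp add: Kop_bv)
  finally show "Kop (tensor A' B') j ?\<phi> = cscale (wt (tensor A B) j n) ?\<phi>"
    by (simp add: tmap_bv split_beta)
qed

lemma is_hom_id: "is_hom M M (\<lambda>v. v)"
  by (simp add: is_hom_def)

lemma split_exact_tensor_right: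
  assumes "split_exact A B C f g r s"
  shows "split_exact (tensor A D) (tensor B D) (tensor C D)
    (tmap f (\<lambda>v. v)) (tmap g (\<lambda>v. v)) (tmap r (\<lambda>v. v)) (tmap s (\<lambda>v. v))"
proof -
  note d = split_exactD[OF assms]
  show ?thesis
    unfolding split_exact_def
  proof (intro conjI ballI)
    show "is_hom (tensor A D) (tensor B D) (tmap f (\<lambda>v. v))" "is_hom (tensor B D) (tensor C D) (tmap g (\<lambda>v. v))"
      by (rule tmap_hom d is_hom_id vlin_id)+
  qed (use assms[unfolded split_exact_def] in \<open>auto simp: tmap_bv tmap_tens mspace_vspan bv_tensor
      simp flip: tens_vec_add_left intro!: tens_vec_vspan vspan_single\<close>)
qed

lemma split_exact_tensor_left:
  assumes "split_exact A B C f g r s"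
  shows "split_exact (tensor D A) (tensor D B) (tensor D C)
    (tmap (\<lambda>v. v) f) (tmap (\<lambda>v. v) g) (tmap (\<lambda>v. v) r) (tmap (\<lambda>v. v) s)"
proof -
  note d = split_exactD[OF assms]
  show ?thesis
    unfolding split_exact_def
  proof (intro conjI ballI)
    show "is_hom (tensor D A) (tensor D B) (tmap (\<lambda>v. v) f)" "is_hom (tensor D B) (tensor D C) (tmap (\<lambda>v. v) g)"
      by (rule tmap_hom d is_hom_id vlin_id)+
  qed (use assms[unfolded split_exact_def] in \<open>auto simp: tmap_bv tmap_tens mspace_vspan bv_tensor
      simp flip: tens_vec_add_right intro!: tens_vec_vspan vspan_single\<close>)
qed

lemma short_exact_tensor:
  assumes "is_rep q A" "is_rep q B" "short_exact A B C"
  shows "short_exact (tensor A D) (tensor B D) (tensor C D)"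
    and "short_exact (tensor D A) (tensor D B) (tensor D C)"
  using short_exact_split[OF assms] split_exact_tensor_left split_exact_tensor_right split_exact_short_exact
  by metis+

subsection \<open>Direct sums\<close>

text \<open>The last equation exhibits the m-th summand as \<open>tens_vec (bv m)\<close> applied to
  \<open>A m\<close>, so direct sums reuse the calculus of \<open>tens_vec\<close>.\<close>

lemma dsum_simps [simp]:
  "idx (dsum A) = prod_encode ` (SIGMA m:UNIV. idx (A m))"
  "podd (dsum A) (prod_encode (m, i)) = podd (A m) i"
  "wt (dsum A) j (prod_encode (m, i)) = wt (A m) j i"
  "act (dsum A) j (prod_encode (m, i)) = tens_vec (bv m) (act (A m) j i)"
proof -
  have "lin_ext (\<lambda>i'. bv (prod_encode (m, i'))) v = tens_vec (bv m) v" for v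
    by (rule vlin_eq_all[of "lin_ext (\<lambda>i'. bv (prod_encode (m, i')))" "tens_vec (bv m)"])
      (auto simp: tens_vec_single intro: vlin_tens_right)
  then show "act (dsum A) j (prod_encode (m, i)) = tens_vec (bv m) (act (A m) j i)"
    by (simp add: dsum_def)
qed (simp_all add: dsum_def)

lemma vlin_tens [simp, intro]: "vlin (tens_vec w)"
  using vlin_tens_right[OF vlin_id] by simp

lemma Eop_dsum: "Eop (dsum A) j (tens_vec (bv m) v) = tens_vec (bv m) (Eop (A m) j v)"
  by (rule vlin_eq_all[of "\<lambda>v. Eop (dsum A) j (tens_vec (bv m) v)" "\<lambda>v. tens_vec (bv m) (Eop (A m) j v)"])
    (auto simp: tens_vec_single intro: vlin_comp[OF vlin_Eop vlin_tens] vlin_comp[OF vlin_tens vlin_Eop])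

lemma Kop_dsum: "Kop (dsum A) j (tens_vec (bv m) v) = tens_vec (bv m) (Kop (A m) j v)"
  by (rule vlin_eq_all[of "\<lambda>v. Kop (dsum A) j (tens_vec (bv m) v)" "\<lambda>v. tens_vec (bv m) (Kop (A m) j v)"])
    (auto simp: tens_vec_single Kop_bv intro: vlin_comp[OF vlin_Kop vlin_tens] vlin_comp[OF vlin_tens vlin_Kop])

lemma tens_vec_hspace_dsum: "v \<in> hspace (A m) p \<Longrightarrow> tens_vec (bv m) v \<in> hspace (dsum A) p"
  unfolding hspace_vspan
  by (drule tens_vec_vspan[OF vspan_single[OF singletonI]], erule subsetD[OF vspan_mono, rotated]) auto

lemma tens_vec_mspace_dsum: "v \<in> mspace (A m) \<Longrightarrow> tens_vec (bv m) v \<in> mspace (dsum A)"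
  unfolding mspace_vspan
  by (drule tens_vec_vspan[OF vspan_single[OF singletonI]], erule subsetD[OF vspan_mono, rotated]) auto

lemma serre_dsum:
  "serre c (Eop (dsum A) i) (Eop (dsum A) j) (tens_vec (bv m) v) = tens_vec (bv m) (serre c (Eop (A m) i) (Eop (A m) j) v)"
  by (simp add: serre_def Eop_dsum vlin_simps)

lemma dsum_rep:
  assumes "\<And>m. is_rep q (A m)"
  shows "is_rep q (dsum A)"
proof (rule is_repI)
  fix i j n assume "n \<in> idx (dsum A)"
  then obtain m k where n: "n = prod_encode (m, k)" and k: "k \<in> idx (A m)" by auto
  have bv: "bv n = tens_vec (bv m) (bv k)" by (simp add: n tens_vec_single)
  show "wt (dsum A) j n \<noteq> 0" using rep_wt[OF assms k] by (simp add: n)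
  show "act (dsum A) j n \<in> hspace (dsum A) (\<not> podd (dsum A) n)"
    using tens_vec_hspace_dsum[of _ A, OF rep_act[OF assms k]] by (simp add: n)
  show "Kop (dsum A) i (act (dsum A) j n) = cscale (q powi cartan i j * wt (dsum A) i n) (act (dsum A) j n)"
    using rep_KE[OF assms bv_mspace[OF k], of i j]
    by (simp add: n Kop_dsum Kop_bv Eop_single tens_vec_cscale_right del: cartan.simps)
  assume "i \<noteq> j"
  then show "serre (three_q q) (Eop (dsum A) i) (Eop (dsum A) j) (bv n) = 0"
    unfolding bv serre_dsum by (simp add: rep_serre[OF assms bv_mspace[OF k]])
qed

definition dmap :: "(nat \<Rightarrow> vec \<Rightarrow> vec) \<Rightarrow> vec \<Rightarrow> vec"
  where "dmap f = lin_ext (\<lambda>n. case prod_decode n of (m, i) \<Rightarrow> tens_vec (bv m) (f m (bv i)))"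

lemma vlin_dmap [simp, intro]: "vlin (dmap f)"
  by (simp add: dmap_def)

lemma dmap_bv: "dmap f (bv (prod_encode (m, i))) = tens_vec (bv m) (f m (bv i))"
  by (simp add: dmap_def)

lemma dmap_tens:
  assumes "vlin (f m)" shows "dmap f (tens_vec (bv m) v) = tens_vec (bv m) (f m v)"
  by (rule vlin_eq_all[of "\<lambda>v. dmap f (tens_vec (bv m) v)" "\<lambda>v. tens_vec (bv m) (f m v)"])
    (auto simp: tens_vec_single dmap_bv
      intro: vlin_comp[OF vlin_dmap vlin_tens] vlin_comp[OF vlin_tens assms])

lemma dmap_hom:
  assumes l: "\<And>m. vlin (f m)" and f: "\<And>m. is_hom (A m) (B m) (f m)"
  shows "is_hom (dsum A) (dsum B) (dmap f)"
  unfolding dmap_def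
proof (rule is_homI, unfold dmap_def[symmetric])
  fix n j assume "n \<in> idx (dsum A)"
  then obtain m k where n: "n = prod_encode (m, k)" and k: "k \<in> idx (A m)" by auto
  let ?\<phi> = "case prod_decode n of (m, i) \<Rightarrow> tens_vec (bv m) (f m (bv i))"
  have \<phi>: "?\<phi> = tens_vec (bv m) (f m (bv k))" by (simp add: n)
  show "?\<phi> \<in> hspace (dsum B) (podd (dsum A) n)"
    unfolding \<phi> using tens_vec_hspace_dsum[of _ B, OF is_homD(3)[OF f bv_hspace[OF k]]] by (simp add: n)
  show "dmap f (act (dsum A) j n) = Eop (dsum B) j ?\<phi>"
    unfolding \<phi> using is_homD(1)[OF f bv_mspace[OF k], of j] by (simp add: n dmap_tens l Eop_dsum)
  show "Kop (dsum B) j ?\<phi> = cscale (wt (dsum A) j n) ?\<phi>"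
    unfolding \<phi>
    using is_homD(2)[OF f bv_mspace[OF k], of j] is_homD(5)[OF f bv_mspace[OF k], of "wt (A m) j k"]
    by (simp add: n Kop_dsum Kop_bv tens_vec_cscale_right)
qed

text \<open>Splittings are chosen for all m simultaneously and summed; being identities on basis
  vectors, they survive an infinite sum.\<close>

lemma short_exact_dsum:
  assumes "\<And>m. is_rep q (A m)" "\<And>m. is_rep q (B m)" "\<And>m. short_exact (A m) (B m) (C m)"
  shows "short_exact (dsum A) (dsum B) (dsum C)"
proof -
  have "\<forall>m. \<exists>f g r s. split_exact (A m) (B m) (C m) f g r s"
    using short_exact_split[OF assms] by metis
  then obtain f g r s where *: "\<And>m. split_exact (A m) (B m) (C m) (f m) (g m) (r m) (s m)"
    by metis
  note d = split_exactD[OF *]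
  have "split_exact (dsum A) (dsum B) (dsum C) (dmap f) (dmap g) (dmap r) (dmap s)"
    unfolding split_exact_def
    by (auto simp: dmap_bv dmap_tens d bv_mspace
        simp flip: tens_vec_add_right intro!: dmap_hom d tens_vec_mspace_dsum simp: tens_vec_single)
  then show ?thesis by (rule split_exact_short_exact)
qed

text \<open>One half of the swindle: the projection deletes summand 0 and renumbers the others, so
  the full sum differs from the shifted one by \<open>A 0\<close>.\<close>

lemma short_exact_dsum_Suc:
  assumes "\<And>m. is_rep q (A m)"
  shows "short_exact (A 0) (dsum A) (dsum (\<lambda>m. A (Suc m)))"
proof -
  let ?f = "lin_ext (\<lambda>i. bv (prod_encode (0, i)))"
  let ?g = "lin_ext (\<lambda>n. case prod_decode n of (m, i) \<Rightarrow>
    if m = 0 then 0 else bv (prod_encode (m - 1, i)))"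
  let ?r = "lin_ext (\<lambda>n. case prod_decode n of (m, i) \<Rightarrow> if m = 0 then bv i else 0)"
  let ?s = "lin_ext (\<lambda>n. case prod_decode n of (m, i) \<Rightarrow> bv (prod_encode (Suc m, i)))"
  have f: "?f v = tens_vec (bv 0) v" for v
    by (rule vlin_eq_all[of ?f "tens_vec (bv 0)"]) (auto simp: tens_vec_single)
  have lg: "vlin (\<lambda>v. if m = 0 then 0 else tens_vec (bv (m - 1)) v)" for m
    by (cases "m = 0") auto
  have g: "?g (tens_vec (bv m) v) = (if m = 0 then 0 else tens_vec (bv (m - 1)) v)" for m v
    by (rule vlin_eq_all[of "\<lambda>v. ?g (tens_vec (bv m) v)" "\<lambda>v. if m = 0 then 0 else tens_vec (bv (m - 1)) v"])
      (auto simp: tens_vec_single lg intro: vlin_comp[OF vlin_lin_ext vlin_tens])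
  have "split_exact (A 0) (dsum A) (dsum (\<lambda>m. A (Suc m))) ?f ?g ?r ?s"
    unfolding split_exact_def
  proof (intro conjI ballI)
    show "is_hom (A 0) (dsum A) ?f"
    proof (rule is_homI)
      fix i j assume i: "i \<in> idx (A 0)"
      show "bv (prod_encode (0, i)) \<in> hspace (dsum A) (podd (A 0) i)"
        using tens_vec_hspace_dsum[of _ A, OF bv_hspace[OF i]] by (simp add: tens_vec_single)
      show "?f (act (A 0) j i) = Eop (dsum A) j (bv (prod_encode (0, i)))"
        unfolding f by simp
      show "Kop (dsum A) j (bv (prod_encode (0, i))) = cscale (wt (A 0) j i) (bv (prod_encode (0, i)))"
        by (simp add: Kop_bv)
    qed
    show "is_hom (dsum A) (dsum (\<lambda>m. A (Suc m))) ?g"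
    proof (rule is_homI)
      fix n j assume "n \<in> idx (dsum A)"
      then obtain m k where n: "n = prod_encode (m, k)" and k: "k \<in> idx (A m)" by auto
      let ?\<phi> = "case prod_decode n of (m, i) \<Rightarrow> if m = 0 then 0 else bv (prod_encode (m - 1, i))"
      show "?\<phi> \<in> hspace (dsum (\<lambda>m. A (Suc m))) (podd (dsum A) n)"
        using k by (cases m) (auto simp: n hspace_vspan intro!: vspan_single)
      show "?g (act (dsum A) j n) = Eop (dsum (\<lambda>m. A (Suc m))) j ?\<phi>"
        unfolding n dsum_simps g by (cases m) (simp_all add: vlin_zero)
      show "Kop (dsum (\<lambda>m. A (Suc m))) j ?\<phi> = cscale (wt (dsum A) j n) ?\<phi>"
        by (cases m) (simp_all add: n vlin_zero Kop_bv)
    qed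
  next
    fix i assume "i \<in> idx (dsum A)"
    then show "?f (?r (bv i)) + ?s (?g (bv i)) = bv i" "?r (bv i) \<in> mspace (A 0)"
      by (auto simp: vlin_zero mspace_vspan intro!: vspan_single)
  qed (auto simp: mspace_vspan intro!: vspan_single)
  then show ?thesis by (rule split_exact_short_exact)
qed

subsection \<open>Isomorphisms\<close>

definition zero_mod :: sbmod
  where "zero_mod = \<lparr>idx = {}, podd = \<lambda>_. False, wt = \<lambda>_ _. 1, act = \<lambda>_ _. 0\<rparr>"

text \<open>Isomorphism in the guise of an exact sequence with zero quotient, so that the results on
  exact sequences, infinite direct sums included, apply to it directly.\<close>

definition mod_iso :: "sbmod \<Rightarrow> sbmod \<Rightarrow> bool"
  where "mod_iso A B \<longleftrightarrow> short_exact A B zero_mod"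

lemma idx_zero_mod [simp]: "idx zero_mod = {}"
  by (simp add: zero_mod_def)

lemma zero_hom: "is_hom M N (\<lambda>v. 0)"
  by (auto simp: is_hom_def hspace_vspan vlin_zero)

lemma split_exact_empty:
  assumes "vlin f" "vlin r" "is_hom A B f" "\<And>i. i \<in> idx B \<Longrightarrow> r (bv i) \<in> mspace A"
    and "\<And>i. i \<in> idx A \<Longrightarrow> r (f (bv i)) = bv i" "\<And>i. i \<in> idx B \<Longrightarrow> f (r (bv i)) = bv i"
    and "idx Z = {}"
  shows "short_exact A B Z"
  by (rule split_exact_short_exact[of A B Z f "\<lambda>v. 0" r "\<lambda>v. 0"])
    (unfold split_exact_def, use assms zero_hom in auto)

lemma short_exact_empty: "idx Z = {} \<Longrightarrow> short_exact Z Z Z"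
  by (rule split_exact_empty[of "\<lambda>v. v" "\<lambda>v. v" Z Z Z]) (auto simp: is_hom_id)

lemma mod_isoI:
  assumes "vlin f" "vlin r" "is_hom A B f" "\<And>i. i \<in> idx B \<Longrightarrow> r (bv i) \<in> mspace A"
    and "\<And>i. i \<in> idx A \<Longrightarrow> r (f (bv i)) = bv i" "\<And>i. i \<in> idx B \<Longrightarrow> f (r (bv i)) = bv i"
  shows "mod_iso A B"
  unfolding mod_iso_def by (rule split_exact_empty[of f r]) (use assms in auto)

lemma mod_iso_rescale:
  assumes bij: "bij_betw \<phi> (idx A) (idx B)" and c: "\<And>i. i \<in> idx A \<Longrightarrow> c i \<noteq> 0"
    and podd: "\<And>i. i \<in> idx A \<Longrightarrow> podd B (\<phi> i) = podd A i"
    and wt: "\<And>i j. i \<in> idx A \<Longrightarrow> wt B j (\<phi> i) = wt A j i"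
    and act: "\<And>i j. i \<in> idx A \<Longrightarrow>
      lin_ext (\<lambda>i. Poly_Mapping.single (\<phi> i) (c i)) (act A j i) = cscale (c i) (act B j (\<phi> i))"
  shows "mod_iso A B"
proof (rule mod_isoI)
  define \<psi> where "\<psi> = inv_into (idx A) \<phi>"
  have \<psi>: "\<psi> (\<phi> i) = i" if "i \<in> idx A" for i
    using that bij by (simp add: \<psi>_def bij_betw_def)
  have \<phi>: "\<phi> (\<psi> n) = n" "\<psi> n \<in> idx A" if "n \<in> idx B" for n
    using that bij by (auto simp: \<psi>_def bij_betw_def f_inv_into_f inv_into_into)
  have \<phi>B: "\<phi> i \<in> idx B" if "i \<in> idx A" for i
    using that bij by (auto simp: bij_betw_def)
  let ?r = "lin_ext (\<lambda>n. Poly_Mapping.single (\<psi> n) (inverse (c (\<psi> n))))"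
  show "vlin (lin_ext (\<lambda>i. Poly_Mapping.single (\<phi> i) (c i)))" "vlin ?r" by auto
  show "is_hom A B (lin_ext (\<lambda>i. Poly_Mapping.single (\<phi> i) (c i)))"
    by (rule is_homI)
      (use \<phi>B in \<open>auto simp: hspace_vspan podd act Eop_single Kop_def lin_ext_single wt mult.commute intro!: vspan_single\<close>)
  show "?r (bv n) \<in> mspace A" if "n \<in> idx B" for n
    using \<phi>[OF that] by (simp add: mspace_vspan vspan_single)
  show "?r (lin_ext (\<lambda>i. Poly_Mapping.single (\<phi> i) (c i)) (bv i)) = bv i" if "i \<in> idx A" for i
    using that c by (simp add: lin_ext_single \<psi>)
  show "lin_ext (\<lambda>i. Poly_Mapping.single (\<phi> i) (c i)) (?r (bv n)) = bv n" if "n \<in> idx B" for n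
    using c[OF \<phi>(2)[OF that]] \<phi>[OF that] by (simp add: lin_ext_single)
qed

lemma mod_iso_relabel:
  assumes "bij_betw \<phi> (idx A) (idx B)"
    and "\<And>i. i \<in> idx A \<Longrightarrow> podd B (\<phi> i) = podd A i"
    and "\<And>i j. i \<in> idx A \<Longrightarrow> wt B j (\<phi> i) = wt A j i"
    and "\<And>i j. i \<in> idx A \<Longrightarrow> lin_ext (\<lambda>i. bv (\<phi> i)) (act A j i) = act B j (\<phi> i)"
  shows "mod_iso A B"
  by (rule mod_iso_rescale[of \<phi> A B "\<lambda>_. 1"]) (use assms in auto)

lemma lookup_relabel:
  assumes "\<And>i. \<psi> (\<phi> i) = i" "\<And>n. \<phi> (\<psi> n) = n"
  shows "Poly_Mapping.lookup (lin_ext (\<lambda>i. bv (\<phi> i)) v) n = Poly_Mapping.lookup v (\<psi> n)"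
proof -
  have "\<phi> i = n \<longleftrightarrow> i = \<psi> n" for i n using assms by metis
  then show ?thesis
    by (simp add: lin_ext_def lookup_vec_sum lookup_single when_def in_keys_iff if_distrib cong: if_cong)
qed

definition assoc_ix :: "nat \<Rightarrow> nat"
  where "assoc_ix n = (case prod_decode n of (p, l) \<Rightarrow> case prod_decode p of (i, k) \<Rightarrow>
    prod_encode (i, prod_encode (k, l)))"

text \<open>This moves the index of a summand past a tensor factor on its left. It is not a braiding
  and involves no sign, since the index has no parity.\<close>

definition swap_ix :: "nat \<Rightarrow> nat"
  where "swap_ix n = (case prod_decode n of (i, p) \<Rightarrow> case prod_decode p of (k, l) \<Rightarrow>
    prod_encode (k, prod_encode (i, l)))"

lemma assoc_ix [simp]:
  "assoc_ix (prod_encode (prod_encode (i, k), l)) = prod_encode (i, prod_encode (k, l))"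
  and swap_ix [simp]: "swap_ix (prod_encode (i, prod_encode (k, l))) = prod_encode (k, prod_encode (i, l))"
  by (simp_all add: assoc_ix_def swap_ix_def)

lemma swap_swap: "swap_ix (swap_ix n) = n"
  by (metis bv_cases swap_ix)

lemma lin_ext_assoc:
  "lin_ext (\<lambda>i. bv (assoc_ix i)) (tens_vec (tens_vec u v) w) = tens_vec u (tens_vec v w)"
proof (rule poly_mapping_eqI)
  fix n
  define \<psi> where "\<psi> = (\<lambda>n. case prod_decode n of (i, p) \<Rightarrow> case prod_decode p of (k, l) \<Rightarrow>
    prod_encode (prod_encode (i, k), l))"
  have \<psi>: "\<psi> (prod_encode (i, prod_encode (k, l))) = prod_encode (prod_encode (i, k), l)" for i k l
    by (simp add: \<psi>_def)
  have inv: "\<psi> (assoc_ix i) = i" "assoc_ix (\<psi> n) = n" for i n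
    by (metis \<psi> assoc_ix bv_cases)+
  obtain i k l where n: "n = prod_encode (i, prod_encode (k, l))" by (metis bv_cases)
  show "Poly_Mapping.lookup (lin_ext (\<lambda>i. bv (assoc_ix i)) (tens_vec (tens_vec u v) w)) n =
    Poly_Mapping.lookup (tens_vec u (tens_vec v w)) n"
    by (simp add: lookup_relabel[of \<psi> assoc_ix, OF inv] n \<psi> lookup_tens_vec)
qed

lemma lin_ext_swap:
  "lin_ext (\<lambda>i. bv (swap_ix i)) (tens_vec u (tens_vec v w)) = tens_vec v (tens_vec u w)"
proof (rule poly_mapping_eqI)
  fix n
  obtain i k l where n: "n = prod_encode (i, prod_encode (k, l))" by (metis bv_cases)
  show "Poly_Mapping.lookup (lin_ext (\<lambda>i. bv (swap_ix i)) (tens_vec u (tens_vec v w))) n =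
    Poly_Mapping.lookup (tens_vec v (tens_vec u w)) n"
    by (simp add: lookup_relabel[of swap_ix swap_ix, OF swap_swap swap_swap] n lookup_tens_vec)
qed

lemma tens_vec_bv_single: "tens_vec (bv m) (Poly_Mapping.single i x) = Poly_Mapping.single (prod_encode (m, i)) x"
  by (simp add: tens_vec_single)

lemma tensor_assoc_iso: "mod_iso (tensor (tensor A B) C) (tensor A (tensor B C))"
proof (rule mod_iso_relabel[of assoc_ix])
  show "bij_betw assoc_ix (idx (tensor (tensor A B) C)) (idx (tensor A (tensor B C)))"
    by (auto simp: bij_betw_def inj_on_def image_iff)
  fix n j assume "n \<in> idx (tensor (tensor A B) C)"
  then obtain i k l where n: "n = prod_encode (prod_encode (i, k), l)" by auto
  show "podd (tensor A (tensor B C)) (assoc_ix n) = podd (tensor (tensor A B) C) n"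
    by (auto simp: n)
  show "wt (tensor A (tensor B C)) j (assoc_ix n) = wt (tensor (tensor A B) C) j n"
    by (simp add: n)
  have "Poly_Mapping.single (prod_encode (k, l)) (wt B j k * wt C j l) =
    tens_vec (Poly_Mapping.single k (wt B j k)) (Poly_Mapping.single l (wt C j l))"
    by (simp add: tens_vec_single)
  then show "lin_ext (\<lambda>i. bv (assoc_ix i)) (act (tensor (tensor A B) C) j n) = act (tensor A (tensor B C)) j (assoc_ix n)"
    by (simp add: n tens_vec_add_left tens_vec_add_right tens_vec_cscale_left tens_vec_cscale_right
        vlin_simps lin_ext_assoc bv_tensor cscale_add add.assoc del: cscale_single)
qed

lemma dsum_tensor_iso: "mod_iso (tensor (dsum A) D) (dsum (\<lambda>m. tensor (A m) D))"
proof (rule mod_iso_relabel[of assoc_ix])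
  show "bij_betw assoc_ix (idx (tensor (dsum A) D)) (idx (dsum (\<lambda>m. tensor (A m) D)))"
    by (auto simp: bij_betw_def inj_on_def image_iff)
  fix n j assume "n \<in> idx (tensor (dsum A) D)"
  then obtain m i k where n: "n = prod_encode (prod_encode (m, i), k)" by auto
  show "podd (dsum (\<lambda>m. tensor (A m) D)) (assoc_ix n) = podd (tensor (dsum A) D) n"
    by (simp add: n)
  show "wt (dsum (\<lambda>m. tensor (A m) D)) j (assoc_ix n) = wt (tensor (dsum A) D) j n"
    by (simp add: n)
  show "lin_ext (\<lambda>i. bv (assoc_ix i)) (act (tensor (dsum A) D) j n) = act (dsum (\<lambda>m. tensor (A m) D)) j (assoc_ix n)"
    by (simp add: n tens_vec_add_right tens_vec_cscale_right vlin_simps lin_ext_assoc bv_tensor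
        del: cscale_single)
qed

lemma tensor_dsum_iso: "mod_iso (tensor D (dsum A)) (dsum (\<lambda>m. tensor D (A m)))"
proof (rule mod_iso_relabel[of swap_ix])
  show "bij_betw swap_ix (idx (tensor D (dsum A))) (idx (dsum (\<lambda>m. tensor D (A m))))"
    by (auto simp: bij_betw_def inj_on_def image_iff)
  fix n j assume "n \<in> idx (tensor D (dsum A))"
  then obtain d m i where n: "n = prod_encode (d, prod_encode (m, i))" by auto
  show "podd (dsum (\<lambda>m. tensor D (A m))) (swap_ix n) = podd (tensor D (dsum A)) n"
    by (simp add: n)
  show "wt (dsum (\<lambda>m. tensor D (A m))) j (swap_ix n) = wt (tensor D (dsum A)) j n"
    by (simp add: n)
  show "lin_ext (\<lambda>i. bv (swap_ix i)) (act (tensor D (dsum A)) j n) = act (dsum (\<lambda>m. tensor D (A m))) j (swap_ix n)"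
    by (simp add: n tens_vec_add_right tens_vec_cscale_right vlin_simps lin_ext_swap
        tens_vec_bv_single[symmetric, of m i] del: cscale_single)
qed

lemma onedim_simps [simp]:
  "idx (onedim p a c) = {0}" "podd (onedim p a c) i = p" "act (onedim p a c) j i = 0"
  "wt (onedim p a c) N0 i = a" "wt (onedim p a c) N1 i = c"
  by (simp_all add: onedim_def)

lemma wt_unit [simp]: "wt (onedim p 1 1) j i = 1"
  by (cases j) simp_all

lemma unit_tensor_iso: "mod_iso (tensor (onedim False 1 1) M) M"
proof (rule mod_iso_relabel[of "\<lambda>n. snd (prod_decode n)"])
  show "bij_betw (\<lambda>n. snd (prod_decode n)) (idx (tensor (onedim False 1 1) M)) (idx M)"
    by (auto simp: bij_betw_def inj_on_def image_iff)
  fix n j assume "n \<in> idx (tensor (onedim False 1 1) M)"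
  then obtain k where n: "n = prod_encode (0, k)" by auto
  have "lin_ext (\<lambda>i. bv (snd (prod_decode i))) (tens_vec (bv 0) v) = v" for v
    by (rule vlin_eq_all[of "\<lambda>v. lin_ext (\<lambda>i. bv (snd (prod_decode i))) (tens_vec (bv 0) v)" "\<lambda>v. v"])
      (auto simp: tens_vec_single intro: vlin_comp[OF vlin_lin_ext vlin_tens])
  then show "lin_ext (\<lambda>n. bv (snd (prod_decode n))) (act (tensor (onedim False 1 1) M) j n) = act M j (snd (prod_decode n))"
    by (simp add: n)
qed auto

lemma tensor_unit_iso: "mod_iso (tensor M (onedim False 1 1)) M"
proof (rule mod_iso_relabel[of "\<lambda>n. fst (prod_decode n)"])
  show "bij_betw (\<lambda>n. fst (prod_decode n)) (idx (tensor M (onedim False 1 1))) (idx M)"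
    by (auto simp: bij_betw_def inj_on_def image_iff)
  fix n j assume "n \<in> idx (tensor M (onedim False 1 1))"
  then obtain k where n: "n = prod_encode (k, 0)" by auto
  have "lin_ext (\<lambda>i. bv (fst (prod_decode i))) (tens_vec v (bv 0)) = v" for v
    by (rule vlin_eq_all[of "\<lambda>v. lin_ext (\<lambda>i. bv (fst (prod_decode i))) (tens_vec v (bv 0))" "\<lambda>v. v"])
      (auto simp: tens_vec_single intro: vlin_comp[OF vlin_lin_ext vlin_tens_left[OF vlin_id]])
  then show "lin_ext (\<lambda>n. bv (fst (prod_decode n))) (act (tensor M (onedim False 1 1)) j n) = act M j (fst (prod_decode n))"
    by (simp add: n)
qed auto


section \<open>The Grothendieck ring\<close>

lemma frag_extend_fun_diff:
  fixes f g :: "'b \<Rightarrow> 'a \<Rightarrow>\<^sub>0 int"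
  shows "frag_extend (\<lambda>M. f M - g M) x = frag_extend f x - frag_extend g x"
proof -
  have *: "frag_cmul c (a - b) = frag_cmul c a - frag_cmul c b" for c and a b :: "'a \<Rightarrow>\<^sub>0 int"
    by (rule poly_mapping_eqI) (simp add: lookup_minus algebra_simps)
  show ?thesis by (simp add: frag_extend_def sum_subtractf *)
qed

definition fmul :: "(sbmod \<Rightarrow>\<^sub>0 int) \<Rightarrow> (sbmod \<Rightarrow>\<^sub>0 int) \<Rightarrow> sbmod \<Rightarrow>\<^sub>0 int"
  where "fmul x y = frag_extend (\<lambda>M. frag_extend (\<lambda>N. frag_of (tensor M N)) y) x"

lemma fmul_diff_left: "fmul (x - x') y = fmul x y - fmul x' y"
  and fmul_diff_right: "fmul x (y - y') = fmul x y - fmul x y'"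
  and fmul_zero_left [simp]: "fmul 0 y = 0"
  by (simp_all add: fmul_def frag_extend_diff frag_extend_fun_diff)

lemma fmul_zero_right [simp]: "fmul x 0 = 0"
  using fmul_diff_right[of x 0 0] by simp

lemma fmul_minus_left: "fmul (- x) y = - fmul x y"
  and fmul_minus_right: "fmul x (- y) = - fmul x y"
  using fmul_diff_left[of 0 x y] fmul_diff_right[of x 0 y] by simp_all

lemma fmul_add_left: "fmul (x + x') y = fmul x y + fmul x' y"
  and fmul_add_right: "fmul x (y + y') = fmul x y + fmul x y'"
  using fmul_diff_left[of x "- x'" y] fmul_diff_right[of x y "- y'"]
  by (simp_all add: fmul_minus_left fmul_minus_right)

lemma fmul_of [simp]: "fmul (frag_of M) (frag_of N) = frag_of (tensor M N)"
  by (simp add: fmul_def)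

lemma free_obj_simps [simp]:
  "carrier (free_obj q) = {x. Poly_Mapping.keys x \<subseteq> catO q}"
  "x \<oplus>\<^bsub>free_obj q\<^esub> y = x + y" "\<zero>\<^bsub>free_obj q\<^esub> = 0" "x \<otimes>\<^bsub>free_obj q\<^esub> y = fmul x y"
  "\<one>\<^bsub>free_obj q\<^esub> = frag_of (onedim False 1 1)"
  by (simp_all add: free_obj_def fmul_def)

definition fcar :: "complex \<Rightarrow> (sbmod \<Rightarrow>\<^sub>0 int) set"
  where "fcar q = {x. Poly_Mapping.keys x \<subseteq> catO q}"

lemma fcar_zero [simp]: "0 \<in> fcar q"
  and fcar_add: "x \<in> fcar q \<Longrightarrow> y \<in> fcar q \<Longrightarrow> x + y \<in> fcar q"
  and fcar_diff: "x \<in> fcar q \<Longrightarrow> y \<in> fcar q \<Longrightarrow> x - y \<in> fcar q"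
  and fcar_minus: "x \<in> fcar q \<Longrightarrow> - x \<in> fcar q"
  and fcar_of: "M \<in> catO q \<Longrightarrow> frag_of M \<in> fcar q"
  using Poly_Mapping.keys_add[of x y] Poly_Mapping.keys_diff[of x y] by (auto simp: fcar_def)

lemma fcar_induct [consumes 1, case_names zero one diff]:
  assumes "x \<in> fcar q" "P 0" "\<And>M. M \<in> catO q \<Longrightarrow> P (frag_of M)" "\<And>a b. P a \<Longrightarrow> P b \<Longrightarrow> P (a - b)"
  shows "P x"
  using assms(1) unfolding fcar_def by (intro frag_induction[of x "catO q" P]) (use assms in auto)

lemma abelian_group_free_obj: "abelian_group (free_obj q)"
proof (rule abelian_groupI)
  fix x assume "x \<in> carrier (free_obj q)"
  then show "\<exists>y\<in>carrier (free_obj q). y \<oplus>\<^bsub>free_obj q\<^esub> x = \<zero>\<^bsub>free_obj q\<^esub>"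
    by (intro bexI[of _ "- x"]) auto
qed (use fcar_add[unfolded fcar_def] in \<open>auto simp: add_ac\<close>)

lemma inv_free_obj: "x \<in> fcar q \<Longrightarrow> inv\<^bsub>add_monoid (free_obj q)\<^esub> x = - x"
  using abelian_group.minus_equality[OF abelian_group_free_obj[of q], of "- x" x]
  by (auto simp: a_inv_def fcar_def)

context generic_param
begin

lemma onedim_catO:
  assumes "a \<noteq> 0" "c \<noteq> 0"
  shows "onedim p a c \<in> catO q"
proof (rule catO_by_depth[where d = "\<lambda>_. 0"])
  have E: "Eop (onedim p a c) j v = 0" for j v
    by (simp add: Eop_def lin_ext_def)
  show "is_rep q (onedim p a c)"
  proof (rule is_repI)
    show "wt (onedim p a c) j i \<noteq> 0" for i j using assms by (cases j) auto
  qed (simp_all add: serre_def E hspace_vspan vlin_zero del: Eop_bv)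
qed simp_all

lemma catO_empty: "idx M = {} \<Longrightarrow> M \<in> catO q"
  by (rule catO_by_depth[where d = "\<lambda>_. 0"]) (auto intro: is_repI)

abbreviation "gens \<equiv> {frag_of B - frag_of A - frag_of C | A B C.
  A \<in> catO q \<and> B \<in> catO q \<and> C \<in> catO q \<and> short_exact A B C}"

lemma exact_rel_subgroup: "subgroup (exact_rel q) (add_monoid (free_obj q))"
  unfolding exact_rel_def
proof (rule group.generate_is_subgroup)
  show "group (add_monoid (free_obj q))"
    using abelian_group.a_group[OF abelian_group_free_obj] .
  show "gens \<subseteq> carrier (add_monoid (free_obj q))"
    using fcar_diff fcar_of unfolding fcar_def by fastforce
qed

lemma abelian_subgroup_exact_rel: "abelian_subgroup (exact_rel q) (free_obj q)"
  by (intro abelian_subgroupI3 additive_subgroupI exact_rel_subgroup abelian_group_free_obj)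

lemma exact_rel_fcar: "x \<in> exact_rel q \<Longrightarrow> x \<in> fcar q"
  using subgroup.subset[OF exact_rel_subgroup] by (auto simp: fcar_def)

lemma exact_rel_zero [simp]: "0 \<in> exact_rel q"
  using subgroup.one_closed[OF exact_rel_subgroup] by simp

lemma exact_rel_add: "x \<in> exact_rel q \<Longrightarrow> y \<in> exact_rel q \<Longrightarrow> x + y \<in> exact_rel q"
  using subgroup.m_closed[OF exact_rel_subgroup] by simp

lemma exact_rel_minus: "x \<in> exact_rel q \<Longrightarrow> - x \<in> exact_rel q"
  using subgroup.m_inv_closed[OF exact_rel_subgroup, of x] by (simp only: inv_free_obj exact_rel_fcar)

lemma exact_rel_diff: "x \<in> exact_rel q \<Longrightarrow> y \<in> exact_rel q \<Longrightarrow> x - y \<in> exact_rel q"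
  using exact_rel_add[OF _ exact_rel_minus] by (metis diff_conv_add_uminus)

lemma exact_rel_incl:
  "A \<in> catO q \<Longrightarrow> B \<in> catO q \<Longrightarrow> C \<in> catO q \<Longrightarrow> short_exact A B C \<Longrightarrow>
    frag_of B - frag_of A - frag_of C \<in> exact_rel q"
  unfolding exact_rel_def by (rule generate.incl) auto

lemma exact_rel_induct [consumes 1, case_names zero gen minus add]:
  assumes "x \<in> exact_rel q" "P 0"
    and "\<And>A B C. A \<in> catO q \<Longrightarrow> B \<in> catO q \<Longrightarrow> C \<in> catO q \<Longrightarrow> short_exact A B C \<Longrightarrow>
      P (frag_of B - frag_of A - frag_of C)"
    and "\<And>a. P a \<Longrightarrow> P (- a)" "\<And>a b. P a \<Longrightarrow> P b \<Longrightarrow> P (a + b)"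
  shows "P x"
  using assms(1) unfolding exact_rel_def
proof (induction rule: generate.induct)
  case one
  then show ?case using assms(2) by simp
next
  case (incl h)
  then show ?case using assms(3) by auto
next
  case (inv h)
  then have "h \<in> fcar q" using exact_rel_fcar unfolding exact_rel_def by (blast intro: generate.incl)
  moreover have "P h" using inv assms(3) by auto
  ultimately show ?case using assms(4) by (simp only: inv_free_obj)
next
  case (eng a b)
  then show ?case using assms(5) by simp
qed

lemma fcar_fmul:
  assumes "x \<in> fcar q" "y \<in> fcar q" shows "fmul x y \<in> fcar q"
  using assms(1)
proof (induction rule: fcar_induct)
  case (one M)
  show ?case using assms(2)
    by (induction rule: fcar_induct) (auto simp: fmul_diff_right fcar_diff fcar_of one tensor_catO)
qed (auto simp: fmul_diff_left fcar_diff)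

text \<open>Tensoring with a fixed module on either side is exact, so the subgroup of relations
  absorbs products from both sides like a two-sided ideal.\<close>

lemma exact_rel_fmul:
  assumes "x \<in> exact_rel q" "y \<in> fcar q"
  shows "fmul x y \<in> exact_rel q" "fmul y x \<in> exact_rel q"
proof -
  have "fmul x y \<in> exact_rel q \<and> fmul y x \<in> exact_rel q"
    using assms(1)
  proof (induction rule: exact_rel_induct)
    case (gen A B C)
    note rep = catO_rep[OF gen(1)] catO_rep[OF gen(2)]
    from assms(2) show ?case
    proof (induction rule: fcar_induct)
      case (one D)
      then show ?case
        by (auto simp: fmul_diff_left fmul_diff_right gen tensor_catO
            intro!: exact_rel_incl short_exact_tensor[OF rep])
    qed (auto simp: fmul_diff_left[of _ _ "_ - _ - _"] fmul_diff_right[of "_ - _ - _"] exact_rel_diff)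
  qed (auto simp: fmul_minus_left fmul_minus_right fmul_add_left fmul_add_right exact_rel_minus exact_rel_add)
  then show "fmul x y \<in> exact_rel q" "fmul y x \<in> exact_rel q" by auto
qed

definition gcls :: "(sbmod \<Rightarrow>\<^sub>0 int) \<Rightarrow> (sbmod \<Rightarrow>\<^sub>0 int) set"
  where "gcls x = exact_rel q +>\<^bsub>free_obj q\<^esub> x"

lemma gclass_gcls: "gclass q M = gcls (frag_of M)"
  by (simp add: gclass_def gcls_def)

lemma gcls_iff: "z \<in> gcls x \<longleftrightarrow> (\<exists>h\<in>exact_rel q. z = h + x)"
  by (auto simp: gcls_def a_r_coset_def')

lemma gcls_eqI:
  assumes "x - y \<in> exact_rel q" shows "gcls x = gcls y"
proof -
  have "\<exists>h'\<in>exact_rel q. h + a = h' + b" if "a - b \<in> exact_rel q" "h \<in> exact_rel q" for a b h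
    using that by (intro bexI[of _ "h + (a - b)"]) (auto intro: exact_rel_add)
  moreover have "y - x \<in> exact_rel q" using exact_rel_minus[OF assms] by simp
  ultimately show ?thesis using assms unfolding set_eq_iff gcls_iff by metis
qed

lemma groth_carrier: "carrier (groth q) = gcls ` fcar q"
  by (auto simp: groth_def FactRing_def A_RCOSETS_def' gcls_def fcar_def)

lemma groth_zero: "\<zero>\<^bsub>groth q\<^esub> = gcls 0"
  by (auto simp: groth_def FactRing_def set_eq_iff gcls_iff)

lemma groth_one: "\<one>\<^bsub>groth q\<^esub> = gcls (frag_of (onedim False 1 1))"
  by (simp add: groth_def FactRing_def gcls_def)

lemma groth_add:
  assumes "x \<in> fcar q" "y \<in> fcar q"
  shows "gcls x \<oplus>\<^bsub>groth q\<^esub> gcls y = gcls (x + y)"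
  using abelian_subgroup.a_rcos_sum[OF abelian_subgroup_exact_rel, of x y] assms
  by (simp add: groth_def FactRing_def gcls_def fcar_def)

text \<open>The product of cosets is a union over all representatives. For a = h + x and b = k + y
  the difference of products is h b + x k, a relation by \<open>exact_rel_fmul\<close>, so the union
  collapses to one coset.\<close>

lemma groth_mult:
  assumes "x \<in> fcar q" "y \<in> fcar q"
  shows "gcls x \<otimes>\<^bsub>groth q\<^esub> gcls y = gcls (fmul x y)"
proof -
  have "gcls (fmul a b) = gcls (fmul x y)" if ab: "a \<in> gcls x" "b \<in> gcls y" for a b
  proof -
    obtain h k where a: "h \<in> exact_rel q" "a = h + x" and b: "k \<in> exact_rel q" "b = k + y"
      using ab by (auto simp: gcls_iff)
    have "fmul a b - fmul x y = fmul h b + fmul x k"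
      by (simp add: a b fmul_add_left fmul_add_right)
    also have "\<dots> \<in> exact_rel q"
      using a(1) b assms fcar_add[OF exact_rel_fcar[OF b(1)] assms(2)]
      by (intro exact_rel_add exact_rel_fmul) simp_all
    finally show ?thesis by (rule gcls_eqI)
  qed
  moreover have "x \<in> gcls x" "y \<in> gcls y" by (auto simp: gcls_iff intro!: bexI[of _ 0])
  ultimately have "(\<Union>a\<in>gcls x. \<Union>b\<in>gcls y. gcls (fmul a b)) = gcls (fmul x y)" by blast
  then show ?thesis
    by (simp add: groth_def FactRing_def rcoset_mult_def flip: gcls_def)
qed

text \<open>The sequence 0, 0, 0 makes the zero module itself a relation; subtracting it from the
  sequence encoding the isomorphism leaves the difference of the two modules.\<close>

lemma mod_iso_rel:
  assumes "A \<in> catO q" "B \<in> catO q" "mod_iso A B"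
  shows "frag_of A - frag_of B \<in> exact_rel q"
proof -
  have Z: "zero_mod \<in> catO q" by (simp add: catO_empty)
  have "frag_of zero_mod - frag_of zero_mod - frag_of zero_mod \<in> exact_rel q"
    by (intro exact_rel_incl Z short_exact_empty) simp
  then have "- frag_of zero_mod \<in> exact_rel q" by simp
  moreover have "frag_of B - frag_of A - frag_of zero_mod \<in> exact_rel q"
    using assms Z unfolding mod_iso_def by (intro exact_rel_incl)
  ultimately have "- frag_of zero_mod - (frag_of B - frag_of A - frag_of zero_mod) \<in> exact_rel q"
    by (rule exact_rel_diff)
  then show ?thesis by simp
qed

lemma fmul_assoc_rel:
  assumes "x \<in> fcar q" "y \<in> fcar q" "z \<in> fcar q"
  shows "fmul (fmul x y) z - fmul x (fmul y z) \<in> exact_rel q"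
  using assms(1)
proof (induction rule: fcar_induct)
  case (one A)
  note A = one
  show ?case using assms(2)
  proof (induction rule: fcar_induct)
    case (one B)
    note B = one
    show ?case using assms(3)
    proof (induction rule: fcar_induct)
      case (one C)
      then show ?case using A B by (auto intro!: mod_iso_rel tensor_assoc_iso tensor_catO)
    next
      case (diff a b)
      then show ?case using exact_rel_diff by (fastforce simp: fmul_diff_right algebra_simps)
    qed simp
  next
    case (diff a b)
    then show ?case using exact_rel_diff by (fastforce simp: fmul_diff_right fmul_diff_left algebra_simps)
  qed simp
next
  case (diff a b)
  then show ?case using exact_rel_diff by (fastforce simp: fmul_diff_left algebra_simps)
qed simp

lemma fmul_unit_rel:
  assumes "x \<in> fcar q"
  shows "fmul (frag_of (onedim False 1 1)) x - x \<in> exact_rel q"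
    and "fmul x (frag_of (onedim False 1 1)) - x \<in> exact_rel q"
proof -
  have U: "onedim False 1 1 \<in> catO q" by (simp add: onedim_catO)
  show "fmul (frag_of (onedim False 1 1)) x - x \<in> exact_rel q"
    using assms
  proof (induction rule: fcar_induct)
    case (one M)
    then show ?case using U by (auto intro!: mod_iso_rel unit_tensor_iso tensor_catO)
  next
    case (diff a b)
    then show ?case using exact_rel_diff by (fastforce simp: fmul_diff_right algebra_simps)
  qed simp
  show "fmul x (frag_of (onedim False 1 1)) - x \<in> exact_rel q"
    using assms
  proof (induction rule: fcar_induct)
    case (one M)
    then show ?case using U by (auto intro!: mod_iso_rel tensor_unit_iso tensor_catO)
  next
    case (diff a b)
    then show ?case using exact_rel_diff by (fastforce simp: fmul_diff_left algebra_simps)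
  qed simp
qed

text \<open>\<open>free_obj q\<close> is associative and unital only up to isomorphism, so the ring
  laws are established in the quotient, where \<open>mod_iso_rel\<close> turns isomorphisms into
  equalities.\<close>

lemma ring_groth: "ring (groth q)"
proof (rule ringI)
  have U: "frag_of (onedim False 1 1) \<in> fcar q" by (simp add: fcar_of onedim_catO)
  note s = groth_carrier groth_zero groth_one groth_add groth_mult fcar_add fcar_fmul U
  show "abelian_group (groth q)"
  proof (rule abelian_groupI)
    fix x assume "x \<in> carrier (groth q)"
    then obtain a where a: "a \<in> fcar q" "x = gcls a" by (auto simp: s)
    show "\<exists>y\<in>carrier (groth q). y \<oplus>\<^bsub>groth q\<^esub> x = \<zero>\<^bsub>groth q\<^esub>"
      using a fcar_minus[OF a(1)] by (intro bexI[of _ "gcls (- a)"]) (auto simp: s)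
  qed (auto simp: s add_ac)
  show "monoid (groth q)"
    by (rule monoidI)
      (auto simp: s gcls_eqI[OF fmul_assoc_rel] gcls_eqI[OF fmul_unit_rel(1)] gcls_eqI[OF fmul_unit_rel(2)])
qed (use fcar_add fcar_fmul in \<open>auto simp: groth_carrier groth_add groth_mult fmul_add_left fmul_add_right\<close>)

subsection \<open>Classes of modules\<close>

lemma gclass_closed: "M \<in> catO q \<Longrightarrow> gclass q M \<in> carrier (groth q)"
  by (auto simp: gclass_gcls groth_carrier fcar_of)

lemma gclass_tensor:
  "A \<in> catO q \<Longrightarrow> B \<in> catO q \<Longrightarrow> gclass q A \<otimes>\<^bsub>groth q\<^esub> gclass q B = gclass q (tensor A B)"
  by (simp add: gclass_gcls groth_mult fcar_of)

lemma gclass_iso: "A \<in> catO q \<Longrightarrow> B \<in> catO q \<Longrightarrow> mod_iso A B \<Longrightarrow> gclass q A = gclass q B"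
  unfolding gclass_gcls by (intro gcls_eqI mod_iso_rel)

lemma gclass_exact:
  assumes "A \<in> catO q" "B \<in> catO q" "C \<in> catO q" "short_exact A B C"
  shows "gclass q B = gclass q A \<oplus>\<^bsub>groth q\<^esub> gclass q C"
  using exact_rel_incl[OF assms] assms
  by (simp add: gclass_gcls groth_add fcar_of) (rule gcls_eqI, simp add: algebra_simps)

lemma gclass_empty:
  assumes "idx Z = {}" shows "gclass q Z = \<zero>\<^bsub>groth q\<^esub>"
proof -
  have Z: "Z \<in> catO q" using assms by (rule catO_empty)
  have "frag_of Z - frag_of Z - frag_of Z \<in> exact_rel q"
    by (intro exact_rel_incl Z short_exact_empty assms)
  from exact_rel_minus[OF this] show ?thesis
    unfolding gclass_gcls groth_zero by (intro gcls_eqI) simp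
qed

lemma gclass_one: "gclass q (onedim False 1 1) = \<one>\<^bsub>groth q\<^esub>"
  by (simp add: gclass_gcls groth_one)

text \<open>The isomorphisms are summed as exact sequences; the resulting quotient is a direct sum
  of zero modules, which has an empty index set and class zero.\<close>

lemma gclass_dsum_iso:
  assumes "\<And>m. A m \<in> catO q" "\<And>m. B m \<in> catO q" "\<And>m. mod_iso (A m) (B m)"
    and "dsum A \<in> catO q" "dsum B \<in> catO q"
  shows "gclass q (dsum A) = gclass q (dsum B)"
proof -
  interpret ring "groth q" by (rule ring_groth)
  have Z: "idx (dsum (\<lambda>m. zero_mod)) = {}" by simp
  have "gclass q (dsum B) = gclass q (dsum A) \<oplus>\<^bsub>groth q\<^esub> gclass q (dsum (\<lambda>m. zero_mod))"
    using assms catO_rep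
    by (intro gclass_exact catO_empty[OF Z] short_exact_dsum[of q]) (auto simp: mod_iso_def)
  then show ?thesis using assms(4) by (simp add: gclass_empty[OF Z] gclass_closed)
qed

text \<open>
  The class of an infinitely filtered module: the short exact sequences
  \<open>0 \<rightarrow> gr m \<rightarrow> Q m \<rightarrow> Q (m + 1) \<rightarrow> 0\<close> are summed over all \<open>m\<close>, and
  the classes of the \<open>Q (m + 1)\<close> cancel against all of the \<open>Q m\<close> but the first one. The
  hypothesis that \<open>\<Oplus> Q m\<close> is in category O is the convergence of the filtration.
\<close>

lemma gclass_filtration:
  assumes "\<And>m. gr m \<in> catO q" "\<And>m. Q m \<in> catO q"
    and "dsum gr \<in> catO q" "dsum Q \<in> catO q" "dsum (\<lambda>m. Q (Suc m)) \<in> catO q"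
    and "\<And>m. short_exact (gr m) (Q m) (Q (Suc m))"
  shows "gclass q (Q 0) = gclass q (dsum gr)"
proof -
  interpret ring "groth q" by (rule ring_groth)
  have "gclass q (dsum Q) = gclass q (dsum gr) \<oplus>\<^bsub>groth q\<^esub> gclass q (dsum (\<lambda>m. Q (Suc m)))"
    using assms catO_rep by (intro gclass_exact short_exact_dsum[of q]) auto
  moreover have "gclass q (dsum Q) = gclass q (Q 0) \<oplus>\<^bsub>groth q\<^esub> gclass q (dsum (\<lambda>m. Q (Suc m)))"
    using assms catO_rep by (intro gclass_exact short_exact_dsum_Suc[of q]) auto
  ultimately show ?thesis
    using assms by (metis gclass_closed add.right_cancel)
qed

end


section \<open>The prefundamental and evaluation modules\<close>

lemma osc_coeff_Suc: "osc_coeff q e (Suc n) = osc_coeff q e 1 - (q powi e)\<^sup>2 * osc_coeff q e n"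
  by (simp add: algebra_simps power2_eq_square)

section \<open>Ladder modules: one raising and one lowering generator\<close>

context generic_param
begin

text \<open>The recursion is affine with ratio t = -q^(2e). Since q^e (q + 1/q) = 1 - t, its
  constant term is -(1 - t) / (q + 1/q)^2, and summing the geometric progression gives the
  formula.\<close>

lemma osc_coeff_closed:
  assumes "e = 1 \<or> e = - 1"
  shows "osc_coeff q e n = - (1 - (- ((q powi e)\<^sup>2)) ^ n) / qq\<^sup>2"
proof (induction n)
  case (Suc n)
  let ?p = "q powi e" and ?t = "- ((q powi e)\<^sup>2)"
  have p: "?p * qq = 1 - ?t"
    using assms q_nz by (auto simp: power_int_minus field_simps power2_eq_square)
  have "osc_coeff q e (Suc n) * qq\<^sup>2 = - (?p * qq) + ?t * (osc_coeff q e n * qq\<^sup>2)"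
    using qq_nz by (simp add: field_simps power2_eq_square)
  also have "osc_coeff q e n * qq\<^sup>2 = - (1 - ?t ^ n)"
    unfolding Suc using qq_nz by simp
  also have "- (?p * qq) + ?t * - (1 - ?t ^ n) = - (1 - ?t ^ Suc n)"
    unfolding p by (simp add: algebra_simps)
  finally show ?case using qq_nz by (simp add: eq_divide_eq)
qed simp

text \<open>The Serre relations of a module where E_0 raises the index by one and E_1 lowers it with
  coefficient a k. The characteristic roots of the recursion are 1, -q^2 and -q^-2.\<close>

definition ladder_rec :: "(nat \<Rightarrow> complex) \<Rightarrow> bool"
  where "ladder_rec a \<longleftrightarrow> a 0 = 0 \<and>
    (\<forall>k. a k + three_q q * a (k + 1) - three_q q * a (k + 2) - a (k + 3) = 0)"

text \<open>By \<open>osc_coeff_closed\<close> the coefficients combine 1 and t^k with t = -q^(2e),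
  two of the characteristic exponentials. The proof uses this as c t = -(t^2 + t + 1) for c =
  \<open>three_q q\<close>.\<close>

lemma ladder_rec_osc:
  assumes "e = 1 \<or> e = - 1"
  shows "ladder_rec (osc_coeff q e)"
  unfolding ladder_rec_def
proof (intro conjI allI)
  fix k
  let ?c = "three_q q" and ?t = "- ((q powi e)\<^sup>2)"
  define y where "y = osc_coeff q e 1"
  let ?x = "osc_coeff q e k" and ?y = y
  have ct: "?c * ?t = - (?t\<^sup>2 + ?t + 1)"
    using assms q_nz unfolding three_q_eq
    by (auto simp: power_int_minus field_simps power2_eq_square)
  have S: "osc_coeff q e (Suc n) = ?y + ?t * osc_coeff q e n" for n
    using osc_coeff_Suc[of q e n] by (simp add: y_def del: osc_coeff.simps One_nat_def)
  have 1: "osc_coeff q e (k + 1) = ?y + ?t * ?x"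
    and 2: "osc_coeff q e (k + 2) = ?y + ?t * (?y + ?t * ?x)"
    and 3: "osc_coeff q e (k + 3) = ?y + ?t * (?y + ?t * (?y + ?t * ?x))"
    using S[of k] S[of "k + 1"] S[of "k + 2"]
    by (simp_all add: numeral_2_eq_2 numeral_3_eq_3 del: osc_coeff.simps)
  have "?x + ?c * (?y + ?t * ?x) - ?c * (?y + ?t * (?y + ?t * ?x)) - (?y + ?t * (?y + ?t * (?y + ?t * ?x)))
    = ?x * (1 + (?c * ?t) - (?c * ?t) * ?t - ?t ^ 3) - ?y * ((?c * ?t) + 1 + ?t + ?t\<^sup>2)"
    by (simp add: algebra_simps power2_eq_square power3_eq_cube)
  also have "\<dots> = 0" unfolding ct by (simp add: algebra_simps power2_eq_square power3_eq_cube)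
  finally show "osc_coeff q e k + ?c * osc_coeff q e (k + 1) - ?c * osc_coeff q e (k + 2) - osc_coeff q e (k + 3) = 0"
    unfolding 1 2 3 .
qed simp

lemma ladder_rec_lin:
  assumes "ladder_rec a" "ladder_rec b"
  shows "ladder_rec (\<lambda>k. x * a k + y * b k)"
  unfolding ladder_rec_def
proof (intro conjI allI)
  fix k
  let ?L = "\<lambda>a :: nat \<Rightarrow> complex. a k + three_q q * a (k + 1) - three_q q * a (k + 2) - a (k + 3)"
  have "?L (\<lambda>k. x * a k + y * b k) = x * ?L a + y * ?L b" by (simp add: algebra_simps)
  then show "?L (\<lambda>k. x * a k + y * b k) = 0" using assms unfolding ladder_rec_def by simp
qed (use assms in \<open>simp add: ladder_rec_def\<close>)

text \<open>Covers prefundamental and evaluation modules alike. On a basis vector each Serre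
  expression is a scalar multiple of one instance of the recursion, and the depth is the index
  itself.\<close>

lemma ladder_catO:
  assumes idx: "idx M = UNIV" and podd: "\<And>k. podd M (Suc k) = (\<not> podd M k)"
    and wt: "\<And>k. wt M N0 k = q powi (2 * int k) * u" "\<And>k. wt M N1 k = q powi (- 2 * int k) * v"
    and w: "u \<noteq> 0" "v \<noteq> 0"
    and act: "\<And>k. act M N0 k = Poly_Mapping.single (Suc k) l" "\<And>k. act M N1 k = Poly_Mapping.single (k - 1) (a k)"
    and rec: "ladder_rec a"
  shows "M \<in> catO q"
proof (rule catO_by_depth[where d = "\<lambda>k. k" and a = u and c = v])
  have a0: "a 0 = 0" and ak: "\<And>k. a k + three_q q * a (k + 1) - three_q q * a (k + 2) - a (k + 3) = 0"
    using rec by (auto simp: ladder_rec_def)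
  have Suc: "q powi (2 * int (Suc k)) = q\<^sup>2 * q powi (2 * int k)"
    "q powi (- 2 * int (Suc k)) = inverse q ^ 2 * q powi (- 2 * int k)" for k
    using q_nz by (simp_all add: distrib_left power_int_add power_int_diff power_int_minus power_inverse field_simps)
  have wtS: "wt M i (Suc k) = q powi cartan i N0 * wt M i k" for i k
    by (cases i) (simp_all only: wt Suc q_powi_cartan, simp_all)
  have wtP: "wt M i k = q powi cartan i N1 * wt M i (Suc k)" for i k
  proof -
    have "q powi cartan i N1 * q powi cartan i N0 = 1"
      using q_nz by (cases i) (simp_all add: power_int_minus)
    then show ?thesis unfolding wtS by (simp flip: mult.assoc)
  qed
  show "is_rep q M"
  proof (rule is_repI)
    show "wt M j i \<noteq> 0" for i j using w q_nz by (cases j) (auto simp: wt)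
    show "act M j k \<in> hspace M (\<not> podd M k)" for j k
      by (cases j; cases k) (auto simp: act idx hspace_vspan podd a0 intro!: vspan_single)
    fix i j k
    show "Kop M i (act M j k) = cscale (q powi cartan i j * wt M i k) (act M j k)"
    proof (cases j)
      case N0
      then show ?thesis by (simp add: act Kop_def lin_ext_single wtS mult_ac del: cartan.simps)
    next
      case N1
      show ?thesis
      proof (cases k)
        case (Suc n)
        then show ?thesis
          using wtP[of i n] N1 by (simp add: act Kop_def lin_ext_single mult_ac del: cartan.simps)
      qed (simp add: N1 act a0 vlin_zero)
    qed
    assume "i \<noteq> j"
    then consider "i = N0" "j = N1" | "i = N1" "j = N0" by (cases i; cases j) auto
    then show "serre (three_q q) (Eop M i) (Eop M j) (bv k) = 0"
    proof cases
      case 1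
      have "serre (three_q q) (Eop M N0) (Eop M N1) (bv k) = Poly_Mapping.single (k + 2)
        (l ^ 3 * (a k + three_q q * a (k + 1) - three_q q * a (k + 2) - a (k + 3)))"
        by (cases k)
          (simp_all add: serre_def Eop_single act a0 vlin_simps numeral_2_eq_2 numeral_3_eq_3 algebra_simps
            flip: single_add single_diff)
      then show ?thesis unfolding 1 ak by simp
    next
      case 2
      \<comment> \<open>E_1 occurs three times and E_0 once, so each word lowers the index by two in
        total and annihilates the first two basis vectors. From k = k' + 2 on no subtraction is
        truncated, and l (a k) (a (k' + 1)) is a common factor.\<close>
      show ?thesis
      proof (cases "k < 2")
        case True
        then have "k = 0 \<or> k = Suc 0" by auto
        then show ?thesis
          by (auto simp: 2 serre_def Eop_single act a0 vlin_simps)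
      next
        case False
        then obtain k' where k: "k = k' + 2" by (metis add.commute le_Suc_ex linorder_not_less)
        have "serre (three_q q) (Eop M N1) (Eop M N0) (bv k) = Poly_Mapping.single k'
          (- (l * a k * a (k' + 1) * (a k' + three_q q * a (k' + 1) - three_q q * a (k' + 2) - a (k' + 3))))"
          by (cases k')
            (simp_all add: k serre_def Eop_single act a0 vlin_simps numeral_2_eq_2 numeral_3_eq_3 algebra_simps
              flip: single_add single_diff single_uminus)
        then show ?thesis unfolding 2 ak by simp
      qed
    qed
  qed
  show "finite {i \<in> idx M. i = n}" for n by (simp add: idx)
qed (rule wt)+

text \<open>\<open>rho q e\<close> acts on the Fock module of sign -e, whose raising operator is the
  image of E_0. Hence both signs give ladders in the same direction with the same weights and differ
  in the lowering coefficients.\<close>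

lemma rho_simps:
  assumes "e = 1 \<or> e = - 1"
  shows "idx (rho q e l) = UNIV" "podd (rho q e l) k = odd k"
    "wt (rho q e l) N0 k = q powi (2 * int k)" "wt (rho q e l) N1 k = q powi (- 2 * int k)"
    "act (rho q e l) N0 k = Poly_Mapping.single (Suc k) l"
    "act (rho q e l) N1 k = Poly_Mapping.single (k - 1) (l * osc_coeff q (- e) k)"
  using assms by (auto simp: rho_def osc_H_def osc_alpha_def)

lemma rho_catO:
  assumes e: "e = 1 \<or> e = - 1"
  shows "rho q e l \<in> catO q"
proof (rule ladder_catO)
  show "ladder_rec (\<lambda>k. l * osc_coeff q (- e) k)"
    using ladder_rec_lin[OF ladder_rec_osc ladder_rec_osc, of "- e" "- e" l 0] e by auto
qed (use rho_simps[OF e] in auto)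

end

section \<open>Powers of q_* and the evaluation modules\<close>

lemma qspow_add: "qspow bs (x + y) = qspow bs x * qspow bs y"
  by (simp add: qspow_def distrib_left exp_add)

lemma qspow_nz [simp]: "qspow bs x \<noteq> 0"
  by (simp add: qspow_def)

lemma qspow_zero [simp]: "qspow bs 0 = 1"
  by (simp add: qspow_def)

lemma qspow_minus: "qspow bs (- x) = inverse (qspow bs x)"
  by (simp add: qspow_def exp_minus)

lemma qspow_diff: "qspow bs (x - y) = qspow bs x / qspow bs y"
  using qspow_add[of bs x "- y"] by (simp add: qspow_minus divide_inverse)

lemma qspow_mult_nat: "qspow bs (x * of_nat n) = qspow bs x ^ n"
  by (induction n) (simp_all add: distrib_left qspow_add)

lemma qsnum_zero [simp]: "qsnum bs 0 = 0"
  by (simp add: qsnum_def)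

locale qstar_param = generic_param q for q :: complex +
  fixes bs :: complex
  assumes q_qs: "q = \<i> * qspow bs 1"
begin

lemma qspow_2: "qspow bs 2 = - (q\<^sup>2)"
proof -
  have "q\<^sup>2 = \<i>\<^sup>2 * (qspow bs 1)\<^sup>2" by (simp only: q_qs power_mult_distrib)
  then show ?thesis using qspow_add[of bs 1 1] by (simp add: power2_eq_square)
qed

lemma qspow_2k: "qspow bs (2 * of_nat k) = (- 1) ^ k * q powi (2 * int k)"
proof -
  have "qspow bs (2 * of_nat k) = (- 1) ^ k * (q\<^sup>2) ^ k"
    unfolding qspow_mult_nat qspow_2 by (simp flip: power_mult_distrib)
  also have "(q\<^sup>2) ^ k = q powi (2 * int k)"
    by (metis of_nat_mult of_nat_numeral power_int_of_nat power_mult)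
  finally show ?thesis .
qed

lemma qspow_minus_2k: "qspow bs (- 2 * of_nat k) = (- 1) ^ k * q powi (- 2 * int k)"
proof -
  have "qspow bs (- 2 * of_nat k) = inverse ((- 1) ^ k * q powi (2 * int k))"
    using qspow_minus[of bs "2 * of_nat k"] by (simp add: qspow_2k)
  then show ?thesis by (simp add: power_int_minus power_inverse[symmetric])
qed

text \<open>The factor (-1)^k in the weights of W cancels the one in q_*^(2k) = (-1)^k q^(2k), so
  all weights lie in one cone generated by powers of q^2.\<close>

lemma W_simps:
  assumes "e = 1 \<or> e = - 1"
  shows "idx (W_rep bs s e l) = UNIV" "podd (W_rep bs s e l) k = (e * (- 1) ^ k \<noteq> 1)"
    "wt (W_rep bs s e l) N0 k = q powi (2 * int k) * (of_int e * qspow bs (- s))"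
    "wt (W_rep bs s e l) N1 k = q powi (- 2 * int k) * (of_int e * qspow bs s)"
    "act (W_rep bs s e l) N0 k = Poly_Mapping.single (Suc k) l"
    "act (W_rep bs s e l) N1 k = Poly_Mapping.single (k - 1) (l * (qsnum bs (of_nat k) * qsnum bs (s - of_nat k + 1)))"
proof -
  have "qspow bs (2 * of_nat k - s) = qspow bs (2 * of_nat k) * qspow bs (- s)"
    "qspow bs (- 2 * of_nat k + s) = qspow bs (- 2 * of_nat k) * qspow bs s"
    by (simp_all flip: qspow_add)
  moreover have "(- 1) ^ k * ((- 1) ^ k * x) = x" for x :: complex
    by (simp flip: mult.assoc power_add mult_2)
  ultimately show "wt (W_rep bs s e l) N0 k = q powi (2 * int k) * (of_int e * qspow bs (- s))"
    "wt (W_rep bs s e l) N1 k = q powi (- 2 * int k) * (of_int e * qspow bs s)"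
    by (simp_all only: W_rep_def sbmod.simps node.simps qspow_2k qspow_minus_2k) (simp_all add: mult_ac)
qed (simp_all add: W_rep_def mult.assoc)

lemma qsnum_prod:
  assumes mu: "mu = qspow bs (s / 2 + 1 / 2)"
  shows "qsnum bs (of_nat k) * qsnum bs (s - of_nat k + 1)
    = mu\<^sup>2 * osc_coeff q (- 1) k + inverse mu ^ 2 * osc_coeff q 1 k"
proof -
  let ?p = "qspow bs 1" and ?m = "qspow bs (s + 1)" and ?x = "qspow bs (of_nat k)"
  have m: "mu\<^sup>2 = ?m"
  proof -
    have "s + 1 = (s / 2 + 1 / 2) + (s / 2 + 1 / 2)" by (simp add: field_simps)
    then show ?thesis unfolding mu power2_eq_square by (simp only: qspow_add)
  qed
  have x2: "?x\<^sup>2 = (- (q\<^sup>2)) ^ k"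
    using qspow_mult_nat[of bs 2 k] qspow_add[of bs "of_nat k" "of_nat k"]
    by (simp add: qspow_2 power2_eq_square flip: mult_2)
  have qq: "qq = \<i> * (?p - inverse ?p)"
    by (simp add: q_qs algebra_simps)
  then have d: "?p - inverse ?p \<noteq> 0" and qq2: "qq\<^sup>2 = - ((?p - inverse ?p)\<^sup>2)"
    using qq_nz by (auto simp: power_mult_distrib)
  have "qspow bs (s - of_nat k + 1) = ?m / ?x"
    using qspow_diff[of bs "s + 1" "of_nat k"] by (simp add: algebra_simps)
  then have "qsnum bs (of_nat k) * qsnum bs (s - of_nat k + 1) =
    (?x - inverse ?x) * (?m / ?x - ?x / ?m) / (?p - inverse ?p)\<^sup>2"
    by (simp add: qsnum_def qspow_minus[of bs "of_nat k"] qspow_minus[of bs 1] power2_eq_square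
        qspow_minus[of bs "s - of_nat k + 1", simplified])
  also have "(?x - inverse ?x) * (?m / ?x - ?x / ?m) = ?m * (1 - inverse (?x\<^sup>2)) + inverse ?m * (1 - ?x\<^sup>2)"
    by (simp add: field_simps power2_eq_square)
  also have "inverse (?x\<^sup>2) = (- ((q powi (- 1))\<^sup>2)) ^ k"
    unfolding x2 using q_nz by (simp add: power_int_minus power_inverse flip: inverse_minus_eq)
  also have "(?m * (1 - (- ((q powi (- 1))\<^sup>2)) ^ k) + inverse ?m * (1 - ?x\<^sup>2)) / (?p - inverse ?p)\<^sup>2
    = mu\<^sup>2 * osc_coeff q (- 1) k + inverse mu ^ 2 * osc_coeff q 1 k"
    unfolding osc_coeff_closed[of "- 1", simplified] osc_coeff_closed[of 1, simplified] qq2 x2 power_inverse m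
    by (simp add: power_inverse algebra_simps add_divide_distrib diff_divide_distrib)
  finally show ?thesis .
qed

text \<open>The lowering coefficients of W combine those of the two oscillators by
  \<open>qsnum_prod\<close>, and the ladder recursion is linear.\<close>

lemma W_catO:
  assumes e: "e = 1 \<or> e = - 1"
  shows "W_rep bs s e l \<in> catO q"
proof (rule ladder_catO[where u = "of_int e * qspow bs (- s)" and v = "of_int e * qspow bs s"])
  let ?mu = "qspow bs (s / 2 + 1 / 2)"
  have "(\<lambda>k. l * (qsnum bs (of_nat k) * qsnum bs (s - of_nat k + 1))) =
    (\<lambda>k. (l * ?mu\<^sup>2) * osc_coeff q (- 1) k + (l * inverse ?mu ^ 2) * osc_coeff q 1 k)"
    by (rule ext) (simp only: qsnum_prod[OF refl] distrib_left mult.assoc)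
  then show "ladder_rec (\<lambda>k. l * (qsnum bs (of_nat k) * qsnum bs (s - of_nat k + 1)))"
    using ladder_rec_lin[OF ladder_rec_osc[of "- 1"] ladder_rec_osc[of 1]] by simp
  show "podd (W_rep bs s e l) (Suc k) = (\<not> podd (W_rep bs s e l) k)" for k
    unfolding W_simps(2)[OF e] using e by (cases "even k") auto
qed (use e in \<open>auto simp only: W_simps[OF e]\<close>, use e in auto)

end


section \<open>The filtration of the tensor product\<close>

text \<open>
  The tensor product of the prefundamental modules has the basis \<open>c\<^sup>k |0, j\<rangle>\<close> with \<open>\<E>\<^sub>0 = l c\<close>,
  indexed by \<open>prod_encode (k, j)\<close>. The vectors with \<open>j < m\<close> span a submodule, and
  \<open>tail_mod q mu l m\<close> is the quotient by it.
\<close>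

definition tail_mod :: "complex \<Rightarrow> complex \<Rightarrow> complex \<Rightarrow> nat \<Rightarrow> sbmod"
  where "tail_mod q mu l m = \<lparr>
    idx = {n. m \<le> snd (prod_decode n)},
    podd = (\<lambda>n. case prod_decode n of (k, j) \<Rightarrow> odd (k + j)),
    wt = (\<lambda>i n. case prod_decode n of (k, j) \<Rightarrow>
      (case i of N0 \<Rightarrow> q powi (2 * int (k + j)) | N1 \<Rightarrow> q powi (- 2 * int (k + j)))),
    act = (\<lambda>i n. case prod_decode n of (k, j) \<Rightarrow> (case i of
        N0 \<Rightarrow> Poly_Mapping.single (prod_encode (Suc k, j)) l
      | N1 \<Rightarrow> Poly_Mapping.single (prod_encode (k - 1, j))
          (l * (mu\<^sup>2 * osc_coeff q (- 1) k + inverse mu ^ 2 * osc_coeff q 1 k))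
        + (if j \<le> m then 0 else Poly_Mapping.single (prod_encode (k, j - 1))
            (l * ((- (q\<^sup>2)) ^ k * (inverse mu * osc_coeff q 1 j))))))\<rparr>"

lemma tail_simps [simp]:
  "prod_encode (k, j) \<in> idx (tail_mod q mu l m) \<longleftrightarrow> m \<le> j"
  "podd (tail_mod q mu l m) (prod_encode (k, j)) = odd (k + j)"
  "wt (tail_mod q mu l m) N0 (prod_encode (k, j)) = q powi (2 * int (k + j))"
  "wt (tail_mod q mu l m) N1 (prod_encode (k, j)) = q powi (- 2 * int (k + j))"
  "act (tail_mod q mu l m) N0 (prod_encode (k, j)) = Poly_Mapping.single (prod_encode (Suc k, j)) l"
  "act (tail_mod q mu l m) N1 (prod_encode (k, j)) = Poly_Mapping.single (prod_encode (k - 1, j))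
          (l * (mu\<^sup>2 * osc_coeff q (- 1) k + inverse mu ^ 2 * osc_coeff q 1 k))
        + (if j \<le> m then 0 else Poly_Mapping.single (prod_encode (k, j - 1))
            (l * ((- (q\<^sup>2)) ^ k * (inverse mu * osc_coeff q 1 j))))"
  by (simp_all add: tail_mod_def)

definition rr_mod :: "complex \<Rightarrow> complex \<Rightarrow> complex \<Rightarrow> sbmod"
  where "rr_mod q mu l = tensor (rho_plus q (l * mu)) (rho_minus q (l * inverse mu))"

text \<open>
  On \<open>rr_mod q mu l\<close>, the operators \<open>\<E>\<^sub>0\<close> and \<open>\<E>\<^sub>1\<close> are \<open>l\<close> times \<open>raise_op\<close> and
  \<open>lower_left + lower_right\<close>; splitting off the factor \<open>l\<close> makes \<open>l = 0\<close> unexceptional.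
\<close>

definition raise_op :: "complex \<Rightarrow> complex \<Rightarrow> vec \<Rightarrow> vec"
  where "raise_op q mu = lin_ext (\<lambda>n. case prod_decode n of (i, k) \<Rightarrow>
    Poly_Mapping.single (prod_encode (Suc i, k)) (mu * q powi (2 * int k))
    + Poly_Mapping.single (prod_encode (i, Suc k)) ((- 1) ^ i * inverse mu))"

definition lower_left :: "complex \<Rightarrow> complex \<Rightarrow> vec \<Rightarrow> vec"
  where "lower_left q mu = lin_ext (\<lambda>n. case prod_decode n of (i, k) \<Rightarrow>
    Poly_Mapping.single (prod_encode (i - 1, k)) (mu * osc_coeff q (- 1) i * q powi (- 2 * int k)))"

definition lower_right :: "complex \<Rightarrow> complex \<Rightarrow> vec \<Rightarrow> vec"
  where "lower_right q mu = lin_ext (\<lambda>n. case prod_decode n of (i, k) \<Rightarrow>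
    Poly_Mapping.single (prod_encode (i, k - 1)) ((- 1) ^ i * inverse mu * osc_coeff q 1 k))"

definition rr_basis :: "complex \<Rightarrow> complex \<Rightarrow> nat \<Rightarrow> vec"
  where "rr_basis q mu n = (case prod_decode n of (k, j) \<Rightarrow> (raise_op q mu ^^ k) (bv (prod_encode (0, j))))"

text \<open>The operator \<open>raise_op\<close> as seen in the coordinates of
  \<open>rr_basis\<close>.\<close>

definition shift_op :: "vec \<Rightarrow> vec"
  where "shift_op = lin_ext (\<lambda>n. case prod_decode n of (k, j) \<Rightarrow> bv (prod_encode (Suc k, j)))"

text \<open>The coordinates of \<open>|i, j\<rangle>\<close> in the basis \<open>rr_basis\<close>.\<close>

primrec rr_coord :: "complex \<Rightarrow> complex \<Rightarrow> nat \<Rightarrow> nat \<Rightarrow> vec"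
  where
    "rr_coord q mu 0 j = bv (prod_encode (0, j))"
  | "rr_coord q mu (Suc i) j = cscale (inverse (mu * q powi (2 * int j)))
      (shift_op (rr_coord q mu i j) - cscale ((- 1) ^ i * inverse mu) (rr_coord q mu i (Suc j)))"

lemma vlin_ops [simp, intro]:
  "vlin (raise_op q mu)" "vlin (lower_left q mu)" "vlin (lower_right q mu)" "vlin shift_op"
  by (simp_all add: raise_op_def lower_left_def lower_right_def shift_op_def)

lemma op_bv:
  "raise_op q mu (bv (prod_encode (i, k))) =
    Poly_Mapping.single (prod_encode (Suc i, k)) (mu * q powi (2 * int k))
    + Poly_Mapping.single (prod_encode (i, Suc k)) ((- 1) ^ i * inverse mu)"
  "lower_left q mu (bv (prod_encode (i, k))) =
    Poly_Mapping.single (prod_encode (i - 1, k)) (mu * osc_coeff q (- 1) i * q powi (- 2 * int k))"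
  "lower_right q mu (bv (prod_encode (i, k))) =
    Poly_Mapping.single (prod_encode (i, k - 1)) ((- 1) ^ i * inverse mu * osc_coeff q 1 k)"
  "shift_op (bv (prod_encode (k, j))) = bv (prod_encode (Suc k, j))"
  by (simp_all add: raise_op_def lower_left_def lower_right_def shift_op_def)

lemma op_single:
  "raise_op q mu (Poly_Mapping.single (prod_encode (i, k)) x) =
    Poly_Mapping.single (prod_encode (Suc i, k)) (x * (mu * q powi (2 * int k)))
    + Poly_Mapping.single (prod_encode (i, Suc k)) (x * ((- 1) ^ i * inverse mu))"
  "lower_left q mu (Poly_Mapping.single (prod_encode (i, k)) x) =
    Poly_Mapping.single (prod_encode (i - 1, k)) (x * (mu * osc_coeff q (- 1) i * q powi (- 2 * int k)))"
  "lower_right q mu (Poly_Mapping.single (prod_encode (i, k)) x) =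
    Poly_Mapping.single (prod_encode (i, k - 1)) (x * ((- 1) ^ i * inverse mu * osc_coeff q 1 k))"
  by (simp_all add: raise_op_def lower_left_def lower_right_def lin_ext_single cscale_add)

section \<open>Commutation of the lowering operators with the raising operator\<close>

locale osc_pair = generic_param q for q :: complex +
  fixes mu :: complex
  assumes mu_nz: "mu \<noteq> 0"
begin

lemma rr_simps:
  "idx (rr_mod q mu l) = UNIV" "podd (rr_mod q mu l) (prod_encode (i, k)) = odd (i + k)"
  "wt (rr_mod q mu l) N0 (prod_encode (i, k)) = q powi (2 * int (i + k))"
  "wt (rr_mod q mu l) N1 (prod_encode (i, k)) = q powi (- 2 * int (i + k))"
proof -
  have "n \<in> idx (rr_mod q mu l)" for n
    by (rule bv_cases[of n]) (simp add: rr_mod_def rho_simps)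
  then show "idx (rr_mod q mu l) = UNIV" by auto
  show "podd (rr_mod q mu l) (prod_encode (i, k)) = odd (i + k)"
    by (auto simp: rr_mod_def rho_simps)
  show "wt (rr_mod q mu l) N0 (prod_encode (i, k)) = q powi (2 * int (i + k))"
    "wt (rr_mod q mu l) N1 (prod_encode (i, k)) = q powi (- 2 * int (i + k))"
    using q_nz by (simp_all add: rr_mod_def rho_simps distrib_left power_int_add power_int_diff
        power_int_minus field_simps)
qed

lemma rr_catO: "rr_mod q mu l \<in> catO q"
  unfolding rr_mod_def by (intro tensor_catO rho_catO) auto

lemma Eop_rr:
  "Eop (rr_mod q mu l) N0 v = cscale l (raise_op q mu v)"
  "Eop (rr_mod q mu l) N1 v = cscale l (lower_left q mu v + lower_right q mu v)"
proof -
  show "Eop (rr_mod q mu l) N0 v = cscale l (raise_op q mu v)"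
  proof (rule vlin_eq_all[of "Eop (rr_mod q mu l) N0" "\<lambda>v. cscale l (raise_op q mu v)"])
    fix n
    obtain i k where n: "n = prod_encode (i, k)" by (rule bv_cases)
    show "Eop (rr_mod q mu l) N0 (bv n) = cscale l (raise_op q mu (bv n))"
      by (simp add: n op_bv rr_mod_def rho_simps tens_vec_single cscale_add mult_ac)
  qed (auto intro!: vlin_scale)
  show "Eop (rr_mod q mu l) N1 v = cscale l (lower_left q mu v + lower_right q mu v)"
  proof (rule vlin_eq_all[of "Eop (rr_mod q mu l) N1" "\<lambda>v. cscale l (lower_left q mu v + lower_right q mu v)"])
    fix n
    obtain i k where n: "n = prod_encode (i, k)" by (rule bv_cases)
    show "Eop (rr_mod q mu l) N1 (bv n) = cscale l (lower_left q mu (bv n) + lower_right q mu (bv n))"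
      by (simp add: n op_bv rr_mod_def rho_simps tens_vec_single cscale_add mult_ac)
  qed (auto intro!: vlin_scale vlin_plus)
qed

text \<open>The oscillator relation in the left factor and the sign and weight shift against the
  other summand of \<open>raise_op\<close> produce the same factor -q^-2. Only the oscillator
  relation contributes the constant, because K_1 K_0 acts as 1 on the right factor.\<close>

lemma lower_left_raise:
  "lower_left q mu (raise_op q mu v) =
    cscale (- (inverse q ^ 2)) (raise_op q mu (lower_left q mu v)) + cscale (mu\<^sup>2 * osc_coeff q (- 1) 1) v"
proof (rule vlin_eq_all[of "\<lambda>v. lower_left q mu (raise_op q mu v)"
      "\<lambda>v. cscale (- (inverse q ^ 2)) (raise_op q mu (lower_left q mu v)) + cscale (mu\<^sup>2 * osc_coeff q (- 1) 1) v"])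
  fix n
  obtain i k where n: "n = prod_encode (i, k)" by (rule bv_cases)
  have p: "q powi (- 2 * int (Suc k)) = inverse q ^ 2 * q powi (- 2 * int k)"
    "q powi (- 2 * int k) * q powi (2 * int k) = 1"
    using q_nz by (simp_all add: distrib_left power_int_add power_int_diff power_int_minus power_inverse field_simps)
  have p2: "(q powi (- 1))\<^sup>2 = inverse q ^ 2" by (simp add: power_int_minus)
  show "lower_left q mu (raise_op q mu (bv n)) =
    cscale (- (inverse q ^ 2)) (raise_op q mu (lower_left q mu (bv n))) + cscale (mu\<^sup>2 * osc_coeff q (- 1) 1) (bv n)"
  proof (cases i)
    case 0
    have z: "lower_left q mu (bv (prod_encode (0, k))) = 0" for k
      by (simp add: op_bv)
    have "lower_left q mu (raise_op q mu (bv n)) =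
      Poly_Mapping.single n (mu * q powi (2 * int k) * (mu * osc_coeff q (- 1) 1 * q powi (- 2 * int k)))"
      unfolding n 0 op_bv(1) vlin_add[OF vlin_ops(2)] op_single by simp
    also have "mu * q powi (2 * int k) * (mu * osc_coeff q (- 1) 1 * q powi (- 2 * int k)) =
      mu\<^sup>2 * osc_coeff q (- 1) 1 * (q powi (- 2 * int k) * q powi (2 * int k))"
      by (simp only: power2_eq_square mult_ac)
    finally show ?thesis
      unfolding p(2) by (simp add: n 0 z vlin_zero del: osc_coeff.simps One_nat_def)
  next
    case (Suc i')
    define C where "C = osc_coeff q (- 1) (Suc i')"
    define D where "D = osc_coeff q (- 1) 1"
    have S: "osc_coeff q (- 1) (Suc (Suc i')) = D - inverse q ^ 2 * C"
      unfolding osc_coeff_Suc[of q "- 1" "Suc i'"] p2 C_def D_def ..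
    define x where "x = q powi (2 * int k)"
    define y where "y = q powi (- 2 * int k)"
    have xy: "y * x = 1" using p(2) by (simp add: x_def y_def)
    have xy': "y * (x * z) = z" for z using xy by (metis mult.assoc mult_1)
    have L: "lower_left q mu (raise_op q mu (bv n)) =
      Poly_Mapping.single (prod_encode (Suc i', k)) (mu * x * (mu * (D - inverse q ^ 2 * C) * y))
      + Poly_Mapping.single (prod_encode (i', Suc k)) ((- 1) ^ Suc i' * inverse mu * (mu * C * (inverse q ^ 2 * y)))"
      by (simp only: n Suc op_bv(1) vlin_add[OF vlin_ops(2)] op_single S p(1) x_def y_def C_def
        cscale_single diff_Suc_1 mult_1)
    have R: "raise_op q mu (lower_left q mu (bv n)) =
      Poly_Mapping.single (prod_encode (Suc i', k)) (mu * C * y * (mu * x))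
      + Poly_Mapping.single (prod_encode (i', Suc k)) (mu * C * y * ((- 1) ^ i' * inverse mu))"
      by (simp only: n Suc op_bv(2) op_single x_def y_def C_def cscale_single diff_Suc_1 cscale_add mult_1)
    have c: "mu * x * (mu * (D - inverse q ^ 2 * C) * y) = - (inverse q ^ 2) * (mu * C * y * (mu * x)) + mu\<^sup>2 * D"
      using xy by (simp add: algebra_simps power2_eq_square xy')
    have c': "(- 1) ^ Suc i' * inverse mu * (mu * C * (inverse q ^ 2 * y))
      = - (inverse q ^ 2) * (mu * C * y * ((- 1) ^ i' * inverse mu))"
      by simp
    show ?thesis
      unfolding L R c c' D_def[symmetric] by (simp only: n Suc cscale_add cscale_single single_add add_ac mult_1_right)
  qed
qed (auto intro!: vlin_scale vlin_plus vlin_comp[OF vlin_ops(1) vlin_ops(2)] vlin_comp[OF vlin_ops(2) vlin_ops(1)])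

text \<open>The mirror image with factor -q^2. As the two factors differ, the summands of E_1 have
  to be moved past powers of \<open>raise_op\<close> separately.\<close>

lemma lower_right_raise:
  "lower_right q mu (raise_op q mu v) =
    cscale (- (q\<^sup>2)) (raise_op q mu (lower_right q mu v)) + cscale (inverse mu ^ 2 * osc_coeff q 1 1) v"
proof (rule vlin_eq_all[of "\<lambda>v. lower_right q mu (raise_op q mu v)"
      "\<lambda>v. cscale (- (q\<^sup>2)) (raise_op q mu (lower_right q mu v)) + cscale (inverse mu ^ 2 * osc_coeff q 1 1) v"])
  fix n
  obtain i k where n: "n = prod_encode (i, k)" by (rule bv_cases)
  have sq: "(- 1) ^ i * inverse mu * ((- 1) ^ i * inverse mu * z) = inverse mu ^ 2 * z" for z :: complex
    by (cases "even i") (simp_all add: power2_eq_square)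
  show "lower_right q mu (raise_op q mu (bv n)) =
    cscale (- (q\<^sup>2)) (raise_op q mu (lower_right q mu (bv n))) + cscale (inverse mu ^ 2 * osc_coeff q 1 1) (bv n)"
  proof (cases k)
    case 0
    have z: "lower_right q mu (bv (prod_encode (i, 0))) = 0" for i
      by (simp add: op_bv)
    have "lower_right q mu (raise_op q mu (bv n)) =
      Poly_Mapping.single n ((- 1) ^ i * inverse mu * ((- 1) ^ i * inverse mu * osc_coeff q 1 1))"
      unfolding n 0 op_bv(1) vlin_add[OF vlin_ops(3)] op_single by simp
    also have "(- 1) ^ i * inverse mu * ((- 1) ^ i * inverse mu * osc_coeff q 1 1) = inverse mu ^ 2 * osc_coeff q 1 1"
      by (rule sq)
    finally show ?thesis
      by (simp add: n 0 z vlin_zero del: osc_coeff.simps One_nat_def)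
  next
    case (Suc k')
    define C where "C = osc_coeff q 1 (Suc k')"
    define D where "D = osc_coeff q 1 1"
    define x where "x = q powi (2 * int k')"
    have S: "osc_coeff q 1 (Suc (Suc k')) = D - q\<^sup>2 * C"
      unfolding osc_coeff_Suc[of q 1 "Suc k'"] C_def D_def by simp
    have p: "q powi (2 * int (Suc k')) = q\<^sup>2 * x"
      using q_nz by (simp add: x_def distrib_left power_int_add)
    have L: "lower_right q mu (raise_op q mu (bv n)) =
      Poly_Mapping.single (prod_encode (Suc i, k')) (mu * (q\<^sup>2 * x) * ((- 1) ^ Suc i * inverse mu * C))
      + Poly_Mapping.single (prod_encode (i, Suc k')) ((- 1) ^ i * inverse mu * ((- 1) ^ i * inverse mu * (D - q\<^sup>2 * C)))"
      by (simp only: n Suc op_bv(1) vlin_add[OF vlin_ops(3)] op_single S p C_def cscale_single diff_Suc_1 mult_1)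
    have R: "raise_op q mu (lower_right q mu (bv n)) =
      Poly_Mapping.single (prod_encode (Suc i, k')) ((- 1) ^ i * inverse mu * C * (mu * x))
      + Poly_Mapping.single (prod_encode (i, Suc k')) ((- 1) ^ i * inverse mu * C * ((- 1) ^ i * inverse mu))"
      by (simp only: n Suc op_bv(3) op_single x_def C_def cscale_single diff_Suc_1 cscale_add mult_1)
    have c: "(- 1) ^ i * inverse mu * ((- 1) ^ i * inverse mu * (D - q\<^sup>2 * C)) =
      - (q\<^sup>2) * ((- 1) ^ i * inverse mu * C * ((- 1) ^ i * inverse mu)) + inverse mu ^ 2 * D"
      using sq[of C] sq[of D] by (simp add: algebra_simps)
    have c': "mu * (q\<^sup>2 * x) * ((- 1) ^ Suc i * inverse mu * C)
      = - (q\<^sup>2) * ((- 1) ^ i * inverse mu * C * (mu * x))"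
      by simp
    show ?thesis
      unfolding L R c c' D_def[symmetric] by (simp only: n Suc cscale_add cscale_single single_add add_ac mult_1_right)
  qed
qed (auto intro!: vlin_scale vlin_plus vlin_comp[OF vlin_ops(1) vlin_ops(3)] vlin_comp[OF vlin_ops(3) vlin_ops(1)])

text \<open>\<open>lower_left\<close> annihilates |0, j>, so only the constants survive, and they
  accumulate by the recursion of \<open>osc_coeff\<close>.\<close>

lemma lower_left_power:
  "lower_left q mu ((raise_op q mu ^^ k) (bv (prod_encode (0, j)))) =
    cscale (mu\<^sup>2 * osc_coeff q (- 1) k) ((raise_op q mu ^^ (k - 1)) (bv (prod_encode (0, j))))"
proof (induction k)
  case 0
  then show ?case by (simp add: op_bv)
next
  case (Suc k)
  let ?w = "\<lambda>k. (raise_op q mu ^^ k) (bv (prod_encode (0, j)))"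
  have S: "osc_coeff q (- 1) (Suc k) = osc_coeff q (- 1) 1 - inverse q ^ 2 * osc_coeff q (- 1) k"
    unfolding osc_coeff_Suc[of q "- 1" k] by (simp add: power_int_minus)
  \<comment> \<open>For k = 0 the truncated exponent k - 1 is wrong, but the coefficient is
    zero.\<close>
  have "cscale (osc_coeff q (- 1) k) (raise_op q mu (?w (k - 1))) = cscale (osc_coeff q (- 1) k) (?w k)"
    by (cases k) simp_all
  then have *: "cscale (c * osc_coeff q (- 1) k) (raise_op q mu (?w (k - 1))) = cscale (c * osc_coeff q (- 1) k) (?w k)" for c
    by (metis cscale_cscale)
  have "lower_left q mu (?w (Suc k)) = cscale (- (inverse q ^ 2) * mu\<^sup>2 * osc_coeff q (- 1) k) (?w k)
      + cscale (mu\<^sup>2 * osc_coeff q (- 1) 1) (?w k)"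
    unfolding funpow.simps o_def lower_left_raise Suc.IH vlin_cscale[OF vlin_ops(1)] cscale_cscale
    by (simp only: * mult.assoc[symmetric])
  also have "\<dots> = cscale (mu\<^sup>2 * osc_coeff q (- 1) (Suc k)) (?w k)"
    unfolding S cscale_left_add[symmetric] by (simp add: algebra_simps)
  finally show ?case by simp
qed

text \<open>The second term is \<open>lower_right\<close> applied to |0, j> after passing all k
  raising operators, each of which contributes -q^2. It lowers j, which makes the span of the
  vectors with bounded j stable.\<close>

lemma lower_right_power:
  "lower_right q mu ((raise_op q mu ^^ k) (bv (prod_encode (0, j)))) =
    cscale (inverse mu ^ 2 * osc_coeff q 1 k) ((raise_op q mu ^^ (k - 1)) (bv (prod_encode (0, j))))
    + cscale ((- (q\<^sup>2)) ^ k * (inverse mu * osc_coeff q 1 j)) ((raise_op q mu ^^ k) (bv (prod_encode (0, j - 1))))"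
proof (induction k)
  case 0
  then show ?case by (simp add: op_bv)
next
  case (Suc k)
  let ?w = "\<lambda>k. (raise_op q mu ^^ k) (bv (prod_encode (0, j)))"
  let ?v = "\<lambda>k. (raise_op q mu ^^ k) (bv (prod_encode (0, j - 1)))"
  let ?b = "inverse mu * osc_coeff q 1 j"
  have S: "osc_coeff q 1 (Suc k) = osc_coeff q 1 1 - q\<^sup>2 * osc_coeff q 1 k"
    unfolding osc_coeff_Suc[of q 1 k] by simp
  have "cscale (osc_coeff q 1 k) (raise_op q mu (?w (k - 1))) = cscale (osc_coeff q 1 k) (?w k)"
    by (cases k) simp_all
  then have *: "cscale (c * osc_coeff q 1 k) (raise_op q mu (?w (k - 1))) = cscale (c * osc_coeff q 1 k) (?w k)" for c
    by (metis cscale_cscale)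
  have "lower_right q mu (?w (Suc k)) = (cscale (- (q\<^sup>2) * inverse mu ^ 2 * osc_coeff q 1 k) (?w k)
      + cscale (- (q\<^sup>2) * ((- (q\<^sup>2)) ^ k * ?b)) (?v (Suc k)))
      + cscale (inverse mu ^ 2 * osc_coeff q 1 1) (?w k)"
    unfolding funpow.simps o_def lower_right_raise Suc.IH vlin_cscale[OF vlin_ops(1)] vlin_add[OF vlin_ops(1)]
      cscale_cscale cscale_add
    by (simp only: * mult.assoc[symmetric])
  also have "\<dots> = (cscale (- (q\<^sup>2) * inverse mu ^ 2 * osc_coeff q 1 k) (?w k)
      + cscale (inverse mu ^ 2 * osc_coeff q 1 1) (?w k)) + cscale ((- (q\<^sup>2)) ^ Suc k * ?b) (?v (Suc k))"
    by (simp only: add_ac mult.assoc power_Suc)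
  also have "\<dots> = cscale (inverse mu ^ 2 * osc_coeff q 1 (Suc k)) (?w k) + cscale ((- (q\<^sup>2)) ^ Suc k * ?b) (?v (Suc k))"
    unfolding S cscale_left_add[symmetric] by (simp add: algebra_simps)
  finally show ?case by simp
qed

section \<open>Weight levels and the change of basis\<close>

definition level :: "nat \<Rightarrow> nat set"
  where "level N = {n. fst (prod_decode n) + snd (prod_decode n) = N}"

lemma rr_basis_level:
  "(raise_op q mu ^^ k) (bv (prod_encode (0, j))) \<in> vspan (level (k + j))"
proof (induction k)
  case 0
  then show ?case by (simp add: level_def vspan_single)
next
  case (Suc k)
  have "raise_op q mu ((raise_op q mu ^^ k) (bv (prod_encode (0, j)))) \<in> vspan (level (Suc (k + j)))"
  proof (rule vlin_vspan[OF vlin_ops(1) _ Suc])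
    fix n assume "n \<in> level (k + j)"
    moreover obtain a b where "n = prod_encode (a, b)" by (rule bv_cases)
    ultimately show "raise_op q mu (bv n) \<in> vspan (level (Suc (k + j)))"
      by (auto simp: op_bv level_def intro!: vspan_add vspan_single)
  qed
  then show ?case by simp
qed

lemma Kop_level:
  assumes "v \<in> vspan (level N)"
  shows "Kop (rr_mod q mu l) i v = cscale (case i of N0 \<Rightarrow> q powi (2 * int N) | N1 \<Rightarrow> q powi (- 2 * int N)) v"
proof (rule poly_mapping_eqI)
  fix n
  obtain a b where n: "n = prod_encode (a, b)" by (rule bv_cases)
  show "Poly_Mapping.lookup (Kop (rr_mod q mu l) i v) n =
    Poly_Mapping.lookup (cscale (case i of N0 \<Rightarrow> q powi (2 * int N) | N1 \<Rightarrow> q powi (- 2 * int N)) v) n"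
  proof (cases "n \<in> level N")
    case True
    then have "a + b = N" by (simp add: level_def n)
    then show ?thesis by (cases i) (simp_all only: lookup_Kop lookup_cscale n rr_simps node.case)
  next
    case False
    then show ?thesis using assms by (simp add: lookup_Kop vspan_lookup)
  qed
qed

lemma level_hspace: "vspan (level N) \<subseteq> hspace (rr_mod q mu l) (odd N)"
  unfolding hspace_vspan
proof (rule vspan_mono, rule subsetI)
  fix n assume n: "n \<in> level N"
  obtain a b where ab: "n = prod_encode (a, b)" by (rule bv_cases)
  with n have "a + b = N" by (simp add: level_def)
  then show "n \<in> {i \<in> idx (rr_mod q mu l). podd (rr_mod q mu l) i = odd N}"
    by (simp add: ab rr_simps)
qed

lemma rr_basis_hom: "is_hom (tail_mod q mu l 0) (rr_mod q mu l) (lin_ext (rr_basis q mu))"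
proof (rule is_homI)
  fix n i
  obtain k j where n: "n = prod_encode (k, j)" by (rule bv_cases)
  have b: "rr_basis q mu (prod_encode (k, j)) = (raise_op q mu ^^ k) (bv (prod_encode (0, j)))" for k j
    by (simp add: rr_basis_def)
  show "rr_basis q mu n \<in> hspace (rr_mod q mu l) (podd (tail_mod q mu l 0) n)"
    unfolding n b tail_simps by (rule subsetD[OF level_hspace rr_basis_level])
  show "lin_ext (rr_basis q mu) (act (tail_mod q mu l 0) i n) = Eop (rr_mod q mu l) i (rr_basis q mu n)"
  proof (cases i)
    case N0
    then show ?thesis by (simp add: n lin_ext_single Eop_rr b)
  next
    case N1
    have "lin_ext (rr_basis q mu) (act (tail_mod q mu l 0) N1 n) =
      cscale (l * (mu\<^sup>2 * osc_coeff q (- 1) k + inverse mu ^ 2 * osc_coeff q 1 k)) (rr_basis q mu (prod_encode (k - 1, j)))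
      + cscale (l * ((- (q\<^sup>2)) ^ k * (inverse mu * osc_coeff q 1 j))) (rr_basis q mu (prod_encode (k, j - 1)))"
      by (cases j) (simp_all add: n vlin_add[OF vlin_lin_ext] lin_ext_single)
    then show ?thesis
      by (simp add: N1 n Eop_rr b lower_left_power lower_right_power cscale_add cscale_left_add distrib_left add_ac)
  qed
  show "Kop (rr_mod q mu l) i (rr_basis q mu n) = cscale (wt (tail_mod q mu l 0) i n) (rr_basis q mu n)"
    unfolding n b Kop_level[OF rr_basis_level] by (cases i) (simp_all only: tail_simps node.case)
qed

lemma rr_basis_shift: "lin_ext (rr_basis q mu) (shift_op v) = raise_op q mu (lin_ext (rr_basis q mu) v)"
proof (rule vlin_eq_all[of "\<lambda>v. lin_ext (rr_basis q mu) (shift_op v)" "\<lambda>v. raise_op q mu (lin_ext (rr_basis q mu) v)"])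
  fix n
  obtain k j where n: "n = prod_encode (k, j)" by (rule bv_cases)
  show "lin_ext (rr_basis q mu) (shift_op (bv n)) = raise_op q mu (lin_ext (rr_basis q mu) (bv n))"
    by (simp add: n op_bv rr_basis_def)
qed (rule vlin_comp[OF vlin_lin_ext vlin_ops(4)] vlin_comp[OF vlin_ops(1) vlin_lin_ext])+

lemma raise_coeff_nz: "mu * q powi (2 * int j) \<noteq> 0"
  using mu_nz q_nz by simp

text \<open>The recursion of \<open>rr_coord\<close> solves the formula for \<open>raise_op\<close>
  on |i, j> for its leading term |i + 1, j>, whose coefficient is nonzero by
  \<open>raise_coeff_nz\<close>.\<close>

lemma rr_basis_coord: "lin_ext (rr_basis q mu) (rr_coord q mu i j) = bv (prod_encode (i, j))"
proof (induction i arbitrary: j)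
  case 0
  then show ?case by (simp add: rr_basis_def)
next
  case (Suc i)
  have "lin_ext (rr_basis q mu) (rr_coord q mu (Suc i) j) = cscale (inverse (mu * q powi (2 * int j)))
    (raise_op q mu (bv (prod_encode (i, j))) - cscale ((- 1) ^ i * inverse mu) (bv (prod_encode (i, Suc j))))"
    by (simp add: vlin_simps[OF vlin_lin_ext] rr_basis_shift Suc del: cscale_single)
  also have "raise_op q mu (bv (prod_encode (i, j))) - cscale ((- 1) ^ i * inverse mu) (bv (prod_encode (i, Suc j)))
    = cscale (mu * q powi (2 * int j)) (bv (prod_encode (Suc i, j)))"
    by (simp add: op_bv)
  also have "cscale (inverse (mu * q powi (2 * int j))) \<dots> = bv (prod_encode (Suc i, j))"
    by (simp only: cscale_cscale left_inverse[OF raise_coeff_nz] cscale_one)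
  finally show ?case .
qed

text \<open>Intertwining \<open>raise_op\<close> with the shift shows by induction on k that the
  coordinate map sends c^k |0, j> to the basis vector (k, j), so it is also a left inverse of
  \<open>rr_basis\<close>.\<close>

lemma rr_coord_raise:
  "lin_ext (\<lambda>n. case prod_decode n of (i, j) \<Rightarrow> rr_coord q mu i j) (raise_op q mu v) =
    shift_op (lin_ext (\<lambda>n. case prod_decode n of (i, j) \<Rightarrow> rr_coord q mu i j) v)"
proof -
  let ?r = "lin_ext (\<lambda>n. case prod_decode n of (i, j) \<Rightarrow> rr_coord q mu i j)"
  show "?r (raise_op q mu v) = shift_op (?r v)"
  proof (rule vlin_eq_all[of "\<lambda>v. ?r (raise_op q mu v)" "\<lambda>v. shift_op (?r v)"])
    fix n
    obtain i j where n: "n = prod_encode (i, j)" by (rule bv_cases)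
    have "?r (raise_op q mu (bv n)) = cscale (mu * q powi (2 * int j)) (rr_coord q mu (Suc i) j)
      + cscale ((- 1) ^ i * inverse mu) (rr_coord q mu i (Suc j))"
      unfolding n op_bv(1) vlin_add[OF vlin_lin_ext] lin_ext_single by simp
    also have "cscale (mu * q powi (2 * int j)) (rr_coord q mu (Suc i) j) =
      shift_op (rr_coord q mu i j) - cscale ((- 1) ^ i * inverse mu) (rr_coord q mu i (Suc j))"
      unfolding rr_coord.simps cscale_cscale right_inverse[OF raise_coeff_nz] by simp
    finally show "?r (raise_op q mu (bv n)) = shift_op (?r (bv n))"
      by (simp add: n)
  qed (rule vlin_comp[OF vlin_lin_ext vlin_ops(1)] vlin_comp[OF vlin_ops(4) vlin_lin_ext])+
qed

lemma rr_iso: "mod_iso (tail_mod q mu l 0) (rr_mod q mu l)"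
  and tail_0_rep: "is_rep q (tail_mod q mu l 0)"
proof -
  let ?r = "lin_ext (\<lambda>n. case prod_decode n of (i, j) \<Rightarrow> rr_coord q mu i j)"
  have idx: "idx (tail_mod q mu l 0) = UNIV" by (simp add: tail_mod_def)
  have rf: "?r (lin_ext (rr_basis q mu) (bv n)) = bv n" for n
  proof -
    obtain k j where n: "n = prod_encode (k, j)" by (rule bv_cases)
    have "?r ((raise_op q mu ^^ k) (bv (prod_encode (0, j)))) = bv (prod_encode (k, j))"
      by (induction k) (simp_all add: rr_coord_raise op_bv)
    then show ?thesis by (simp add: n rr_basis_def)
  qed
  show "mod_iso (tail_mod q mu l 0) (rr_mod q mu l)"
  proof (rule mod_isoI[of "lin_ext (rr_basis q mu)" ?r])
    fix n
    obtain i j where n: "n = prod_encode (i, j)" by (rule bv_cases)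
    show "lin_ext (rr_basis q mu) (?r (bv n)) = bv n"
      by (simp add: n rr_basis_coord)
  qed (use rf in \<open>auto simp: mspace_vspan idx vspan_lookup rr_basis_hom\<close>)
  have inj: "inj_on (lin_ext (rr_basis q mu)) (mspace (tail_mod q mu l 0))"
  proof (rule inj_on_inverseI)
    fix v
    show "?r (lin_ext (rr_basis q mu) v) = v"
      by (rule vlin_eq_all[of "\<lambda>v. ?r (lin_ext (rr_basis q mu) v)" "\<lambda>v. v"])
        (auto simp: rf simp del: lin_ext_bv intro: vlin_comp[OF vlin_lin_ext vlin_lin_ext])
  qed
  show "is_rep q (tail_mod q mu l 0)"
  proof (rule rep_of_inj_hom[OF catO_rep[OF rr_catO] vlin_lin_ext rr_basis_hom inj])
    fix i n
    obtain k j where n: "n = prod_encode (k, j)" by (rule bv_cases)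
    show "wt (tail_mod q mu l 0) i n \<noteq> 0"
      using q_nz by (cases i) (simp_all add: n)
    show "act (tail_mod q mu l 0) i n \<in> hspace (tail_mod q mu l 0) (\<not> podd (tail_mod q mu l 0) n)"
      by (cases i; cases k; cases j) (auto simp: n idx hspace_vspan intro!: vspan_add vspan_single)
  qed
qed

end


section \<open>The successive quotients of the filtration\<close>

context osc_pair
begin

abbreviation "tail_proj m \<equiv> lin_ext (\<lambda>n. if m < snd (prod_decode n) then bv n else 0)"

lemma tail_proj_hom: "is_hom (tail_mod q mu l m) (tail_mod q mu l (Suc m)) (tail_proj m)"
proof (rule is_homI)
  fix n i
  assume "n \<in> idx (tail_mod q mu l m)"
  moreover obtain k j where n: "n = prod_encode (k, j)" by (rule bv_cases)
  ultimately have j: "m \<le> j" by simp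
  let ?\<phi> = "if m < snd (prod_decode n) then bv n else 0"
  show "?\<phi> \<in> hspace (tail_mod q mu l (Suc m)) (podd (tail_mod q mu l m) n)"
    by (auto simp: n hspace_vspan intro!: vspan_single)
  show "tail_proj m (act (tail_mod q mu l m) i n) = Eop (tail_mod q mu l (Suc m)) i ?\<phi>"
    using j by (cases i) (auto simp: n lin_ext_single vlin_add[OF vlin_lin_ext] vlin_zero)
  show "Kop (tail_mod q mu l (Suc m)) i ?\<phi> = cscale (wt (tail_mod q mu l m) i n) ?\<phi>"
    by (cases i) (auto simp: n Kop_bv vlin_zero)
qed

text \<open>Each quotient is the image of the preceding one under \<open>tail_proj\<close>, so the
  relations descend by induction from \<open>tail_0_rep\<close>.\<close>

lemma tail_rep: "is_rep q (tail_mod q mu l m)"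
proof (induction m)
  case 0
  show ?case by (rule tail_0_rep)
next
  case (Suc m)
  show ?case
  proof (rule rep_of_surj_hom[OF Suc vlin_lin_ext tail_proj_hom])
    show "mspace (tail_mod q mu l (Suc m)) \<subseteq> tail_proj m ` mspace (tail_mod q mu l m)"
    proof
      fix v assume v: "v \<in> mspace (tail_mod q mu l (Suc m))"
      have "tail_proj m v = v"
        by (rule mspace_eqI[OF _ _ _ v, of "tail_proj m" "\<lambda>v. v"]) (auto simp: tail_mod_def)
      moreover have "v \<in> mspace (tail_mod q mu l m)"
        using v by (auto simp: mspace_def tail_mod_def)
      ultimately show "v \<in> tail_proj m ` mspace (tail_mod q mu l m)"
        by (intro image_eqI[of v _ v]) simp_all
    qed
    fix i n
    assume "n \<in> idx (tail_mod q mu l (Suc m))"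
    moreover obtain k j where n: "n = prod_encode (k, j)" by (rule bv_cases)
    ultimately have j: "Suc m \<le> j" by simp
    show "wt (tail_mod q mu l (Suc m)) i n \<noteq> 0"
      using q_nz by (cases i) (simp_all add: n)
    show "act (tail_mod q mu l (Suc m)) i n \<in> hspace (tail_mod q mu l (Suc m)) (\<not> podd (tail_mod q mu l (Suc m)) n)"
      using j by (cases i; cases k; cases j) (auto simp: n hspace_vspan intro!: vspan_add vspan_single)
  qed
qed

lemma tail_catO: "tail_mod q mu l m \<in> catO q"
proof (rule catO_by_depth[OF tail_rep, where d = "\<lambda>n. fst (prod_decode n) + snd (prod_decode n)" and a = 1 and c = 1])
  fix N
  have "n \<in> prod_encode ` ({..N} \<times> {..N})" if "fst (prod_decode n) + snd (prod_decode n) = N" for n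
    using that by (intro image_eqI[of _ _ "prod_decode n"]) (auto simp: mem_Times_iff)
  then show "finite {n \<in> idx (tail_mod q mu l m). fst (prod_decode n) + snd (prod_decode n) = N}"
    by - (rule finite_subset[of _ "prod_encode ` ({..N} \<times> {..N})"], auto)
qed (auto simp: tail_mod_def split_beta)

text \<open>A vector (k, j) of the m-th summand satisfies m \<le> f m \<le> j \<le> k + j, so depth
  N bounds m, k and j by N. The swindle uses f as the identity and as \<open>Suc\<close>.\<close>

lemma dsum_tail_catO:
  assumes "\<And>m. m \<le> f m"
  shows "dsum (\<lambda>m. tail_mod q mu l (f m)) \<in> catO q"
proof (rule catO_by_depth[where a = 1 and c = 1 and
      d = "\<lambda>n. case prod_decode n of (m, p) \<Rightarrow> fst (prod_decode p) + snd (prod_decode p)"])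
  show "is_rep q (dsum (\<lambda>m. tail_mod q mu l (f m)))" by (intro dsum_rep tail_rep)
  fix N
  show "finite {n \<in> idx (dsum (\<lambda>m. tail_mod q mu l (f m))).
    (case prod_decode n of (m, p) \<Rightarrow> fst (prod_decode p) + snd (prod_decode p)) = N}"
  proof (rule finite_subset[of _ "(\<lambda>(m, k, j). prod_encode (m, prod_encode (k, j))) ` ({..N} \<times> {..N} \<times> {..N})"])
    show "{n \<in> idx (dsum (\<lambda>m. tail_mod q mu l (f m))).
        (case prod_decode n of (m, p) \<Rightarrow> fst (prod_decode p) + snd (prod_decode p)) = N}
      \<subseteq> (\<lambda>(m, k, j). prod_encode (m, prod_encode (k, j))) ` ({..N} \<times> {..N} \<times> {..N})"
    proof
      fix n assume n: "n \<in> {n \<in> idx (dsum (\<lambda>m. tail_mod q mu l (f m))).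
        (case prod_decode n of (m, p) \<Rightarrow> fst (prod_decode p) + snd (prod_decode p)) = N}"
      obtain m p where mp: "n = prod_encode (m, p)" by (rule bv_cases)
      obtain k j where kj: "p = prod_encode (k, j)" by (rule bv_cases)
      have "k + j = N" "f m \<le> j" using n by (auto simp: mp kj prod_encode_eq)
      with assms[of m] have "(m, k, j) \<in> {..N} \<times> {..N} \<times> {..N}" by auto
      then show "n \<in> (\<lambda>(m, k, j). prod_encode (m, prod_encode (k, j))) ` ({..N} \<times> {..N} \<times> {..N})"
        unfolding mp kj by (rule rev_image_eqI) simp
    qed
  qed simp
next
  fix n assume "n \<in> idx (dsum (\<lambda>m. tail_mod q mu l (f m)))"
  moreover obtain m p where mp: "n = prod_encode (m, p)" by (rule bv_cases)
  moreover obtain k j where kj: "p = prod_encode (k, j)" by (rule bv_cases)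
  ultimately show
    "wt (dsum (\<lambda>m. tail_mod q mu l (f m))) N0 n = q powi (2 * int (case prod_decode n of (m, p) \<Rightarrow> fst (prod_decode p) + snd (prod_decode p))) * 1"
    "wt (dsum (\<lambda>m. tail_mod q mu l (f m))) N1 n = q powi (- 2 * int (case prod_decode n of (m, p) \<Rightarrow> fst (prod_decode p) + snd (prod_decode p))) * 1"
    by simp_all
qed

end

section \<open>Products with locally finite sums\<close>

context generic_param
begin

lemma catO_transfer:
  assumes A: "A \<in> catO q" and B: "is_rep q B" and bij: "bij_betw \<phi> (idx A) (idx B)"
    and wt: "\<And>i j. i \<in> idx A \<Longrightarrow> wt B j (\<phi> i) = wt A j i"
  shows "B \<in> catO q"
  unfolding catO_def
proof (intro CollectI conjI allI B)
  have B': "idx B = \<phi> ` idx A" using bij by (simp add: bij_betw_def)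
  fix x y
  have "finite {i \<in> idx A. wt A N0 i = x \<and> wt A N1 i = y}" using A by (simp add: catO_def)
  moreover have "{i \<in> idx B. wt B N0 i = x \<and> wt B N1 i = y} = \<phi> ` {i \<in> idx A. wt A N0 i = x \<and> wt A N1 i = y}"
    unfolding B' using wt by auto
  ultimately show "finite {i \<in> idx B. wt B N0 i = x \<and> wt B N1 i = y}" by simp
  show "\<exists>Om. finite Om \<and> (\<forall>i\<in>idx B. \<exists>(a, c)\<in>Om. \<exists>n::nat.
      wt B N0 i = q powi (2 * int n) * a \<and> wt B N1 i = q powi (- 2 * int n) * c)"
    using A unfolding catO_def B' by (simp add: wt)
qed

text \<open>Distributivity over the direct sum is a weight-preserving bijection of bases, so
  finiteness is inherited from the tensor product with \<open>dsum A\<close>.\<close>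

lemma dsum_tensor_catO:
  assumes "\<And>m. A m \<in> catO q" "dsum A \<in> catO q" "D \<in> catO q"
  shows "dsum (\<lambda>m. tensor D (A m)) \<in> catO q" "dsum (\<lambda>m. tensor (A m) D) \<in> catO q"
proof -
  have rep: "is_rep q (dsum (\<lambda>m. tensor D (A m)))" "is_rep q (dsum (\<lambda>m. tensor (A m) D))"
    using assms by (simp_all add: dsum_rep tensor_rep catO_rep)
  have "bij_betw swap_ix (idx (tensor D (dsum A))) (idx (dsum (\<lambda>m. tensor D (A m))))"
    by (auto simp: bij_betw_def inj_on_def image_iff)
  then show "dsum (\<lambda>m. tensor D (A m)) \<in> catO q"
    by (intro catO_transfer[OF tensor_catO[OF assms(3,2)] rep(1), of swap_ix]) auto
  have "bij_betw assoc_ix (idx (tensor (dsum A) D)) (idx (dsum (\<lambda>m. tensor (A m) D)))"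
    by (auto simp: bij_betw_def inj_on_def image_iff)
  then show "dsum (\<lambda>m. tensor (A m) D) \<in> catO q"
    by (intro catO_transfer[OF tensor_catO[OF assms(2,3)] rep(2), of assoc_ix]) auto
qed

text \<open>Multiplication in the Grothendieck ring distributes over locally finite sums;
  \<open>B\<close> allows each product term to be replaced by an isomorphic module.\<close>

lemma gclass_tensor_dsum:
  assumes "\<And>m. A m \<in> catO q" "dsum A \<in> catO q" "D \<in> catO q"
    and B: "\<And>m. B m \<in> catO q" "dsum B \<in> catO q"
  shows "(\<And>m. mod_iso (tensor D (A m)) (B m)) \<Longrightarrow> gclass q D \<otimes>\<^bsub>groth q\<^esub> gclass q (dsum A) = gclass q (dsum B)"
    and "(\<And>m. mod_iso (tensor (A m) D) (B m)) \<Longrightarrow> gclass q (dsum A) \<otimes>\<^bsub>groth q\<^esub> gclass q D = gclass q (dsum B)"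
proof -
  note D = dsum_tensor_catO[OF assms(1-3)]
  have "gclass q D \<otimes>\<^bsub>groth q\<^esub> gclass q (dsum A) = gclass q (dsum (\<lambda>m. tensor D (A m)))"
    using assms D by (simp add: gclass_tensor) (intro gclass_iso tensor_dsum_iso tensor_catO)
  then show "(\<And>m. mod_iso (tensor D (A m)) (B m)) \<Longrightarrow> gclass q D \<otimes>\<^bsub>groth q\<^esub> gclass q (dsum A) = gclass q (dsum B)"
    using gclass_dsum_iso[of "\<lambda>m. tensor D (A m)" B] assms D tensor_catO by simp
  have "gclass q (dsum A) \<otimes>\<^bsub>groth q\<^esub> gclass q D = gclass q (dsum (\<lambda>m. tensor (A m) D))"
    using assms D by (simp add: gclass_tensor) (intro gclass_iso dsum_tensor_iso tensor_catO)
  then show "(\<And>m. mod_iso (tensor (A m) D) (B m)) \<Longrightarrow> gclass q (dsum A) \<otimes>\<^bsub>groth q\<^esub> gclass q D = gclass q (dsum B)"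
    using gclass_dsum_iso[of "\<lambda>m. tensor (A m) D" B] assms D tensor_catO by simp
qed

text \<open>Classes of genuine modules need no subtracted family, so the second family in
  \<open>groth_sums\<close> consists of zero modules.\<close>

lemma groth_sums_dsum:
  assumes "\<And>m. A m \<in> catO q" "dsum A \<in> catO q" "\<And>m. X m = gclass q (A m)"
  shows "groth_sums q X (gclass q (dsum A))"
proof -
  interpret ring "groth q" by (rule ring_groth)
  have Z: "idx (dsum (\<lambda>m. zero_mod)) = {}" by simp
  have "x \<ominus>\<^bsub>groth q\<^esub> \<zero>\<^bsub>groth q\<^esub> = x" if "x \<in> carrier (groth q)" for x
    using that by (simp add: a_minus_def)
  then show ?thesis
    unfolding groth_sums_def using assms catO_empty[OF Z]
    by (intro exI[of _ A] exI[of _ "\<lambda>m. zero_mod"])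
      (simp add: gclass_empty[OF Z] gclass_empty[OF idx_zero_mod] gclass_closed catO_empty)
qed

end

section \<open>One-dimensional modules and the geometric series\<close>

context qstar_param
begin

lemma U_simps:
  "idx (U_rep bs e p) = {0}" "podd (U_rep bs e p) i = (e \<noteq> 1)" "act (U_rep bs e p) j i = 0"
  "wt (U_rep bs e p) N0 i = of_int e * qspow bs (- p)" "wt (U_rep bs e p) N1 i = of_int e * qspow bs p"
  by (simp_all add: U_rep_def)

lemma U_catO: "e = 1 \<or> e = - 1 \<Longrightarrow> U_rep bs e p \<in> catO q"
  unfolding U_rep_def by (rule onedim_catO) auto

lemma U_one: "gclass q (U_rep bs 1 0) = \<one>\<^bsub>groth q\<^esub>"
  by (simp add: U_rep_def gclass_one)

lemma sign_power: "(- 1 :: int) ^ m = 1 \<or> (- 1 :: int) ^ m = - 1"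
  by (cases "even m") auto

lemma U_tensor_iso:
  assumes e: "e = 1 \<or> e = - 1" "e' = 1 \<or> e' = - 1"
  shows "mod_iso (tensor (U_rep bs e p) (U_rep bs e' p')) (U_rep bs (e * e') (p + p'))"
proof (rule mod_iso_relabel[of "\<lambda>_. 0"])
  show "bij_betw (\<lambda>_. 0) (idx (tensor (U_rep bs e p) (U_rep bs e' p'))) (idx (U_rep bs (e * e') (p + p')))"
    by (auto simp: bij_betw_def U_simps)
  fix n j assume "n \<in> idx (tensor (U_rep bs e p) (U_rep bs e' p'))"
  then have n: "n = prod_encode (0, 0)" by (simp add: U_simps)
  show "podd (U_rep bs (e * e') (p + p')) 0 = podd (tensor (U_rep bs e p) (U_rep bs e' p')) n"
    using e by (auto simp: n U_simps simp del: prod_encode_eq)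
  show "wt (U_rep bs (e * e') (p + p')) j 0 = wt (tensor (U_rep bs e p) (U_rep bs e' p')) j n"
    using qspow_add[of bs "- p" "- p'"]
    unfolding n by (cases j) (simp_all add: U_simps qspow_add)
  show "lin_ext (\<lambda>i. bv 0) (act (tensor (U_rep bs e p) (U_rep bs e' p')) j n) = act (U_rep bs (e * e') (p + p')) j 0"
    unfolding n by (simp add: U_simps)
qed

lemma U_mult:
  assumes "e = 1 \<or> e = - 1" "e' = 1 \<or> e' = - 1"
  shows "gclass q (U_rep bs e p) \<otimes>\<^bsub>groth q\<^esub> gclass q (U_rep bs e' p') = gclass q (U_rep bs (e * e') (p + p'))"
proof -
  have "e * e' = 1 \<or> e * e' = - 1" using assms by auto
  then show ?thesis
    using assms by (simp add: gclass_tensor U_catO) (intro gclass_iso U_tensor_iso tensor_catO U_catO)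
qed

lemma parity_power: "parity_elt q bs [^]\<^bsub>groth q\<^esub> (m::nat) = gclass q (U_rep bs ((- 1) ^ m) 0)"
proof -
  interpret ring "groth q" by (rule ring_groth)
  show ?thesis
  proof (induction m)
    case 0
    then show ?case by (simp add: U_one)
  next
    case (Suc m)
    then show ?case
      using U_mult[OF sign_power[of m], of "- 1" 0 0] by (simp add: parity_elt_def)
  qed
qed

text \<open>The sign superscript absorbs the parity power: the class of the m-th module is sigma^m
  [U_(p-2m)]. The value p = 0 gives the geometric series and p = -s gives f_s.\<close>

abbreviation U_fam :: "complex \<Rightarrow> nat \<Rightarrow> sbmod"
  where "U_fam p m \<equiv> U_rep bs ((- 1) ^ m) (p - 2 * of_nat m)"

lemma U_fam_catO: "U_fam p m \<in> catO q"
  by (intro U_catO sign_power)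

lemma wt_U_fam:
  "wt (U_fam p m) N0 i = q powi (2 * int m) * qspow bs (- p)"
  "wt (U_fam p m) N1 i = q powi (- 2 * int m) * qspow bs p"
proof -
  have "qspow bs (- (p - 2 * of_nat m)) = qspow bs (2 * of_nat m) * qspow bs (- p)"
    "qspow bs (p - 2 * of_nat m) = qspow bs (- 2 * of_nat m) * qspow bs p"
    by (simp_all flip: qspow_add)
  moreover have "(- 1) ^ m * ((- 1) ^ m * x) = x" for x :: complex
    by (simp flip: mult.assoc power_add mult_2)
  ultimately show "wt (U_fam p m) N0 i = q powi (2 * int m) * qspow bs (- p)"
    "wt (U_fam p m) N1 i = q powi (- 2 * int m) * qspow bs p"
    by (simp_all only: U_simps qspow_2k qspow_minus_2k) (simp_all add: mult_ac)
qed

lemma dsum_U_fam_catO: "dsum (U_fam p) \<in> catO q"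
proof (rule catO_by_depth[where d = "\<lambda>n. fst (prod_decode n)" and a = "qspow bs (- p)" and c = "qspow bs p"])
  show "is_rep q (dsum (U_fam p))" by (intro dsum_rep catO_rep U_fam_catO)
  show "finite {n \<in> idx (dsum (U_fam p)). fst (prod_decode n) = N}" for N
    by (rule finite_subset[of _ "{prod_encode (N, 0)}"]) (auto simp: U_simps)
qed (auto simp: wt_U_fam)

lemma dsum_U_fam_Suc:
  "gclass q (dsum (U_fam p)) = gclass q (U_fam p 0) \<oplus>\<^bsub>groth q\<^esub> gclass q (dsum (\<lambda>m. U_fam p (Suc m)))"
    and dsum_U_fam_Suc_catO: "dsum (\<lambda>m. U_fam p (Suc m)) \<in> catO q"
proof -
  show c: "dsum (\<lambda>m. U_fam p (Suc m)) \<in> catO q"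
  \<comment> \<open>The shifted family keeps the apex of the full one, hence the depth with
    \<open>Suc\<close>.\<close>
  proof (rule catO_by_depth[where d = "\<lambda>n. Suc (fst (prod_decode n))" and a = "qspow bs (- p)" and c = "qspow bs p"])
    show "is_rep q (dsum (\<lambda>m. U_fam p (Suc m)))" by (intro dsum_rep catO_rep U_fam_catO)
    show "finite {n \<in> idx (dsum (\<lambda>m. U_fam p (Suc m))). Suc (fst (prod_decode n)) = N}" for N
      by (rule finite_subset[of _ "{prod_encode (N - 1, 0)}"]) (auto simp: U_simps)
  qed (auto simp: wt_U_fam simp del: power_Suc of_nat_Suc)
  show "gclass q (dsum (U_fam p)) = gclass q (U_fam p 0) \<oplus>\<^bsub>groth q\<^esub> gclass q (dsum (\<lambda>m. U_fam p (Suc m)))"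
    by (intro gclass_exact c dsum_U_fam_catO U_fam_catO short_exact_dsum_Suc[of q "U_fam p"] catO_rep)
qed

text \<open>Tensoring with u = sigma [U_(-2)] shifts the family by one, so u G and G u both equal
  the sum of the terms from m = 1 on, which is G - 1. Both orders are computed because a unit needs
  a two-sided inverse.\<close>

lemma geometric_inverse:
  defines "u \<equiv> parity_elt q bs \<otimes>\<^bsub>groth q\<^esub> gclass q (U_rep bs 1 (- 2))"
  shows "\<one>\<^bsub>groth q\<^esub> \<ominus>\<^bsub>groth q\<^esub> u \<in> Units (groth q)"
    and "inv\<^bsub>groth q\<^esub> (\<one>\<^bsub>groth q\<^esub> \<ominus>\<^bsub>groth q\<^esub> u) = gclass q (dsum (U_fam 0))"
proof -
  interpret ring "groth q" by (rule ring_groth)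
  let ?G = "gclass q (dsum (U_fam 0))" and ?V = "U_rep bs (- 1) (- 2)"
  have u: "u = gclass q ?V"
    using U_mult[of "- 1" 1 0 "- 2"] by (simp add: u_def parity_elt_def)
  have V: "?V \<in> catO q" by (simp add: U_catO)
  have ucl: "u \<in> carrier (groth q)" unfolding u by (intro gclass_closed V)
  have G: "?G \<in> carrier (groth q)" by (intro gclass_closed dsum_U_fam_catO)
  have S: "?G = \<one>\<^bsub>groth q\<^esub> \<oplus>\<^bsub>groth q\<^esub> gclass q (dsum (\<lambda>m. U_fam 0 (Suc m)))"
    using dsum_U_fam_Suc[of 0] by (simp add: U_one)
  have iso: "mod_iso (tensor ?V (U_fam 0 m)) (U_fam 0 (Suc m))" "mod_iso (tensor (U_fam 0 m) ?V) (U_fam 0 (Suc m))" for m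
    using U_tensor_iso[OF _ sign_power, of "- 1" "- 2" m "0 - 2 * of_nat m"]
      U_tensor_iso[OF sign_power, of "- 1" m "0 - 2 * of_nat m" "- 2"]
    by (simp_all add: algebra_simps)
  have uG: "u \<otimes>\<^bsub>groth q\<^esub> ?G = gclass q (dsum (\<lambda>m. U_fam 0 (Suc m)))"
    and Gu: "?G \<otimes>\<^bsub>groth q\<^esub> u = gclass q (dsum (\<lambda>m. U_fam 0 (Suc m)))"
    unfolding u by (rule gclass_tensor_dsum U_fam_catO dsum_U_fam_catO dsum_U_fam_Suc_catO V iso)+
  have H: "gclass q (dsum (\<lambda>m. U_fam 0 (Suc m))) \<in> carrier (groth q)"
    by (intro gclass_closed dsum_U_fam_Suc_catO)
  have 1: "(\<one>\<^bsub>groth q\<^esub> \<ominus>\<^bsub>groth q\<^esub> u) \<otimes>\<^bsub>groth q\<^esub> ?G = \<one>\<^bsub>groth q\<^esub>"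
    and 2: "?G \<otimes>\<^bsub>groth q\<^esub> (\<one>\<^bsub>groth q\<^esub> \<ominus>\<^bsub>groth q\<^esub> u) = \<one>\<^bsub>groth q\<^esub>"
  proof -
    have "(\<one>\<^bsub>groth q\<^esub> \<ominus>\<^bsub>groth q\<^esub> u) \<otimes>\<^bsub>groth q\<^esub> ?G = ?G \<ominus>\<^bsub>groth q\<^esub> u \<otimes>\<^bsub>groth q\<^esub> ?G"
      using ucl G by (simp add: a_minus_def l_distr l_minus)
    also have "\<dots> = \<one>\<^bsub>groth q\<^esub>"
      unfolding uG using S H by (simp add: a_minus_def a_assoc r_neg)
    finally show "(\<one>\<^bsub>groth q\<^esub> \<ominus>\<^bsub>groth q\<^esub> u) \<otimes>\<^bsub>groth q\<^esub> ?G = \<one>\<^bsub>groth q\<^esub>" .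
    have "?G \<otimes>\<^bsub>groth q\<^esub> (\<one>\<^bsub>groth q\<^esub> \<ominus>\<^bsub>groth q\<^esub> u) = ?G \<ominus>\<^bsub>groth q\<^esub> ?G \<otimes>\<^bsub>groth q\<^esub> u"
      using ucl G by (simp add: a_minus_def r_distr r_minus)
    also have "\<dots> = \<one>\<^bsub>groth q\<^esub>"
      unfolding Gu using S H by (simp add: a_minus_def a_assoc r_neg)
    finally show "?G \<otimes>\<^bsub>groth q\<^esub> (\<one>\<^bsub>groth q\<^esub> \<ominus>\<^bsub>groth q\<^esub> u) = \<one>\<^bsub>groth q\<^esub>" .
  qed
  have c: "\<one>\<^bsub>groth q\<^esub> \<ominus>\<^bsub>groth q\<^esub> u \<in> carrier (groth q)" using ucl by simp
  show U: "\<one>\<^bsub>groth q\<^esub> \<ominus>\<^bsub>groth q\<^esub> u \<in> Units (groth q)"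
    unfolding Units_def using c G 1 2 by blast
  show "inv\<^bsub>groth q\<^esub> (\<one>\<^bsub>groth q\<^esub> \<ominus>\<^bsub>groth q\<^esub> u) = ?G"
    using c G 1 2 by (rule_tac inv_unique'[symmetric]) auto
qed

lemma U_shift_dsum:
  "gclass q (U_rep bs 1 p) \<otimes>\<^bsub>groth q\<^esub> gclass q (dsum (U_fam 0)) = gclass q (dsum (U_fam p))"
proof (rule gclass_tensor_dsum(1)[OF U_fam_catO dsum_U_fam_catO _ U_fam_catO dsum_U_fam_catO])
  show "U_rep bs 1 p \<in> catO q" by (simp add: U_catO)
  show "mod_iso (tensor (U_rep bs 1 p) (U_fam 0 m)) (U_fam p m)" for m
    using U_tensor_iso[OF _ sign_power, of 1 p m "0 - 2 * of_nat m"] by simp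
qed

section \<open>The graded pieces and the class of the tensor product\<close>

abbreviation UW_fam :: "complex \<Rightarrow> complex \<Rightarrow> nat \<Rightarrow> sbmod"
  where "UW_fam s l m \<equiv> tensor (U_rep bs 1 (- s - 2 * of_nat m)) (W_rep bs s ((- 1) ^ m) l)"

lemma UW_fam_catO: "UW_fam s l m \<in> catO q"
  by (intro tensor_catO U_catO W_catO sign_power) simp

lemma idx_UW: "idx (UW_fam s l m) = range (\<lambda>k. prod_encode (0, k))"
  by (auto simp: U_simps W_simps[OF sign_power])

text \<open>The weight q_*^s of K_0 on U cancels the apex weight q_*^(-s) of W, and -2m lowers the
  piece by m steps. The result agrees with the weights of |k, m> in \<open>tail_mod\<close>.\<close>

lemma wt_UW:
  "wt (UW_fam s l m) N0 (prod_encode (0, k)) = q powi (2 * int (k + m))"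
  "wt (UW_fam s l m) N1 (prod_encode (0, k)) = q powi (- 2 * int (k + m))"
proof -
  have "q powi (2 * int (k + m)) = q powi (2 * int k) * q powi (2 * int m)"
    "q powi (- 2 * int (k + m)) = q powi (- 2 * int k) * q powi (- 2 * int m)"
    using q_nz by (simp_all add: distrib_left power_int_add power_int_diff power_int_minus field_simps)
  \<comment> \<open>The sign of W is moved to the factor U, where \<open>wt_U_fam\<close> absorbs
    it.\<close>
  moreover have "wt (UW_fam s l m) N0 (prod_encode (0, k)) = wt (U_fam (- s) m) N0 0 * q powi (2 * int k) * qspow bs (- s)"
    "wt (UW_fam s l m) N1 (prod_encode (0, k)) = wt (U_fam (- s) m) N1 0 * q powi (- 2 * int k) * qspow bs s"
    by (simp_all add: U_simps W_simps[OF sign_power])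
  ultimately show "wt (UW_fam s l m) N0 (prod_encode (0, k)) = q powi (2 * int (k + m))"
    "wt (UW_fam s l m) N1 (prod_encode (0, k)) = q powi (- 2 * int (k + m))"
    unfolding wt_U_fam by (simp_all add: qspow_minus)
qed

lemma dsum_UW_catO: "dsum (UW_fam s l) \<in> catO q"
proof (rule catO_by_depth[where d = "\<lambda>n. case prod_decode n of (m, p) \<Rightarrow> snd (prod_decode p) + m" and a = 1 and c = 1])
  let ?d = "\<lambda>n. case prod_decode n of (m, p) \<Rightarrow> snd (prod_decode p) + m"
  show "is_rep q (dsum (UW_fam s l))" by (intro dsum_rep catO_rep UW_fam_catO)
  fix N
  show "finite {n \<in> idx (dsum (UW_fam s l)). ?d n = N}"
  proof (rule finite_subset[of _ "(\<lambda>(m, k). prod_encode (m, prod_encode (0, k))) ` ({..N} \<times> {..N})"])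
    show "{n \<in> idx (dsum (UW_fam s l)). ?d n = N} \<subseteq> (\<lambda>(m, k). prod_encode (m, prod_encode (0, k))) ` ({..N} \<times> {..N})"
      unfolding dsum_simps idx_UW by (auto simp: image_iff)
  qed simp
next
  fix n assume "n \<in> idx (dsum (UW_fam s l))"
  then obtain m k where n: "n = prod_encode (m, prod_encode (0, k))"
    unfolding dsum_simps idx_UW by auto
  show "wt (dsum (UW_fam s l)) N0 n = q powi (2 * int (case prod_decode n of (m, p) \<Rightarrow> snd (prod_decode p) + m)) * 1"
    "wt (dsum (UW_fam s l)) N1 n = q powi (- 2 * int (case prod_decode n of (m, p) \<Rightarrow> snd (prod_decode p) + m)) * 1"
    unfolding n dsum_simps wt_UW by simp_all
qed

text \<open>
  Tensoring with \<open>U\<close> on the right multiplies the action of \<open>\<E>\<^sub>0\<close> by \<open>\<K>\<^sub>0\<close> of \<open>U\<close> and that of \<open>\<E>\<^sub>1\<close>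
  by its inverse, which rescaling the basis undoes.
\<close>

lemma WU_iso: "mod_iso (tensor (W_rep bs s 1 l) (U_fam (- s) m)) (UW_fam s l m)"
proof -
  define p where "p = - s - 2 * of_nat m"
  define e :: int where "e = (- 1) ^ m"
  have e: "e = 1 \<or> e = - 1" unfolding e_def by (rule sign_power)
  define \<phi> where "\<phi> = (\<lambda>n. prod_encode (0, fst (prod_decode n)))"
  define z where "z = of_int e * qspow bs p"
  have z: "z \<noteq> 0" using e by (auto simp: z_def)
  have zi: "z * (of_int e * qspow bs (- p)) = 1"
    using e by (auto simp: z_def qspow_minus)
  \<comment> \<open>The k-th vector is rescaled by the k-th power of the eigenvalue z of K_1 on U;
    by \<open>zi\<close> the eigenvalue of K_0 is 1/z.\<close>
  define c where "c = (\<lambda>n. z ^ fst (prod_decode n))"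
  have "mod_iso (tensor (W_rep bs s 1 l) (U_rep bs e p)) (tensor (U_rep bs 1 p) (W_rep bs s e l))"
  proof (rule mod_iso_rescale[of \<phi> _ _ c])
    show "bij_betw \<phi> (idx (tensor (W_rep bs s 1 l) (U_rep bs e p))) (idx (tensor (U_rep bs 1 p) (W_rep bs s e l)))"
      by (auto simp: bij_betw_def inj_on_def \<phi>_def U_simps W_simps[OF e] W_simps[of 1, simplified] image_iff)
    show "c n \<noteq> 0" for n using z by (simp add: c_def)
    fix n j assume "n \<in> idx (tensor (W_rep bs s 1 l) (U_rep bs e p))"
    then obtain k where n: "n = prod_encode (k, 0)" by (auto simp: U_simps)
    have \<phi>: "\<phi> (prod_encode (k, 0)) = prod_encode (0, k)" by (simp add: \<phi>_def)
    note W = W_simps[of 1, OF disjI1[OF refl]] W_simps[OF e]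
    show "podd (tensor (U_rep bs 1 p) (W_rep bs s e l)) (\<phi> n) = podd (tensor (W_rep bs s 1 l) (U_rep bs e p)) n"
      unfolding n \<phi> tensor_simps U_simps W using e by (cases "even k") auto
    show "wt (tensor (U_rep bs 1 p) (W_rep bs s e l)) j (\<phi> n) = wt (tensor (W_rep bs s 1 l) (U_rep bs e p)) j n"
      unfolding n \<phi> by (cases j) (simp_all add: U_simps W)
    show "lin_ext (\<lambda>i. Poly_Mapping.single (\<phi> i) (c i)) (act (tensor (W_rep bs s 1 l) (U_rep bs e p)) j n) =
      cscale (c n) (act (tensor (U_rep bs 1 p) (W_rep bs s e l)) j (\<phi> n))"
    proof (cases j)
      case N0
      have "l * (of_int e * qspow bs (- p)) * (z * z ^ k) = (z * (of_int e * qspow bs (- p))) * (z ^ k * l)"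
        by (simp only: mult_ac)
      then have eq: "l * (of_int e * qspow bs (- p)) * (z * z ^ k) = z ^ k * l"
        unfolding zi by simp
      show ?thesis
        unfolding n \<phi> N0 by (simp add: U_simps W tens_vec_single lin_ext_single \<phi>_def c_def eq)
    next
      case N1
      show ?thesis
      proof (cases k)
        case (Suc k')
        then show ?thesis
          unfolding n \<phi> N1
          by (simp add: U_simps W tens_vec_single lin_ext_single \<phi>_def c_def z_def[symmetric] del: of_nat_Suc)
            (simp only: mult_ac)
      next
        case 0
        then show ?thesis unfolding n \<phi> N1 by (simp add: U_simps W vlin_zero)
      qed
    qed
  qed
  then show ?thesis by (simp add: p_def e_def)
qed

lemma W_dsum_U:
  "gclass q (W_rep bs s 1 l) \<otimes>\<^bsub>groth q\<^esub> gclass q (dsum (U_fam (- s))) = gclass q (dsum (UW_fam s l))"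
  by (rule gclass_tensor_dsum(1)[OF U_fam_catO dsum_U_fam_catO _ UW_fam_catO dsum_UW_catO WU_iso])
    (simp add: W_catO)

text \<open>The submodule is spanned by the vectors with j = m, where the term of E_1 that lowers j
  is absent. U is even with E_i = 0, so E_i acts on U \<otimes> W through W alone.\<close>

lemma UW_tail_exact:
  fixes s l :: complex
  defines "mu \<equiv> qspow bs (s / 2 + 1 / 2)"
  shows "short_exact (UW_fam s l m) (tail_mod q mu l m) (tail_mod q mu l (Suc m))"
proof -
  interpret osc_pair q mu by unfold_locales (simp add: mu_def)
  let ?f = "lin_ext (\<lambda>n. bv (prod_encode (snd (prod_decode n), m)))"
  let ?r = "lin_ext (\<lambda>n. case prod_decode n of (k, j) \<Rightarrow> if j = m then bv (prod_encode (0, k)) else 0)"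
  \<comment> \<open>The basis of the quotient is part of the basis of the middle term, so the
    identity is a section.\<close>
  have "split_exact (UW_fam s l m) (tail_mod q mu l m) (tail_mod q mu l (Suc m)) ?f (tail_proj m) ?r (\<lambda>v. v)"
    unfolding split_exact_def
  proof (intro conjI ballI)
    show "is_hom (UW_fam s l m) (tail_mod q mu l m) ?f"
    proof (rule is_homI)
      fix n j assume "n \<in> idx (UW_fam s l m)"
      then obtain k where n: "n = prod_encode (0, k)" unfolding idx_UW by blast
      note W = W_simps[OF sign_power]
      show "bv (prod_encode (snd (prod_decode n), m)) \<in> hspace (tail_mod q mu l m) (podd (UW_fam s l m) n)"
        unfolding n hspace_vspan tensor_simps U_simps W
        by (cases "even m"; cases "even k") (auto intro!: vspan_single)
      \<comment> \<open>Here mu is tied to s: \<open>qsnum_prod\<close> identifies the lowering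
        coefficient of the tail with that of W.\<close>
      show "?f (act (UW_fam s l m) j n) = Eop (tail_mod q mu l m) j (bv (prod_encode (snd (prod_decode n), m)))"
        using qsnum_prod[of mu s k]
        by (cases j) (simp_all add: n U_simps W tens_vec_single lin_ext_single mu_def)
      show "Kop (tail_mod q mu l m) j (bv (prod_encode (snd (prod_decode n), m))) =
        cscale (wt (UW_fam s l m) j n) (bv (prod_encode (snd (prod_decode n), m)))"
        by (cases j) (simp_all only: n wt_UW Kop_bv tail_simps prod_encode_inverse snd_conv cscale_single mult_1_right)
    qed
    show "is_hom (tail_mod q mu l m) (tail_mod q mu l (Suc m)) (tail_proj m)" by (rule tail_proj_hom)
  next
    fix n assume "n \<in> idx (tail_mod q mu l m)"
    moreover obtain k j where n: "n = prod_encode (k, j)" by (rule bv_cases)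
    ultimately have j: "m \<le> j" by simp
    show "?r (bv n) \<in> mspace (UW_fam s l m)"
      unfolding mspace_vspan idx_UW by (auto simp: n intro!: vspan_single)
    show "?f (?r (bv n)) + tail_proj m (bv n) = bv n"
      using j by (auto simp: n vlin_zero)
  next
    fix n assume "n \<in> idx (UW_fam s l m)"
    then obtain k where n: "n = prod_encode (0, k)" unfolding idx_UW by blast
    show "?r (?f (bv n)) = bv n" "tail_proj m (?f (bv n)) = 0" by (simp_all add: n)
  next
    fix n assume "n \<in> idx (tail_mod q mu l (Suc m))"
    moreover obtain k j where n: "n = prod_encode (k, j)" by (rule bv_cases)
    ultimately have j: "m < j" by simp
    show "bv n \<in> mspace (tail_mod q mu l m)"
      using j by (auto simp: n mspace_vspan intro!: vspan_single)
    show "tail_proj m (bv n) = bv n" using j by (simp add: n)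
  qed auto
  then show ?thesis by (rule split_exact_short_exact)
qed

text \<open>\<open>gclass_filtration\<close> applies with the tails as quotients and
  \<open>UW_fam\<close> as graded pieces, and \<open>rr_iso\<close> identifies the first tail with
  the tensor product.\<close>

lemma rho_rho_class:
  fixes s l :: complex
  defines "mu \<equiv> qspow bs (s / 2 + 1 / 2)"
  shows "gclass q (tensor (rho_plus q (l * mu)) (rho_minus q (l * inverse mu))) = gclass q (dsum (UW_fam s l))"
proof -
  interpret osc_pair q mu by unfold_locales (simp add: mu_def)
  have "gclass q (tail_mod q mu l 0) = gclass q (dsum (UW_fam s l))"
    using UW_tail_exact[where s = s and l = l]
    by (intro gclass_filtration[of "UW_fam s l" "tail_mod q mu l"] UW_fam_catO tail_catO dsum_UW_catO
        dsum_tail_catO[of "\<lambda>m. m"] dsum_tail_catO[of Suc]) (auto simp: mu_def)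
  moreover have "gclass q (tail_mod q mu l 0) = gclass q (rr_mod q mu l)"
    by (intro gclass_iso tail_catO rr_catO rr_iso)
  ultimately show ?thesis by (simp add: rr_mod_def)
qed

end

theorem mainTheorem4:
  fixes b bs s lam q mu :: complex
  assumes "b\<^sup>2 = bs\<^sup>2 + 1 / 2"
    and "q = qpar b"
    and generic: "\<forall>n::nat. n > 0 \<longrightarrow> q ^ n \<noteq> 1"
    and "mu = qspow bs (s / 2 + 1 / 2)"
  shows "groth_sums q
      (\<lambda>m. gclass q (tensor (U_rep bs 1 (- s - 2 * of_nat m)) (W_rep bs s ((- 1) ^ m) lam)))
      (gclass q (tensor (rho_plus q (lam * mu)) (rho_minus q (lam * inverse mu))))
    \<and> (\<exists>f. groth_sums q
        (\<lambda>m. (parity_elt q bs [^]\<^bsub>groth q\<^esub> m)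
              \<otimes>\<^bsub>groth q\<^esub> gclass q (U_rep bs 1 (- s - 2 * of_nat m))) f
      \<and> \<one>\<^bsub>groth q\<^esub> \<ominus>\<^bsub>groth q\<^esub> parity_elt q bs \<otimes>\<^bsub>groth q\<^esub> gclass q (U_rep bs 1 (- 2))
          \<in> Units (groth q)
      \<and> f = gclass q (U_rep bs 1 (- s)) \<otimes>\<^bsub>groth q\<^esub>
          inv\<^bsub>groth q\<^esub> (\<one>\<^bsub>groth q\<^esub> \<ominus>\<^bsub>groth q\<^esub>
            parity_elt q bs \<otimes>\<^bsub>groth q\<^esub> gclass q (U_rep bs 1 (- 2)))
      \<and> gclass q (rho_plus q (qspow bs (s / 2 + 1 / 2) * lam))
          \<otimes>\<^bsub>groth q\<^esub> gclass q (rho_minus q (qspow bs (- s / 2 - 1 / 2) * lam))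
        = gclass q (W_rep bs s 1 lam) \<otimes>\<^bsub>groth q\<^esub> f)"
proof -
  \<comment> \<open>The shift 1/2 between the squares of b and bs contributes exp (pi i / 2) =
    i.\<close>
  have q: "q = \<i> * qspow bs 1"
  proof -
    have "\<i> * of_real pi * b\<^sup>2 = \<i> * of_real pi / 2 + \<i> * of_real pi * bs\<^sup>2 * 1"
      unfolding assms(1) by (simp add: algebra_simps)
    then have "q = exp (\<i> * of_real pi / 2) * qspow bs 1"
      unfolding assms(2) qpar_def qspow_def by (simp only: exp_add)
    also have "exp (\<i> * of_real pi / 2) = \<i>"
      using cis_conv_exp[of "pi / 2"] by simp
    finally show ?thesis .
  qed
  interpret qstar_param q bs
    using generic q by unfold_locales auto
  have rho: "rho q e l \<in> catO q" if "e = 1 \<or> e = - 1" for e l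
    using that by (rule rho_catO)
  have rr: "gclass q (tensor (rho_plus q (lam * mu)) (rho_minus q (lam * inverse mu))) = gclass q (dsum (UW_fam s lam))"
    unfolding assms(4) by (rule rho_rho_class)
  have sum1: "groth_sums q
      (\<lambda>m. gclass q (tensor (U_rep bs 1 (- s - 2 * of_nat m)) (W_rep bs s ((- 1) ^ m) lam)))
      (gclass q (tensor (rho_plus q (lam * mu)) (rho_minus q (lam * inverse mu))))"
    unfolding rr by (rule groth_sums_dsum[OF UW_fam_catO dsum_UW_catO refl])
  have sum2: "groth_sums q
        (\<lambda>m. (parity_elt q bs [^]\<^bsub>groth q\<^esub> m)
              \<otimes>\<^bsub>groth q\<^esub> gclass q (U_rep bs 1 (- s - 2 * of_nat m))) (gclass q (dsum (U_fam (- s))))"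
    by (rule groth_sums_dsum[OF U_fam_catO dsum_U_fam_catO])
      (use U_mult[OF sign_power, of 1 _ 0] in \<open>simp add: parity_power\<close>)
  have "- s / 2 - 1 / 2 = - (s / 2 + 1 / 2)" by (simp add: field_simps)
  then have mu': "qspow bs (- s / 2 - 1 / 2) = inverse mu"
    unfolding assms(4) qspow_minus[symmetric] by simp
  have "gclass q (rho_plus q (mu * lam)) \<otimes>\<^bsub>groth q\<^esub> gclass q (rho_minus q (inverse mu * lam)) =
      gclass q (tensor (rho_plus q (lam * mu)) (rho_minus q (lam * inverse mu)))"
    by (simp add: gclass_tensor rho mult.commute)
  also have "\<dots> = gclass q (W_rep bs s 1 lam) \<otimes>\<^bsub>groth q\<^esub> gclass q (dsum (U_fam (- s)))"
    unfolding rr W_dsum_U ..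
  \<comment> \<open>The witness for f_s is the class of the direct sum of
    \<open>U_fam (- s)\<close>; \<open>U_shift_dsum\<close> and \<open>geometric_inverse\<close>
    rewrite it as the quotient.\<close>
  finally show ?thesis
    using sum1 sum2 geometric_inverse U_shift_dsum[of "- s"]
    unfolding mu' assms(4)[symmetric] by (intro conjI exI[of _ "gclass q (dsum (U_fam (- s)))"]) simp_all
qed

end
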